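(* The annihilation Lie superalgebra $\mathfrak g(RE(5,10))$ of the Lie conformal superalgebra $RE(5,10)$ is isomorphic, as a $\mathbb Z$-graded Lie superalgebra, to $E(5,10)$ with its principal gradation, under the map $\Phi$ (extended linearly and continuously) $$a_{ij}\boldsymbol y^M\mapsto -m_i\boldsymbol x^{M-e_i}\partial_{x_j}+m_j\boldsymbol x^{M-e_j}\partial_{x_i},\qquad b_k\boldsymbol y^M\mapsto\sum_{r\ne k}m_r\boldsymbol x^{M-e_r}d_{kr},$$ for $i,j,k\in\{1,\dots,5\}$ and $M=(m_1,\dots,m_5)\in\mathbb Z_{\ge0}^5$, where $e_i$ is the $i$-th unit vector.
   Context: $\mathbb F$ is an algebraically closed field of characteristic $0$; $\boldsymbol\lambda=(\lambda_1,\dots,\lambda_5)$, $\boldsymbol\partial$, $\boldsymbol y$, $\boldsymbol x$ are sets of five even commuting variables, with multi-exponent notation $\boldsymbol y^M=y_1^{m_1}\cdots y_5^{m_5}$, $|M|=\sum m_i$. A Lie conformal superalgebra of type $(5,0)$ is a $\mathbb Z/2$-graded $\mathbb F[\boldsymbol\partial]$-module $R$ with a parity-preserving linear $\boldsymbol\lambda$-bracket $R\otimes R\to\mathbb F[\boldsymbol\lambda]\otimes R$ satisfying $[(\partial_ia)_{\boldsymbol\lambda}b]=-\lambda_i[a_{\boldsymbol\lambda}b]$, $[a_{\boldsymbol\lambda}(\partial_ib)]=(\partial_i+\lambda_i)[a_{\boldsymbol\lambda}b]$, $[b_{\boldsymbol\lambda}a]=-(-1)^{p(a)p(b)}[a_{-\boldsymbol\lambda-\boldsymbol\partial}b]$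 and $[a_{\boldsymbol\lambda}[b_{\boldsymbol\mu}c]]=[[a_{\boldsymbol\lambda}b]_{\boldsymbol\lambda+\boldsymbol\mu}c]+(-1)^{p(a)p(b)}[b_{\boldsymbol\mu}[a_{\boldsymbol\lambda}c]]$. $RE(5,10)$: in the free $\mathbb F[\boldsymbol\partial]$-module on even generators $\partial_{x_i}$ ($1\le i\le5$) and odd generators $d_{jk}$ ($j<k$; $d_{kj}=-d_{jk}$, $d_{jj}=0$), it is the submodule generated by the even elements $a_{ij}=\partial_i\partial_{x_j}-\partial_j\partial_{x_i}$ and the odd elements $b_k=\sum_h\partial_hd_{hk}$. Its $\boldsymbol\lambda$-bracket is the one determined by sesquilinearity, skew-symmetry and $[{a_{ij}}_{\boldsymbol\lambda}a_{rs}]=\lambda_j\lambda_ra_{si}+\lambda_i\lambda_ra_{js}+\lambda_i\lambda_sa_{rj}+\lambda_j\lambda_sa_{ir}+\lambda_i\partial_ja_{rs}+\lambda_j\partial_ia_{sr}$; $[{a_{ij}}_{\boldsymbol\lambda}b_k]=(\lambda_i\partial_j-\lambda_j\partial_i)b_k+(\delta_{ik}\lambda_j-\delta_{jk}\lambda_i)\sum_r\lambda_rb_r$; $[{b_i}_{\boldsymbol\lambda}b_i]=0$; and for $i\ne j$, $[{b_i}_{\boldsymbol\lambda}b_j]=\varepsilon_{ijhkl}(\lambda_ha_{kl}+\lambda_ka_{lh}+\lambda_la_{hk})$, $\{i,j,h,k,l\}=\{1,\dots,5\}$, $\varepsilon_{ijhkl}$ the sign of the permutation. It is $\mathbb Z$-graded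 with $\deg a_{ij}=-4$, $\deg b_k=-3$, $\deg\partial_i=\deg\lambda_i=-2$. Annihilation superalgebra: $\mathcal A(R)=(R\otimes\mathbb F[[\boldsymbol y]])/\sum_i(\partial_i+\partial_{y_i})(R\otimes\mathbb F[[\boldsymbol y]])$ with (continuous) bracket $[a\boldsymbol y^M,b\boldsymbol y^N]=\sum_J\frac1{J!}(a_Jb)(\partial_{\boldsymbol y}^J\boldsymbol y^M)\boldsymbol y^N$, where $[a_{\boldsymbol\lambda}b]=\sum_J\frac{\boldsymbol\lambda^J}{J!}(a_Jb)$; gradation $\deg(a\boldsymbol y^M)=\deg a+2|M|$. $\mathfrak g(R)=(D\ltimes\mathcal A(R))/\{x-\mathrm{ad}(x):x\in\mathcal A(R)_{-2}\}$, $D=\langle\partial_{y_1},\dots,\partial_{y_5}\rangle$, which for $R=RE(5,10)$ is identified with $\mathcal A(R)$. $E(5,10)$: the even part is $S_5=\{X=\sum_{i=1}^5f_i\partial_{x_i}: f_i\in\mathbb F[[x_1,\dots,x_5]],\ \sum_i\partial f_i/\partial x_i=0\}$ with the commutator; the odd part is the space $\Omega^2_{cl}$ of closed $2$-forms in $x_1,\dots,x_5$ with formal power series coefficients; $S_5$ acts on $\Omega^2_{cl}$ by Lie derivative; and, with $d_{ij}=dx_i\wedge dx_j$, $[f\,d_{ij},g\,d_{kl}]=\varepsilon_{ijkl}fg\,\partial_{x_t}$ (extended bilinearly), where for distinct $i,j,k,l$ the index $t$ is the remaining one and $\varepsilon_{ijkl}$ is the sign of $(i,j,k,l,t)$, and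 $\varepsilon_{ijkl}=0$ otherwise. Principal gradation: for $k\ge0$, $E(5,10)_{2k-2}$ consists of the elements of $S_5$ with coefficients homogeneous of degree $k$, and $E(5,10)_{2k-1}$ of the closed $2$-forms with coefficients homogeneous of degree $k$. *)

theory Defs
  imports
    "HOL-Library.Function_Algebras"
    "HOL-Library.Product_Plus"
    "HOL-Library.Set_Algebras"
    "HOL-Library.Poly_Mapping"
    "HOL-Library.Z2"
    "HOL-Combinatorics.Permutations"
    "HOL-Computational_Algebra.Polynomial"
begin

section \<open>Multi-exponents, polynomials and formal power series in five variables\<close>

datatype ix = I1 | I2 | I3 | I4 | I5

lemma UNIV_ix: "(UNIV :: ix set) = {I1, I2, I3, I4, I5}"
  by (auto intro: ix.exhaust)

instance ix :: finite
  by standard (simp add: UNIV_ix)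

type_synonym mexp = "ix \<Rightarrow> nat"

text \<open>Polynomials carry the convolution product of \<^typ>\<open>'a \<Rightarrow>\<^sub>0 'b\<close>.
  Power series are plain coefficient functions: sums and differences of them are the
  pointwise ones, but their product is \<open>ps_mult\<close> below and never the pointwise
  \<open>(*)\<close> of function algebras.\<close>

type_synonym 'k mpol = "mexp \<Rightarrow>\<^sub>0 'k"
type_synonym 'k ps = "mexp \<Rightarrow> 'k"

definition unit_mexp :: "ix \<Rightarrow> mexp" where
  "unit_mexp i = (\<lambda>j. if j = i then 1 else 0)"

definition mdeg :: "mexp \<Rightarrow> nat" where
  "mdeg M = (\<Sum>i\<in>UNIV. M i)"

definition mfact :: "mexp \<Rightarrow> 'k::comm_semiring_1" where
  "mfact M = (\<Prod>i\<in>UNIV. of_nat (fact (M i)))"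

text \<open>\<open>T\<^sup>J = T\<^sub>1\<^sup>J\<^sup>1 \<cdots> T\<^sub>5\<^sup>J\<^sup>5\<close> for a family of commuting operators.\<close>

definition op_power :: "(ix \<Rightarrow> 'a \<Rightarrow> 'a) \<Rightarrow> mexp \<Rightarrow> 'a \<Rightarrow> 'a" where
  "op_power T J = (T I1 ^^ J I1) \<circ> (T I2 ^^ J I2) \<circ> (T I3 ^^ J I3) \<circ> (T I4 ^^ J I4) \<circ> (T I5 ^^ J I5)"

definition pconst :: "'k \<Rightarrow> 'k::comm_ring_1 mpol" where
  "pconst c = Poly_Mapping.single 0 c"

definition pvar :: "ix \<Rightarrow> 'k::comm_ring_1 mpol" where
  "pvar i = Poly_Mapping.single (unit_mexp i) 1"

definition ps_monom :: "'k \<Rightarrow> mexp \<Rightarrow> 'k::comm_ring_1 ps" where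
  "ps_monom c M = (\<lambda>N. if N = M then c else 0)"

definition ps_smult :: "'k \<Rightarrow> 'k ps \<Rightarrow> 'k::comm_ring_1 ps" where
  "ps_smult c f = (\<lambda>M. c * f M)"

definition ps_mult :: "'k ps \<Rightarrow> 'k ps \<Rightarrow> 'k::comm_ring_1 ps" where
  "ps_mult f g = (\<lambda>M. \<Sum>N | N \<le> M. f N * g (M - N))"

definition ps_deriv :: "ix \<Rightarrow> 'k ps \<Rightarrow> 'k::comm_ring_1 ps" where
  "ps_deriv i f = (\<lambda>M. of_nat (M i + 1) * f (M + unit_mexp i))"

definition ps_homog :: "nat \<Rightarrow> 'k::comm_ring_1 ps \<Rightarrow> bool" where
  "ps_homog k f \<longleftrightarrow> (\<forall>M. f M \<noteq> 0 \<longrightarrow> mdeg M = k)"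

definition ps_ord_ge :: "nat \<Rightarrow> 'k::comm_ring_1 ps \<Rightarrow> bool" where
  "ps_ord_ge k f \<longleftrightarrow> (\<forall>M. f M \<noteq> 0 \<longrightarrow> k \<le> mdeg M)"

text \<open>The sign of the permutation sending \<open>1, 2, 3, 4, 5\<close> to \<open>i, j, k, l, t\<close>,
  and \<open>0\<close> if two of these indices coincide.\<close>

definition eps :: "ix \<Rightarrow> ix \<Rightarrow> ix \<Rightarrow> ix \<Rightarrow> ix \<Rightarrow> 'k::comm_ring_1" where
  "eps i j k l t =
     (if distinct [i, j, k, l, t] then of_int (sign (case_ix i j k l t)) else 0)"


section \<open>Topological graded superalgebras and their quotients\<close>

text \<open>\<open>gr\<close> gives the homogeneous components of a \<open>\<int>\<close>-gradation (an element is in general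
  an infinite sum of homogeneous ones), and \<open>nbh\<close> a decreasing fundamental system
  of neighbourhoods of \<open>0\<close> consisting of linear subspaces.\<close>

record ('k, 'a) superalgebra =
  carr :: "'a set"
  add :: "'a \<Rightarrow> 'a \<Rightarrow> 'a"
  scal :: "'k \<Rightarrow> 'a \<Rightarrow> 'a"
  brk :: "'a \<Rightarrow> 'a \<Rightarrow> 'a"
  part :: "bit \<Rightarrow> 'a set"
  gr :: "int \<Rightarrow> 'a set"
  nbh :: "int \<Rightarrow> 'a set"

definition coset :: "('k, 'a) superalgebra \<Rightarrow> 'a set \<Rightarrow> 'a \<Rightarrow> 'a set" where
  "coset G I x = add G x ` I"

text \<open>As for products of cosets in \<open>HOL-Algebra\<close>, an operation on cosets is the union
  over all representatives; it is a coset exactly when the operation is well defined.\<close>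

definition quot :: "('k, 'a) superalgebra \<Rightarrow> 'a set \<Rightarrow> ('k, 'a set) superalgebra" where
  "quot G I =
    \<lparr>carr = coset G I ` carr G,
     add = (\<lambda>X Y. \<Union>x\<in>X. \<Union>y\<in>Y. coset G I (add G x y)),
     scal = (\<lambda>c X. \<Union>x\<in>X. coset G I (scal G c x)),
     brk = (\<lambda>X Y. \<Union>x\<in>X. \<Union>y\<in>Y. coset G I (brk G x y)),
     part = (\<lambda>p. coset G I ` part G p),
     gr = (\<lambda>n. coset G I ` gr G n),
     nbh = (\<lambda>n. coset G I ` nbh G n)\<rparr>"

definition graded_superalgebra_iso ::
  "('k, 'a) superalgebra \<Rightarrow> ('k, 'b) superalgebra \<Rightarrow> ('a \<Rightarrow> 'b) \<Rightarrow> bool" where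
  "graded_superalgebra_iso G H \<Phi> \<longleftrightarrow>
     bij_betw \<Phi> (carr G) (carr H) \<and>
     (\<forall>x\<in>carr G. \<forall>y\<in>carr G. \<Phi> (add G x y) = add H (\<Phi> x) (\<Phi> y)) \<and>
     (\<forall>c. \<forall>x\<in>carr G. \<Phi> (scal G c x) = scal H c (\<Phi> x)) \<and>
     (\<forall>x\<in>carr G. \<forall>y\<in>carr G. \<Phi> (brk G x y) = brk H (\<Phi> x) (\<Phi> y)) \<and>
     (\<forall>p. \<Phi> ` part G p = part H p) \<and>
     (\<forall>n. \<Phi> ` gr G n = gr H n)"

text \<open>Continuity of a linear map, i.e. continuity at \<open>0\<close>.\<close>

definition continuous_linear ::
  "('k, 'a) superalgebra \<Rightarrow> ('k, 'b) superalgebra \<Rightarrow> ('a \<Rightarrow> 'b) \<Rightarrow> bool" where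
  "continuous_linear G H \<Phi> \<longleftrightarrow> (\<forall>n. \<exists>m. \<Phi> ` nbh G m \<subseteq> nbh H n)"


section \<open>Conformal superalgebras of type (5,0) and their annihilation superalgebras\<close>

text \<open>The data of a \<open>\<int>\<close>-graded conformal superalgebra \<open>R\<close> inside an ambient
  \<open>F[\<partial>\<^sub>1,\<dots>,\<partial>\<^sub>5]\<close>-module: \<open>cpart 0\<close>, \<open>cpart 1\<close> are its even and odd part, \<open>cact\<close> is the module
  structure, and \<open>cbr a b\<close> is the polynomial \<open>[a\<^sub>\<lambda> b]\<close> in \<open>\<lambda>\<close> with coefficients in \<open>R\<close>,
  whose term \<open>\<lambda>\<^sup>J \<otimes> r\<close> is \<open>Poly_Mapping.single J r\<close>.\<close>

record (overloaded) ('k::zero, 'r::zero) conformal =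
  cpart :: "bit \<Rightarrow> 'r set"
  cact :: "'k mpol \<Rightarrow> 'r \<Rightarrow> 'r"
  cbr :: "'r \<Rightarrow> 'r \<Rightarrow> (mexp \<Rightarrow>\<^sub>0 'r)"
  cgr :: "int \<Rightarrow> 'r set"

definition ccarr :: "('k::zero, 'r::ab_group_add) conformal \<Rightarrow> 'r set" where
  "ccarr R = cpart R 0 + cpart R 1"

definition cscal :: "('k::comm_ring_1, 'r::zero) conformal \<Rightarrow> 'k \<Rightarrow> 'r \<Rightarrow> 'r" where
  "cscal R c = cact R (pconst c)"

definition cder :: "('k::comm_ring_1, 'r::zero) conformal \<Rightarrow> ix \<Rightarrow> 'r \<Rightarrow> 'r" where
  "cder R i = cact R (pvar i)"

definition lam_mult :: "ix \<Rightarrow> (mexp \<Rightarrow>\<^sub>0 'r::ab_group_add) \<Rightarrow> (mexp \<Rightarrow>\<^sub>0 'r)" where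
  "lam_mult i P = (\<Sum>J\<in>Poly_Mapping.keys P.
     Poly_Mapping.single (J + unit_mexp i) (Poly_Mapping.lookup P J))"

text \<open>\<open>P(-\<lambda>-\<partial>)\<close>, where \<open>\<partial>\<close> acts on the coefficients.\<close>

definition skew_subst ::
  "('k::comm_ring_1, 'r::ab_group_add) conformal \<Rightarrow> (mexp \<Rightarrow>\<^sub>0 'r) \<Rightarrow> (mexp \<Rightarrow>\<^sub>0 'r)" where
  "skew_subst R P = (\<Sum>J\<in>Poly_Mapping.keys P.
     op_power (\<lambda>i Q. - lam_mult i Q - Poly_Mapping.map (cder R i) Q) J
       (Poly_Mapping.single 0 (Poly_Mapping.lookup P J)))"

definition super_sign :: "bit \<Rightarrow> bit \<Rightarrow> 'a::ab_group_add \<Rightarrow> 'a" where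
  "super_sign p q x = (if p = 1 \<and> q = 1 then - x else x)"

text \<open>A parity-preserving \<open>F\<close>-bilinear bracket \<open>R \<times> R \<rightarrow> F[\<lambda>] \<otimes> R\<close>.\<close>

definition lambda_bracket :: "('k::comm_ring_1, 'r::ab_group_add) conformal \<Rightarrow> bool" where
  "lambda_bracket R \<longleftrightarrow>
     (\<forall>p q J. \<forall>a\<in>cpart R p. \<forall>b\<in>cpart R q. Poly_Mapping.lookup (cbr R a b) J \<in> cpart R (p + q)) \<and>
     (\<forall>a\<in>ccarr R. \<forall>a'\<in>ccarr R. \<forall>b\<in>ccarr R. cbr R (a + a') b = cbr R a b + cbr R a' b) \<and>
     (\<forall>a\<in>ccarr R. \<forall>b\<in>ccarr R. \<forall>b'\<in>ccarr R. cbr R a (b + b') = cbr R a b + cbr R a b') \<and>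
     (\<forall>c. \<forall>a\<in>ccarr R. \<forall>b\<in>ccarr R.
        cbr R (cscal R c a) b = Poly_Mapping.map (cscal R c) (cbr R a b) \<and>
        cbr R a (cscal R c b) = Poly_Mapping.map (cscal R c) (cbr R a b))"

definition sesquilinear :: "('k::comm_ring_1, 'r::ab_group_add) conformal \<Rightarrow> bool" where
  "sesquilinear R \<longleftrightarrow> (\<forall>i. \<forall>a\<in>ccarr R. \<forall>b\<in>ccarr R.
     cbr R (cder R i a) b = - lam_mult i (cbr R a b) \<and>
     cbr R a (cder R i b) = Poly_Mapping.map (cder R i) (cbr R a b) + lam_mult i (cbr R a b))"

definition skew_symmetric :: "('k::comm_ring_1, 'r::ab_group_add) conformal \<Rightarrow> bool" where
  "skew_symmetric R \<longleftrightarrow> (\<forall>p q. \<forall>a\<in>cpart R p. \<forall>b\<in>cpart R q.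
     cbr R b a = - super_sign p q (skew_subst R (cbr R a b)))"

text \<open>\<open>a\<^sub>J b\<close>, where \<open>[a\<^sub>\<lambda> b] = \<Sum>\<^sub>J \<lambda>\<^sup>J / J! (a\<^sub>J b)\<close>.\<close>

definition nprod :: "('k::comm_ring_1, 'r::ab_group_add) conformal \<Rightarrow> mexp \<Rightarrow> 'r \<Rightarrow> 'r \<Rightarrow> 'r" where
  "nprod R J a b = cscal R (mfact J) (Poly_Mapping.lookup (cbr R a b) J)"

text \<open>The tensor product \<open>R \<otimes> F[[y]]\<close> is presented as the free vector space on the pairs
  \<open>(r, f)\<close> modulo bilinearity; \<open>ann_rel\<close> spans the bilinearity relations together with
  \<open>(\<partial>\<^sub>i + \<partial>\<^sub>y\<^sub>i)(r \<otimes> f) = \<partial>\<^sub>i r \<otimes> f + r \<otimes> \<partial>\<^sub>y\<^sub>i f\<close>.\<close>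

type_synonym ('k, 'r) tens = "('r \<times> 'k ps) \<Rightarrow>\<^sub>0 'k"

definition tscal :: "'k \<Rightarrow> ('k, 'r) tens \<Rightarrow> ('k::comm_ring_1, 'r) tens" where
  "tscal c u = Poly_Mapping.map ((*) c) u"

definition tens :: "'r \<Rightarrow> 'k ps \<Rightarrow> ('k::comm_ring_1, 'r) tens" where
  "tens r f = Poly_Mapping.single (r, f) 1"

definition ann_rel :: "('k::field, 'r::ab_group_add) conformal \<Rightarrow> ('k, 'r) tens set" where
  "ann_rel R = module.span tscal
     ({tens (r + s) f - tens r f - tens s f | r s f. r \<in> ccarr R \<and> s \<in> ccarr R} \<union>
      {tens r (f + g) - tens r f - tens r g | r f g. r \<in> ccarr R} \<union>
      {tens (cscal R c r) f - tscal c (tens r f) | c r f. r \<in> ccarr R} \<union>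
      {tens r (ps_smult c f) - tscal c (tens r f) | c r f. r \<in> ccarr R} \<union>
      {tens (cder R i r) f + tens r (ps_deriv i f) | i r f. r \<in> ccarr R})"

text \<open>The bracket \<open>[a f, b g] = \<Sum>\<^sub>J 1/J! (a\<^sub>J b) (\<partial>\<^sub>y\<^sup>J f) g\<close> for arbitrary power series \<open>f\<close>, \<open>g\<close>;
  this is the continuous extension of the formula on monomials.\<close>

definition ann_bracket ::
  "('k::field_char_0, 'r::ab_group_add) conformal \<Rightarrow> ('k, 'r) tens \<Rightarrow> ('k, 'r) tens \<Rightarrow> ('k, 'r) tens" where
  "ann_bracket R u v =
     (\<Sum>(a, f)\<in>Poly_Mapping.keys u. \<Sum>(b, g)\<in>Poly_Mapping.keys v.
        \<Sum>J\<in>Poly_Mapping.keys (cbr R a b).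
          tscal (Poly_Mapping.lookup u (a, f) * Poly_Mapping.lookup v (b, g) * (1 / mfact J))
            (tens (nprod R J a b) (ps_mult (op_power ps_deriv J f) g)))"

text \<open>The neighbourhood \<open>nbh n\<close> is spanned by the \<open>r \<otimes> f\<close> whose components all have
  degree at least \<open>n\<close>.\<close>

definition pre_annihilation ::
  "('k::field_char_0, 'r::ab_group_add) conformal \<Rightarrow> ('k, ('k, 'r) tens) superalgebra" where
  "pre_annihilation R =
    \<lparr>carr = {u. \<forall>(r, f)\<in>Poly_Mapping.keys u. r \<in> ccarr R},
     add = (+), scal = tscal, brk = ann_bracket R,
     part = (\<lambda>p. {u. \<forall>(r, f)\<in>Poly_Mapping.keys u. r \<in> cpart R p}),
     gr = (\<lambda>n. {u. \<forall>(r, f)\<in>Poly_Mapping.keys u.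
        \<exists>d k. r \<in> cgr R d \<and> ps_homog k f \<and> d + 2 * int k = n}),
     nbh = (\<lambda>n. {u. \<forall>(r, f)\<in>Poly_Mapping.keys u.
        \<exists>d k. r \<in> cgr R d \<and> ps_ord_ge k f \<and> n \<le> d + 2 * int k})\<rparr>"

definition annihilation ::
  "('k::field_char_0, 'r::ab_group_add) conformal \<Rightarrow> ('k, ('k, 'r) tens set) superalgebra" where
  "annihilation R = quot (pre_annihilation R) (ann_rel R)"

definition ann_class ::
  "('k::field_char_0, 'r::ab_group_add) conformal \<Rightarrow> 'r \<Rightarrow> 'k ps \<Rightarrow> ('k, 'r) tens set" where
  "ann_class R r f = coset (pre_annihilation R) (ann_rel R) (tens r f)"

text \<open>\<open>D = \<langle>\<partial>\<^sub>y\<^sub>1,\<dots>,\<partial>\<^sub>y\<^sub>5\<rangle>\<close> is represented by coordinate vectors \<open>\<delta>\<close>, acting on the second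
  tensor factor by \<open>\<Sum>\<^sub>i \<delta>\<^sub>i \<partial>\<^sub>y\<^sub>i\<close>; it is even, abelian and of degree \<open>-2\<close>.\<close>

definition tens_D :: "(ix \<Rightarrow> 'k) \<Rightarrow> ('k, 'r) tens \<Rightarrow> ('k::comm_ring_1, 'r) tens" where
  "tens_D \<delta> u = (\<Sum>(r, f)\<in>Poly_Mapping.keys u.
     tscal (Poly_Mapping.lookup u (r, f)) (tens r (\<Sum>i\<in>UNIV. ps_smult (\<delta> i) (ps_deriv i f))))"

definition ann_D ::
  "('k::field_char_0, 'r::ab_group_add) conformal \<Rightarrow> (ix \<Rightarrow> 'k) \<Rightarrow> ('k, 'r) tens set \<Rightarrow> ('k, 'r) tens set" where
  "ann_D R \<delta> X = (\<Union>u\<in>X. coset (pre_annihilation R) (ann_rel R) (tens_D \<delta> u))"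

definition ext_annihilation ::
  "('k::field_char_0, 'r::ab_group_add) conformal \<Rightarrow>
     ('k, (ix \<Rightarrow> 'k) \<times> ('k, 'r) tens set) superalgebra" where
  "ext_annihilation R = (let A = annihilation R in
    \<lparr>carr = UNIV \<times> carr A,
     add = (\<lambda>(\<delta>, u) (\<delta>', u'). (\<delta> + \<delta>', add A u u')),
     scal = (\<lambda>c (\<delta>, u). (\<lambda>i. c * \<delta> i, scal A c u)),
     brk = (\<lambda>(\<delta>, u) (\<delta>', u').
        (0, add A (add A (ann_D R \<delta> u') (scal A (- 1) (ann_D R \<delta>' u))) (brk A u u'))),
     part = (\<lambda>p. (if p = 0 then UNIV else {0}) \<times> part A p),
     gr = (\<lambda>n. (if n = - 2 then UNIV else {0}) \<times> gr A n),
     nbh = (\<lambda>n. (if n \<le> - 2 then UNIV else {0}) \<times> nbh A n)\<rparr>)"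

text \<open>The subspace \<open>{x - ad x : x \<in> A(R)\<^sub>-\<^sub>2}\<close>, where \<open>ad x\<close> stands for the element \<open>\<delta>\<close> of \<open>D\<close>
  acting on \<open>A(R)\<close> as \<open>ad x\<close>.\<close>

definition ad_rel ::
  "('k::field_char_0, 'r::ab_group_add) conformal \<Rightarrow> ((ix \<Rightarrow> 'k) \<times> ('k, 'r) tens set) set" where
  "ad_rel R = {(- \<delta>, x) | \<delta> x. x \<in> gr (annihilation R) (- 2) \<and>
     (\<forall>u\<in>carr (annihilation R). brk (annihilation R) x u = ann_D R \<delta> u)}"

definition ann_lie ::
  "('k::field_char_0, 'r::ab_group_add) conformal \<Rightarrow>
     ('k, ((ix \<Rightarrow> 'k) \<times> ('k, 'r) tens set) set) superalgebra" where
  "ann_lie R = quot (ext_annihilation R) (ad_rel R)"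

text \<open>The image in \<open>ann_lie R\<close> of the element \<open>r f\<close> of the annihilation superalgebra.\<close>

definition ann_lie_class ::
  "('k::field_char_0, 'r::ab_group_add) conformal \<Rightarrow> 'r \<Rightarrow> 'k ps \<Rightarrow>
     ((ix \<Rightarrow> 'k) \<times> ('k, 'r) tens set) set" where
  "ann_lie_class R r f = coset (ext_annihilation R) (ad_rel R) (0, ann_class R r f)"


section \<open>The conformal superalgebra RE(5,10)\<close>

text \<open>The pair \<open>(v, w)\<close> stands for \<open>(\<Sum>j. v j \<partial>\<^sub>x\<^sub>j) + (\<Sum>j<k. w j k d\<^sub>j\<^sub>k)\<close>: the free module on the
  \<open>d\<^sub>j\<^sub>k\<close>, \<open>j < k\<close>, consists of the alternating matrices \<open>w\<close>.\<close>

type_synonym 'k re_amb = "(ix \<Rightarrow> 'k mpol) \<times> (ix \<Rightarrow> ix \<Rightarrow> 'k mpol)"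

definition re_act :: "'k mpol \<Rightarrow> 'k re_amb \<Rightarrow> 'k::comm_ring_1 re_amb" where
  "re_act p = (\<lambda>(v, w). (\<lambda>j. p * v j, \<lambda>j k. p * w j k))"

definition re_dx :: "ix \<Rightarrow> 'k::comm_ring_1 re_amb" where
  "re_dx j = (\<lambda>h. if h = j then 1 else 0, 0)"

definition re_d :: "ix \<Rightarrow> ix \<Rightarrow> 'k::comm_ring_1 re_amb" where
  "re_d j k = (0, \<lambda>p q. (if p = j \<and> q = k then 1 else 0) - (if p = k \<and> q = j then 1 else 0))"

definition re_a :: "ix \<Rightarrow> ix \<Rightarrow> 'k::comm_ring_1 re_amb" where
  "re_a i j = re_act (pvar i) (re_dx j) - re_act (pvar j) (re_dx i)"

definition re_b :: "ix \<Rightarrow> 'k::comm_ring_1 re_amb" where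
  "re_b k = (\<Sum>h\<in>UNIV. re_act (pvar h) (re_d h k))"

definition RE_with_bracket ::
  "('k re_amb \<Rightarrow> 'k re_amb \<Rightarrow> (mexp \<Rightarrow>\<^sub>0 'k re_amb)) \<Rightarrow> ('k::comm_ring_1, 'k re_amb) conformal" where
  "RE_with_bracket br =
    \<lparr>cpart = (\<lambda>p. module.span re_act (if p = 0 then {re_a i j | i j. True} else range re_b)),
     cact = re_act,
     cbr = br,
     cgr = (\<lambda>n. module.span (\<lambda>c. re_act (pconst c))
       ({re_act (Poly_Mapping.single J 1) (re_a i j) | J i j. - 4 - 2 * int (mdeg J) = n} \<union>
        {re_act (Poly_Mapping.single J 1) (re_b k) | J k. - 3 - 2 * int (mdeg J) = n}))\<rparr>"

definition is_RE_bracket ::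
  "('k re_amb \<Rightarrow> 'k re_amb \<Rightarrow> (mexp \<Rightarrow>\<^sub>0 'k::comm_ring_1 re_amb)) \<Rightarrow> bool" where
  "is_RE_bracket br \<longleftrightarrow> (let R = RE_with_bracket br; lm = Poly_Mapping.single;
       e = unit_mexp; a = re_a; b = re_b in
     lambda_bracket R \<and> sesquilinear R \<and> skew_symmetric R \<and>
     (\<forall>i j r s. br (a i j) (a r s) =
        lm (e j + e r) (a s i) + lm (e i + e r) (a j s)
        + lm (e i + e s) (a r j) + lm (e j + e s) (a i r)
        + lm (e i) (cder R j (a r s)) + lm (e j) (cder R i (a s r))) \<and>
     (\<forall>i j k. br (a i j) (b k) =
        lm (e i) (cder R j (b k)) - lm (e j) (cder R i (b k))
        + (if i = k then \<Sum>r\<in>UNIV. lm (e j + e r) (b r) else 0)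
        - (if j = k then \<Sum>r\<in>UNIV. lm (e i + e r) (b r) else 0)) \<and>
     (\<forall>i. br (b i) (b i) = 0) \<and>
     (\<forall>i j h k l. distinct [i, j, h, k, l] \<longrightarrow> br (b i) (b j) =
        Poly_Mapping.map (cscal R (eps i j h k l))
          (lm (e h) (a k l) + lm (e k) (a l h) + lm (e l) (a h k))))"

text \<open>These conditions determine the bracket on \<open>RE(5,10)\<close>; off \<open>RE(5,10)\<close> it is normalised to \<open>0\<close>.\<close>

definition RE_bracket ::
  "'k re_amb \<Rightarrow> 'k re_amb \<Rightarrow> (mexp \<Rightarrow>\<^sub>0 'k::comm_ring_1 re_amb)" where
  "RE_bracket = (THE br. is_RE_bracket br \<and>
     (\<forall>x y. x \<notin> ccarr (RE_with_bracket br) \<or> y \<notin> ccarr (RE_with_bracket br) \<longrightarrow> br x y = 0))"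

definition RE_5_10 :: "('k::comm_ring_1, 'k re_amb) conformal" where
  "RE_5_10 = RE_with_bracket RE_bracket"


section \<open>The Lie superalgebra E(5,10)\<close>

text \<open>\<open>(X, \<omega>)\<close> stands for \<open>(\<Sum>i. X i \<partial>\<^sub>x\<^sub>i) + (\<Sum>i<j. \<omega> i j dx\<^sub>i \<and> dx\<^sub>j)\<close> with \<open>\<omega>\<close> alternating.\<close>

type_synonym 'k vfield = "ix \<Rightarrow> 'k ps"
type_synonym 'k form2 = "ix \<Rightarrow> ix \<Rightarrow> 'k ps"

definition S5 :: "'k::comm_ring_1 vfield set" where
  "S5 = {X. (\<Sum>i\<in>UNIV. ps_deriv i (X i)) = 0}"

definition Omega2_cl :: "'k::comm_ring_1 form2 set" where
  "Omega2_cl = {\<omega>. (\<forall>i j. \<omega> i j = - \<omega> j i) \<and> (\<forall>i. \<omega> i i = 0) \<and>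
     (\<forall>i j k. ps_deriv i (\<omega> j k) + ps_deriv j (\<omega> k i) + ps_deriv k (\<omega> i j) = 0)}"

definition commutator :: "'k vfield \<Rightarrow> 'k vfield \<Rightarrow> 'k::comm_ring_1 vfield" where
  "commutator X Y = (\<lambda>j. \<Sum>i\<in>UNIV. ps_mult (X i) (ps_deriv i (Y j)) - ps_mult (Y i) (ps_deriv i (X j)))"

definition lie_deriv :: "'k vfield \<Rightarrow> 'k form2 \<Rightarrow> 'k::comm_ring_1 form2" where
  "lie_deriv X \<omega> = (\<lambda>j k. \<Sum>i\<in>UNIV. ps_mult (X i) (ps_deriv i (\<omega> j k))
     + ps_mult (ps_deriv j (X i)) (\<omega> i k) + ps_mult (ps_deriv k (X i)) (\<omega> j i))"

text \<open>The factor \<open>1/4\<close> accounts for \<open>\<omega> = 1/2 (\<Sum>i j. \<omega> i j d\<^sub>i\<^sub>j)\<close>, the sum being over all \<open>i\<close>, \<open>j\<close>.\<close>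

definition form_bracket :: "'k form2 \<Rightarrow> 'k form2 \<Rightarrow> 'k::field_char_0 vfield" where
  "form_bracket \<omega> \<eta> = (\<lambda>t. ps_smult (1 / 4)
     (\<Sum>i\<in>UNIV. \<Sum>j\<in>UNIV. \<Sum>k\<in>UNIV. \<Sum>l\<in>UNIV.
        ps_smult (eps i j k l t) (ps_mult (\<omega> i j) (\<eta> k l))))"

definition E_5_10 :: "('k::field_char_0, 'k vfield \<times> 'k form2) superalgebra" where
  "E_5_10 =
    \<lparr>carr = S5 \<times> Omega2_cl,
     add = (+),
     scal = (\<lambda>c (X, \<omega>). (\<lambda>i. ps_smult c (X i), \<lambda>i j. ps_smult c (\<omega> i j))),
     brk = (\<lambda>(X, \<omega>) (Y, \<eta>).
        (commutator X Y + form_bracket \<omega> \<eta>, lie_deriv X \<eta> - lie_deriv Y \<omega>)),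
     part = (\<lambda>p. if p = 0 then S5 \<times> {0} else {0} \<times> Omega2_cl),
     gr = (\<lambda>n. {(X, \<omega>) \<in> S5 \<times> Omega2_cl.
        (\<forall>i. \<forall>M. X i M \<noteq> 0 \<longrightarrow> 2 * int (mdeg M) - 2 = n) \<and>
        (\<forall>i j. \<forall>M. \<omega> i j M \<noteq> 0 \<longrightarrow> 2 * int (mdeg M) - 1 = n)}),
     nbh = (\<lambda>n. {(X, \<omega>) \<in> S5 \<times> Omega2_cl.
        (\<forall>i. \<forall>M. X i M \<noteq> 0 \<longrightarrow> n \<le> 2 * int (mdeg M) - 2) \<and>
        (\<forall>i j. \<forall>M. \<omega> i j M \<noteq> 0 \<longrightarrow> n \<le> 2 * int (mdeg M) - 1)})\<rparr>"

text \<open>\<open>f \<partial>\<^sub>x\<^sub>j\<close> and \<open>f d\<^sub>j\<^sub>k\<close>.\<close>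

definition vf :: "'k ps \<Rightarrow> ix \<Rightarrow> 'k::comm_ring_1 vfield \<times> 'k form2" where
  "vf f j = (\<lambda>h. if h = j then f else 0, 0)"

definition form :: "'k ps \<Rightarrow> ix \<Rightarrow> ix \<Rightarrow> 'k::comm_ring_1 vfield \<times> 'k form2" where
  "form f j k = (0, \<lambda>p q. (if p = j \<and> q = k then f else 0) - (if p = k \<and> q = j then f else 0))"

end

theory Submission
  imports Defs
begin

text \<open>
  The bracket of \<open>RE(5,10)\<close> is the bracket of \<open>E(5,10)\<close> written in symbols. In a bidifferential
  expression in power series \<open>f\<close>, \<open>g\<close> let \<open>\<lambda>\<^sub>i\<close> stand for differentiating \<open>f\<close> and \<open>- \<partial>\<^sub>i\<close> for
  differentiating the whole product, so that \<open>- \<lambda>\<^sub>i - \<partial>\<^sub>i\<close> differentiates \<open>g\<close>. Transcribing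
  commutator, Lie derivative and product of forms in this way gives a \<open>\<lambda>\<close>-bracket on the whole
  ambient module. It is sesquilinear and skew-symmetric and has the prescribed values on the
  generators, so it restricts to the bracket of \<open>RE(5,10)\<close>; and \<open>r \<otimes> f \<mapsto> r(-\<partial>\<^sub>x) f\<close> respects
  brackets by construction, with no computation on generators.

  The formal Poincare lemma (inverting the Euler operator) does the rest: closed 2-forms are exact
  and divergence free fields are divergences of bivectors, hence the map is onto \<open>E(5,10)\<close>; its
  kernel is spanned by the defining relations because a divergence free bivector is the divergence
  of a trivector and a closed 1-form is exact, while \<open>\<partial>\<^sub>k a\<^sub>i\<^sub>j + \<partial>\<^sub>i a\<^sub>j\<^sub>k + \<partial>\<^sub>j a\<^sub>k\<^sub>i = 0\<close> and
  \<open>\<Sum>\<^sub>k \<partial>\<^sub>k b\<^sub>k = 0\<close> in \<open>RE(5,10)\<close>. Finally \<open>D\<close> acts on \<open>E(5,10)\<close> as the constant vector fields,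
  which are its component of degree \<open>-2\<close> and act faithfully, so the last quotient identifies the two.\<close>

section \<open>Finitely supported functions\<close>

text \<open>The generators \<open>a_ij\<close>, \<open>b_k\<close> satisfy linear relations over
  F[\<partial>], so values of a bracket on them cannot be extended at will: compatibility with every
  relation would have to be checked. The ambient module is free, so a formula in its coordinates is
  well defined. What remains is that brackets of generators have coefficients in the submodule;
  sesquilinearity carries this, and also uniqueness, from the generators to all of RE(5,10). No
  limits of power series occur. The second tensor factor is all of F[[y]] and derivatives can be
  moved onto it, so each class has a representative with finitely many terms
  \<open>a_ij F_ij\<close> and \<open>b_k g_k\<close>. Continuity becomes an inclusion of
  neighbourhoods. The tensor product is a quotient of the free space on all pairs
  \<open>(r, f)\<close>, where even \<open>(r, 0)\<close> is a nonzero basis vector. Computations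
  are therefore made in E(5,10), the classes being the fibres of one linear map. Characteristic 0
  enters through division by integers: J!, the 4 in the product of forms, the eigenvalues of the
  Euler operator, the factors 2 and 3 in the kernel.\<close>

definition psum :: "('a \<Rightarrow> 'b::zero \<Rightarrow> 'c::comm_monoid_add) \<Rightarrow> ('a \<Rightarrow>\<^sub>0 'b) \<Rightarrow> 'c" where
  "psum h p = (\<Sum>K\<in>Poly_Mapping.keys p. h K (Poly_Mapping.lookup p K))"

lemma psum_superset:
  assumes "finite A" "Poly_Mapping.keys p \<subseteq> A" "\<And>K. h K 0 = 0"
  shows "psum h p = (\<Sum>K\<in>A. h K (Poly_Mapping.lookup p K))"
  unfolding psum_def using assms
  by (intro sum.mono_neutral_left) (auto simp: in_keys_iff)

lemma psum_0 [simp]: "psum h 0 = 0"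
  by (simp add: psum_def)

lemma psum_single [simp]: "h K 0 = 0 \<Longrightarrow> psum h (Poly_Mapping.single K c) = h K c"
  by (simp add: psum_def)

text \<open>Coefficients may cancel, so the support of \<open>p + q\<close> can be smaller than the
  union of the supports. All three sums are padded with zeros to that union.\<close>

lemma psum_add:
  assumes "\<And>K. h K 0 = 0" "\<And>K a b. h K (a + b) = h K a + h K b"
  shows "psum h (p + q) = psum h p + psum h q"
proof -
  let ?A = "Poly_Mapping.keys p \<union> Poly_Mapping.keys q"
  have "psum h r = (\<Sum>K\<in>?A. h K (Poly_Mapping.lookup r K))" if "Poly_Mapping.keys r \<subseteq> ?A" for r
    using that assms(1) by (intro psum_superset) auto
  then show ?thesis
    using keys_add[of p q] by (simp add: lookup_add assms(2) sum.distrib)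
qed

lemma psum_comp:
  assumes "F 0 = 0" "\<And>x y. F (x + y) = F x + F y"
  shows "F (psum h p) = psum (\<lambda>K c. F (h K c)) p"
  unfolding psum_def
  using sum_comp_morphism[of F "\<lambda>K. h K (Poly_Mapping.lookup p K)" "Poly_Mapping.keys p", OF assms]
  by (simp add: o_def)

lemma psum_map:
  assumes "F 0 = 0" "\<And>K. h K 0 = 0"
  shows "psum h (Poly_Mapping.map F p) = psum (\<lambda>K c. h K (F c)) p"
proof -
  have "psum h (Poly_Mapping.map F p) = (\<Sum>K\<in>Poly_Mapping.keys p. h K (Poly_Mapping.lookup (Poly_Mapping.map F p) K))"
    by (intro psum_superset) (auto simp: in_keys_iff map.rep_eq assms when_def)
  also have "\<dots> = psum (\<lambda>K c. h K (F c)) p"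
    unfolding psum_def by (intro sum.cong) (auto simp: map.rep_eq assms when_def in_keys_iff)
  finally show ?thesis .
qed

lemma lookup_map_0 [simp]: "F 0 = 0 \<Longrightarrow> Poly_Mapping.lookup (Poly_Mapping.map F p) K = F (Poly_Mapping.lookup p K)"
  by (simp add: map.rep_eq when_def)

text \<open>Subtracting the term at one key removes exactly that key from the support, so the size
  of the support is the induction measure.\<close>

lemma pm_induct [case_names zero single]:
  assumes "P 0" "\<And>K c p. P p \<Longrightarrow> P (Poly_Mapping.single K c + p)"
  shows "P (p :: 'a \<Rightarrow>\<^sub>0 'b::ab_group_add)"
proof (induction "card (Poly_Mapping.keys p)" arbitrary: p)
  case 0
  then have "p = 0" by simp
  then show ?case using assms by simp
next
  case (Suc n)
  then obtain K where K: "K \<in> Poly_Mapping.keys p" by fastforce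
  define q where "q = p - Poly_Mapping.single K (Poly_Mapping.lookup p K)"
  have "Poly_Mapping.keys q = Poly_Mapping.keys p - {K}"
    by (auto simp: q_def in_keys_iff lookup_minus lookup_single when_def split: if_splits)
  then have "card (Poly_Mapping.keys q) = n" using Suc.hyps(2) K by simp
  then have "P (Poly_Mapping.single K (Poly_Mapping.lookup p K) + q)"
    using Suc.hyps(1) assms(2) by blast
  then show ?case by (simp add: q_def)
qed

lemma sum_apply: "(\<Sum>a\<in>A. f a) x = (\<Sum>a\<in>A. f a x)"
  for f :: "'a \<Rightarrow> 'b \<Rightarrow> 'c::comm_monoid_add"
  by (induction A rule: infinite_finite_induct) auto

section \<open>The five indices, multi-exponents and induction on polynomials\<close>

lemma UNIV_ix_sum: "(\<Sum>i\<in>UNIV. f i) = f I1 + f I2 + f I3 + f I4 + f I5"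
  by (simp add: UNIV_ix add.assoc)

lemma UNIV_ix_prod: "(\<Prod>i\<in>UNIV. f i) = f I1 * f I2 * f I3 * f I4 * f I5"
  for f :: "ix \<Rightarrow> 'a::comm_monoid_mult"
  by (simp add: UNIV_ix mult.assoc)

lemma unit_mexp_apply: "unit_mexp i j = (if j = i then 1 else 0)"
  by (simp add: unit_mexp_def)

lemma mexp_induct [case_names zero step]:
  assumes "P (0::mexp)" "\<And>i M. P M \<Longrightarrow> P (unit_mexp i + M)"
  shows "P M"
proof (induction "mdeg M" arbitrary: M)
  case 0
  then have "M = 0" by (auto simp: mdeg_def fun_eq_iff)
  then show ?case using assms(1) by (simp only:)
next
  case (Suc n)
  then obtain i where i: "M i \<noteq> 0" by (fastforce simp: mdeg_def)
  define N where "N = (\<lambda>j. M j - unit_mexp i j)"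
  have M: "M = unit_mexp i + N" using i by (auto simp: N_def unit_mexp_def fun_eq_iff)
  have "mdeg M = Suc (mdeg N)"
    unfolding M mdeg_def by (simp add: sum.distrib unit_mexp_apply)
  then show ?case using Suc assms(2)[of N i] M by auto
qed

lemma pvar_single: "pvar i * Poly_Mapping.single K c = Poly_Mapping.single (unit_mexp i + K) c"
  by (simp add: pvar_def mult_single)

lemma pconst_add: "pconst (a + b) = pconst a + pconst b"
  by (simp add: pconst_def single_add)

lemma pconst_mult: "pconst (a * b) = pconst a * pconst b"
  by (simp add: pconst_def mult_single)

lemma pconst_0 [simp]: "pconst 0 = 0" and pconst_1 [simp]: "pconst 1 = 1"
  by (simp_all add: pconst_def)

lemma pconst_of_int [simp]: "pconst (of_int n) = of_int n"
  by (simp add: pconst_def)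

lemma pconst_minus: "pconst (- a) = - pconst a"
  by (simp add: pconst_def single_uminus)

text \<open>Constants and variables generate F[\<partial>] as a ring. A property additive in the
  polynomial is thus reduced to a constant and to multiplication by one variable, the two cases in
  which module actions and substitutions are known explicitly.\<close>

lemma mpol_induct [case_names const add var]:
  fixes p :: "'k::comm_ring_1 mpol"
  assumes const: "\<And>c. P (pconst c)" and add: "\<And>p q. P p \<Longrightarrow> P q \<Longrightarrow> P (p + q)"
    and var: "\<And>i p. P p \<Longrightarrow> P (pvar i * p)"
  shows "P p"
proof -
  have single: "P (Poly_Mapping.single M c)" for M c
  proof (induction M rule: mexp_induct)
    case zero
    show ?case using const[of c] by (simp only: pconst_def)
  next
    case (step i M)
    then show ?case using var[of "Poly_Mapping.single M c" i] by (simp only: pvar_single)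
  qed
  show ?thesis
  proof (induction p rule: pm_induct)
    case zero
    then show ?case using const[of 0] by simp
  next
    case (single K c p)
    then show ?case using add[OF \<open>\<And>M c. P (Poly_Mapping.single M c)\<close>] by blast
  qed
qed

section \<open>Calculus of formal power series\<close>

lemma mfact_pos: "mfact M \<noteq> (0 :: 'k::field_char_0)"
  by (simp add: mfact_def)

lemma mfact_unit: "mfact (M + unit_mexp i) = of_nat (M i + 1) * (mfact M :: 'k::field_char_0)"
proof -
  have "(\<Prod>j\<in>UNIV - {i}. of_nat (fact ((M + unit_mexp i) j))) = (\<Prod>j\<in>UNIV - {i}. of_nat (fact (M j)) :: 'k)"
    by (intro prod.cong) (auto simp: unit_mexp_apply)
  then show ?thesis
    unfolding mfact_def
    by (simp add: prod.remove[of UNIV i] unit_mexp_apply mult_ac)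
qed

text \<open>\<open>pd J f\<close> is \<open>\<partial>\<^sup>J f\<close>.\<close>

definition pd :: "mexp \<Rightarrow> 'k ps \<Rightarrow> 'k::field_char_0 ps" where
  "pd J f = (\<lambda>M. mfact (M + J) / mfact M * f (M + J))"

lemma pd_0 [simp]: "pd 0 f = f"
  by (simp add: pd_def mfact_pos)

lemma pd_add: "pd (J + K) f = pd J (pd K f)"
  by (simp add: pd_def mfact_pos add.assoc)

lemma pd_unit: "pd (unit_mexp i) f = ps_deriv i f"
  by (simp add: pd_def ps_deriv_def mfact_unit mfact_pos)

lemma pd_unit_add: "pd (unit_mexp i + J) f = pd J (ps_deriv i f)"
  unfolding add.commute[of _ J] pd_add pd_unit ..

lemma ps_deriv_pd: "ps_deriv i (pd J f) = pd J (ps_deriv i f)"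
  unfolding pd_unit_add[symmetric] pd_add pd_unit ..

lemma funpow_ps_deriv: "(ps_deriv i ^^ n) f = pd (\<lambda>j. if j = i then n else 0) f"
proof (induction n)
  case 0
  then show ?case using pd_0[of f] by (simp add: zero_fun_def)
next
  case (Suc n)
  have "(\<lambda>j. if j = i then Suc n else 0) = unit_mexp i + (\<lambda>j. if j = i then n else 0)"
    by (auto simp: fun_eq_iff unit_mexp_def)
  then show ?case using Suc by (simp add: pd_add pd_unit)
qed

lemma op_power_ps_deriv: "op_power ps_deriv J f = pd J f"
proof -
  let ?d = "\<lambda>i j. if j = i then J i else 0"
  have "J = ?d I1 + (?d I2 + (?d I3 + (?d I4 + ?d I5)))"
    by (rule ext, rename_tac j, case_tac j) auto
  then have "pd J f = pd (?d I1) (pd (?d I2) (pd (?d I3) (pd (?d I4) (pd (?d I5) f))))"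
    unfolding pd_add[symmetric] by (rule arg_cong)
  then show ?thesis by (simp add: op_power_def funpow_ps_deriv)
qed

lemma ps_smult_apply [simp]: "ps_smult c f M = c * f M"
  by (simp add: ps_smult_def)

lemma ps_smult_simps [simp]: "ps_smult 0 f = 0" "ps_smult c 0 = 0" "ps_smult 1 f = f"
    "ps_smult a (ps_smult b f) = ps_smult (a * b) f"
  by (auto simp: fun_eq_iff)

lemma ps_smult_add: "ps_smult c (f + g) = ps_smult c f + ps_smult c g"
  "ps_smult (a + b) f = ps_smult a f + ps_smult b f"
  by (auto simp: fun_eq_iff algebra_simps)

lemma ps_smult_sum: "ps_smult c (\<Sum>a\<in>A. f a) = (\<Sum>a\<in>A. ps_smult c (f a))"
  by (auto simp: fun_eq_iff sum_apply sum_distrib_left)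

lemma ps_deriv_add: "ps_deriv i (f + g) = ps_deriv i f + ps_deriv i g"
  by (auto simp: fun_eq_iff ps_deriv_def algebra_simps)

lemma ps_deriv_0 [simp]: "ps_deriv i 0 = 0"
  by (auto simp: fun_eq_iff ps_deriv_def)

lemma ps_deriv_uminus: "ps_deriv i (- f) = - ps_deriv i f"
  by (auto simp: fun_eq_iff ps_deriv_def)

lemma ps_deriv_diff: "ps_deriv i (f - g) = ps_deriv i f - ps_deriv i g"
  by (auto simp: fun_eq_iff ps_deriv_def algebra_simps)

lemma ps_deriv_smult: "ps_deriv i (ps_smult c f) = ps_smult c (ps_deriv i f)"
  by (auto simp: fun_eq_iff ps_deriv_def algebra_simps)

lemma ps_deriv_sum: "ps_deriv i (\<Sum>a\<in>A. f a) = (\<Sum>a\<in>A. ps_deriv i (f a))"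
  using sum_comp_morphism[of "ps_deriv i" f A] by (simp add: ps_deriv_add o_def)

lemma ps_deriv_commute: "ps_deriv i (ps_deriv j f) = ps_deriv j (ps_deriv i f)"
  by (auto simp: fun_eq_iff ps_deriv_def unit_mexp_def add_ac mult_ac)

lemma finite_le_mexp [simp]: "finite {N. N \<le> (M :: mexp)}"
proof (rule finite_subset)
  show "{N. N \<le> M} \<subseteq> PiE UNIV (\<lambda>i. {..M i})"
    by (auto simp: le_fun_def)
  show "finite (PiE UNIV (\<lambda>i. {..M i}))"
    by (intro finite_PiE) auto
qed

lemma ps_mult_commute: "ps_mult f g = ps_mult g f"
proof
  fix M
  have MM: "M - (M - N) = N" if "N \<le> M" for N :: mexp
    using that by (auto simp: le_fun_def fun_eq_iff)
  show "ps_mult f g M = ps_mult g f M"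
    unfolding ps_mult_def
    by (rule sum.reindex_bij_witness[of _ "\<lambda>N. M - N" "\<lambda>N. M - N"])
       (simp_all add: MM mult.commute, simp_all add: le_fun_def)
qed

lemma ps_mult_add: "ps_mult (f + g) h = ps_mult f h + ps_mult g h"
    "ps_mult h (f + g) = ps_mult h f + ps_mult h g"
  by (auto simp: fun_eq_iff ps_mult_def algebra_simps sum.distrib)

lemma ps_mult_uminus: "ps_mult (- f) h = - ps_mult f h"  "ps_mult h (- f) = - ps_mult h f"
  by (auto simp: fun_eq_iff ps_mult_def sum_negf)

lemma ps_mult_0 [simp]: "ps_mult 0 h = 0" "ps_mult h 0 = 0"
  by (auto simp: fun_eq_iff ps_mult_def)

lemma ps_mult_smult: "ps_mult (ps_smult c f) h = ps_smult c (ps_mult f h)"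
    "ps_mult h (ps_smult c f) = ps_smult c (ps_mult h f)"
  by (auto simp: fun_eq_iff ps_mult_def sum_distrib_left mult_ac)

text \<open>In the coefficient of \<open>x^M\<close> each pair of exponents with sum
  \<open>M + e_i\<close> gets the weight \<open>M i + 1\<close>, which is the sum of its two
  exponents at \<open>i\<close>. Each of the two parts is the derivative of one factor.\<close>

lemma ps_deriv_mult: "ps_deriv i (ps_mult f g) = ps_mult (ps_deriv i f) g + ps_mult f (ps_deriv i g)"
proof
  fix M :: mexp
  let ?e = "unit_mexp i"
  \<comment> \<open>Terms with \<open>N i = 0\<close> carry weight zero; the others are reindexed by
    \<open>N - e_i\<close>, where the truncated subtraction is exact.\<close>
  have shift: "(\<Sum>N | N \<le> M + ?e. of_nat (N i) * (F N * G (M + ?e - N))) = ps_mult (ps_deriv i F) G M"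
    for F G :: "'a ps"
  proof -
    have "(\<Sum>N | N \<le> M + ?e. of_nat (N i) * (F N * G (M + ?e - N)))
        = (\<Sum>N | N \<le> M + ?e \<and> N i \<noteq> 0. of_nat (N i) * (F N * G (M + ?e - N)))"
      by (rule sum.mono_neutral_right) (auto intro: finite_subset[OF _ finite_le_mexp])
    also have "\<dots> = ps_mult (ps_deriv i F) G M"
      unfolding ps_mult_def ps_deriv_def
    proof (rule sum.reindex_bij_witness[of _ "\<lambda>N. N + ?e" "\<lambda>N. N - ?e"])
      fix N assume "N \<in> {N. N \<le> M + ?e \<and> N i \<noteq> 0}"
      then have N: "N \<le> M + ?e" "N i \<noteq> 0" by auto
      then show 1: "N - ?e + ?e = N" by (auto simp: fun_eq_iff unit_mexp_def)
      show "N - ?e \<in> {N. N \<le> M}"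
        using N by (auto simp: le_fun_def unit_mexp_def split: if_splits)
      have 2: "M - (N - ?e) = M + ?e - N"
        using N by (auto simp: fun_eq_iff unit_mexp_def)
      have "(N - ?e) i + 1 = N i" using N by (auto simp: unit_mexp_def)
      then show "of_nat ((N - ?e) i + 1) * F (N - ?e + ?e) * G (M - (N - ?e))
          = of_nat (N i) * (F N * G (M + ?e - N))"
        unfolding 1 2 by (simp add: mult.assoc)
    next
      fix N assume N: "N \<in> {N. N \<le> M}"
      show "N + ?e - ?e = N" by (auto simp: fun_eq_iff)
      show "N + ?e \<in> {N. N \<le> M + ?e \<and> N i \<noteq> 0}" using N by (auto simp: le_fun_def unit_mexp_def)
    qed
    finally show ?thesis .
  qed
  have "ps_deriv i (ps_mult f g) M = (\<Sum>N | N \<le> M + ?e. of_nat (M i + 1) * (f N * g (M + ?e - N)))"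
    by (simp add: ps_deriv_def ps_mult_def sum_distrib_left)
  also have "\<dots> = (\<Sum>N | N \<le> M + ?e. of_nat (N i) * (f N * g (M + ?e - N)))
      + (\<Sum>N | N \<le> M + ?e. of_nat ((M + ?e - N) i) * (f N * g (M + ?e - N)))"
    unfolding sum.distrib[symmetric]
  proof (rule sum.cong)
    fix N assume "N \<in> {N. N \<le> M + ?e}"
    then have "N i \<le> M i + 1" by (auto simp: le_fun_def unit_mexp_def dest: spec[of _ i])
    then have "M i + 1 = N i + (M + ?e - N) i" by (simp add: unit_mexp_def)
    then have "(of_nat (M i + 1) :: 'a) = of_nat (N i) + of_nat ((M + ?e - N) i)"
      by (metis of_nat_add)
    then show "of_nat (M i + 1) * (f N * g (M + ?e - N)) = of_nat (N i) * (f N * g (M + ?e - N))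
       + of_nat ((M + ?e - N) i) * (f N * g (M + ?e - N))" by (simp only: distrib_right)
  qed simp
  \<comment> \<open>The reflection of \<open>N\<close> to \<open>M + e_i - N\<close> exchanges the
    factors, so that \<open>shift\<close> also covers this sum.\<close>
  also have "(\<Sum>N | N \<le> M + ?e. of_nat ((M + ?e - N) i) * (f N * g (M + ?e - N)))
      = (\<Sum>N | N \<le> M + ?e. of_nat (N i) * (g N * f (M + ?e - N)))"
  proof (rule sum.reindex_bij_witness[of _ "\<lambda>N. M + ?e - N" "\<lambda>N. M + ?e - N"])
    fix N assume "N \<in> {N. N \<le> M + ?e}"
    then have *: "M + ?e - (M + ?e - N) = N" by (auto simp: fun_eq_iff le_fun_def)
    then show "M + ?e - (M + ?e - N) = N" .
    show "M + ?e - N \<in> {N. N \<le> M + ?e}" by (auto simp: le_fun_def)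
    show "of_nat ((M + ?e - N) i) * (g (M + ?e - N) * f (M + ?e - (M + ?e - N))) =
      of_nat ((M + ?e - N) i) * (f N * g (M + ?e - N))"
      unfolding * by (simp add: mult_ac)
  qed (auto simp: fun_eq_iff le_fun_def)
  also have "(\<Sum>N | N \<le> M + ?e. of_nat (N i) * (f N * g (M + ?e - N))) = ps_mult (ps_deriv i f) g M"
    by (rule shift)
  also have "(\<Sum>N | N \<le> M + ?e. of_nat (N i) * (g N * f (M + ?e - N))) = ps_mult f (ps_deriv i g) M"
    unfolding shift by (rule fun_cong[OF ps_mult_commute])
  finally show "ps_deriv i (ps_mult f g) M = (ps_mult (ps_deriv i f) g + ps_mult f (ps_deriv i g)) M"
    by simp
qed

lemmas fun_apply = plus_fun_apply zero_fun_apply uminus_apply minus_apply ps_smult_apply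

text \<open>Power series, fields and forms are all functions, and the same pointwise rules would
  evaluate each of them. From here on passing to components or coefficients is requested
  explicitly.\<close>

declare fun_apply [simp del]

text \<open>\<open>mpol_act p f\<close> is \<open>p(-\<partial>\<^sub>x) f\<close>: in the annihilation superalgebra \<open>\<partial>\<^sub>i\<close> acts as \<open>- \<partial>\<^sub>y\<^sub>i\<close>.\<close>

definition mpol_act :: "'k mpol \<Rightarrow> 'k ps \<Rightarrow> 'k::field_char_0 ps" where
  "mpol_act p f = psum (\<lambda>K c. ps_smult ((-1) ^ mdeg K * c) (pd K f)) p"

lemma mpol_act_add: "mpol_act (p + q) f = mpol_act p f + mpol_act q f"
  unfolding mpol_act_def by (rule psum_add) (simp_all add: distrib_left ps_smult_add)

lemma mpol_act_single: "mpol_act (Poly_Mapping.single K c) f = ps_smult ((-1) ^ mdeg K * c) (pd K f)"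
  by (simp add: mpol_act_def)

lemma mdeg_simps [simp]: "mdeg 0 = 0" "mdeg (M + N) = mdeg M + mdeg N" "mdeg (unit_mexp i) = 1"
  by (simp_all add: mdeg_def sum.distrib unit_mexp_apply fun_apply)

lemma mpol_act_0 [simp]: "mpol_act 0 f = 0"
  by (simp add: mpol_act_def)

lemma mpol_act_const: "mpol_act (pconst c) f = ps_smult c f"
  by (simp add: pconst_def mpol_act_single)

lemma mpol_act_1 [simp]: "mpol_act 1 f = f"
  using mpol_act_const[of 1 f] by simp

lemma mpol_act_var: "mpol_act (pvar i * p) f = - ps_deriv i (mpol_act p f)"
proof (induction p rule: pm_induct)
  case zero
  show ?case by simp
next
  case (single K c p)
  have "mpol_act (pvar i * Poly_Mapping.single K c) f = - ps_deriv i (mpol_act (Poly_Mapping.single K c) f)"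
    by (simp add: pvar_single mpol_act_single pd_unit_add ps_deriv_smult ps_deriv_pd)
       (simp add: fun_eq_iff fun_apply)
  then show ?case using single by (simp add: distrib_left mpol_act_add ps_deriv_add)
qed

lemma mpol_act_pvar: "mpol_act (pvar i) f = - ps_deriv i f"
  using mpol_act_var[of i 1 f] by simp

lemma mpol_act_uminus: "mpol_act (- p) f = - mpol_act p f"
  using mpol_act_add[of "- p" p f] by (simp add: eq_neg_iff_add_eq_0)

lemma mpol_act_add_right: "mpol_act p (f + g) = mpol_act p f + mpol_act p g"
  by (induction p rule: mpol_induct)
     (simp_all add: mpol_act_const mpol_act_add mpol_act_var ps_smult_add ps_deriv_add)

lemma ps_smult_uminus: "ps_smult c (- f) = - ps_smult c f" "ps_smult (- c) f = - ps_smult c f"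
  by (simp_all add: fun_eq_iff fun_apply)

lemma mpol_act_smult: "mpol_act p (ps_smult c f) = ps_smult c (mpol_act p f)"
  by (induction p rule: mpol_induct)
     (simp_all add: mpol_act_const mpol_act_add mpol_act_var ps_smult_add ps_deriv_smult ps_smult_uminus
        mult.commute[of c])

lemma mpol_act_deriv: "mpol_act p (ps_deriv i f) = ps_deriv i (mpol_act p f)"
  by (induction p rule: mpol_induct)
     (simp_all add: mpol_act_const mpol_act_add mpol_act_var ps_deriv_smult ps_deriv_add ps_deriv_uminus
        ps_deriv_commute[of _ i])

section \<open>Polynomials in \<open>\<lambda>\<close> and \<open>\<partial>\<close>\<close>

text \<open>Polynomials in \<open>\<lambda>\<close> whose coefficients are polynomials in \<open>\<partial>\<close>; on coordinates,
  \<open>\<lambda>\<close>-brackets take values in this commutative ring.\<close>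

type_synonym 'k lpol = "mexp \<Rightarrow>\<^sub>0 'k mpol"

definition emb :: "'k mpol \<Rightarrow> 'k::comm_ring_1 lpol" where
  "emb q = Poly_Mapping.single 0 q"

definition lam :: "ix \<Rightarrow> 'k::comm_ring_1 lpol" where
  "lam i = Poly_Mapping.single (unit_mexp i) 1"

abbreviation par :: "ix \<Rightarrow> 'k::comm_ring_1 lpol" where
  "par i \<equiv> emb (pvar i)"

text \<open>The ring homomorphism from F[\<partial>] to F[\<partial>][\<lambda>] over F that
  substitutes \<open>t i\<close> for the variable of index \<open>i\<close>.\<close>

definition ev :: "(ix \<Rightarrow> 'k lpol) \<Rightarrow> 'k mpol \<Rightarrow> 'k::comm_ring_1 lpol" where
  "ev t p = psum (\<lambda>K c. emb (pconst c) * (\<Prod>i\<in>UNIV. t i ^ K i)) p"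

lemma emb_simps: "emb (p + q) = emb p + emb q" "emb (p * q) = emb p * emb q" "emb 0 = 0" "emb 1 = 1"
    "emb (- p) = - emb p" "emb (p - q) = emb p - emb q"
  by (simp_all add: emb_def single_add mult_single single_uminus single_diff)

lemma ev_add: "ev t (p + q) = ev t p + ev t q"
  unfolding ev_def by (rule psum_add) (simp_all add: pconst_add emb_simps distrib_right)

lemma ev_0 [simp]: "ev t 0 = 0"
  by (simp add: ev_def)

lemma ev_const: "ev t (pconst c) = emb (pconst c)"
  by (simp add: ev_def pconst_def emb_def fun_apply)

lemma ev_1 [simp]: "ev t 1 = 1"
  using ev_const[of t 1] by (simp add: emb_simps)

lemma ev_uminus: "ev t (- p) = - ev t p"
  using ev_add[of t "- p" p] by (simp add: eq_neg_iff_add_eq_0)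

lemma ev_diff: "ev t (p - q) = ev t p - ev t q"
  using ev_add[of t p "- q"] by (simp add: ev_uminus)

lemma prod_unit: "(\<Prod>j\<in>UNIV. t j ^ (unit_mexp i + K) j) = t i * (\<Prod>j\<in>UNIV. t j ^ K j)"
  for t :: "ix \<Rightarrow> 'a::comm_monoid_mult"
proof -
  have "(\<Prod>j\<in>UNIV. t j ^ unit_mexp i j) = t i"
    by (simp add: unit_mexp_def if_distrib[of "\<lambda>n. _ ^ n"] prod.delta cong: if_cong)
  then show ?thesis by (simp add: power_add prod.distrib fun_apply)
qed

lemma ev_var: "ev t (pvar i * p) = t i * ev t p"
proof (induction p rule: pm_induct)
  case zero
  show ?case by simp
next
  case (single K c p)
  have "ev t (pvar i * Poly_Mapping.single K c) = t i * ev t (Poly_Mapping.single K c)"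
    unfolding ev_def pvar_single
    by (subst (1 2) psum_single) (simp_all add: emb_simps prod_unit)
  then show ?case using single by (simp add: distrib_left ev_add)
qed

lemma ev_pvar: "ev t (pvar i) = t i"
  using ev_var[of t i 1] by simp

lemma ev_mult: "ev t (p * q) = ev t p * ev t q"
proof -
  have *: "ev t (pconst c * q) = emb (pconst c) * ev t q" for c
  proof (induction q rule: mpol_induct)
    case (const d)
    show ?case unfolding pconst_mult[symmetric] ev_const unfolding pconst_mult emb_simps ..
  next
    case (add p q)
    then show ?case by (simp add: ev_add distrib_left)
  next
    case (var i p)
    then show ?case by (simp add: mult.left_commute[of _ "pvar i"] ev_var)
  qed
  show ?thesis
    by (induction p rule: mpol_induct) (simp_all add: * ev_const ev_add ev_var distrib_right mult.assoc)
qed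

lemma emb_single: "emb q * Poly_Mapping.single J r = Poly_Mapping.single J (q * r)"
  by (simp add: emb_def mult_single)

lemma lam_single: "lam i * Poly_Mapping.single J r = Poly_Mapping.single (unit_mexp i + J) r"
  by (simp add: lam_def mult_single)

text \<open>The substitutions that sesquilinearity prescribes for the coefficients of the first and of the
  second argument of a \<open>\<lambda>\<close>-bracket.\<close>

abbreviation "evl \<equiv> ev (\<lambda>i. - lam i)"
abbreviation "evr \<equiv> ev (\<lambda>i. lam i + par i)"

text \<open>The bidifferential operator with symbol \<open>Q\<close>.\<close>

definition bil :: "'k lpol \<Rightarrow> 'k ps \<Rightarrow> 'k ps \<Rightarrow> 'k::field_char_0 ps" where
  "bil Q f g = psum (\<lambda>J q. mpol_act q (ps_mult (pd J f) g)) Q"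

lemma bil_add: "bil (P + Q) f g = bil P f g + bil Q f g"
  unfolding bil_def by (rule psum_add) (simp_all add: mpol_act_add)

lemma bil_0 [simp]: "bil 0 f g = 0"
  by (simp add: bil_def)

lemma bil_uminus: "bil (- Q) f g = - bil Q f g"
  using bil_add[of "- Q" Q f g] by (simp add: eq_neg_iff_add_eq_0)

lemma bil_diff: "bil (P - Q) f g = bil P f g - bil Q f g"
  using bil_add[of P "- Q"] by (simp add: bil_uminus)

lemma bil_sum: "bil (\<Sum>a\<in>A. P a) f g = (\<Sum>a\<in>A. bil (P a) f g)"
  using sum_comp_morphism[of "\<lambda>Q. bil Q f g" P A] by (simp add: bil_add o_def)

lemma bil_single: "bil (Poly_Mapping.single J q) f g = mpol_act q (ps_mult (pd J f) g)"
  by (simp add: bil_def)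

lemma bil_lam: "bil (lam i * Q) f g = bil Q (ps_deriv i f) g"
proof (induction Q rule: pm_induct)
  case (single K c p)
  have "bil (lam i * Poly_Mapping.single K c) f g = bil (Poly_Mapping.single K c) (ps_deriv i f) g"
    unfolding lam_single bil_single pd_unit_add ..
  then show ?case using single by (simp add: distrib_left bil_add)
qed simp

lemma bil_par: "bil (par i * Q) f g = - ps_deriv i (bil Q f g)"
proof (induction Q rule: pm_induct)
  case (single K c p)
  have "bil (par i * Poly_Mapping.single K c) f g = - ps_deriv i (bil (Poly_Mapping.single K c) f g)"
    unfolding emb_single bil_single mpol_act_var ..
  then show ?case using single by (simp add: distrib_left bil_add ps_deriv_add)
qed simp

text \<open>On a product, \<lambda> of index \<open>i\<close> contributes the derivative of
  \<open>f\<close> times \<open>g\<close>, and \<partial> minus the derivative of the whole product.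
  By Leibniz only minus \<open>f\<close> times the derivative of \<open>g\<close> is left.\<close>

lemma bil_lam_par: "bil ((lam i + par i) * Q) f g = - bil Q f (ps_deriv i g)"
proof (induction Q rule: pm_induct)
  case (single K c p)
  have "bil ((lam i + par i) * Poly_Mapping.single K c) f g = - bil (Poly_Mapping.single K c) f (ps_deriv i g)"
    unfolding distrib_right bil_add bil_lam bil_par
    by (simp add: bil_single mpol_act_deriv[symmetric] ps_deriv_mult mpol_act_add_right ps_deriv_pd)
  then show ?case using single by (simp add: distrib_left bil_add)
qed simp

lemma bil_emb_const: "bil (emb (pconst c) * Q) f g = ps_smult c (bil Q f g)"
proof (induction Q rule: pm_induct)
  case (single K q p)
  have "mpol_act (pconst c * q) h = ps_smult c (mpol_act q h)" for h
  proof (induction q rule: mpol_induct)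
    case (const d)
    show ?case unfolding pconst_mult[symmetric] mpol_act_const by simp
  next
    case (add p q)
    then show ?case by (simp add: mpol_act_add distrib_left ps_smult_add)
  next
    case (var i p)
    then show ?case
      by (simp add: mult.left_commute[of _ "pvar i"] mpol_act_var ps_deriv_smult ps_smult_uminus)
  qed
  then have "bil (emb (pconst c) * Poly_Mapping.single K q) f g = ps_smult c (bil (Poly_Mapping.single K q) f g)"
    unfolding emb_single bil_single by blast
  then show ?case using single by (simp add: distrib_left bil_add ps_smult_add)
qed simp

lemma bil_smult: "bil Q (ps_smult c f) g = ps_smult c (bil Q f g)" "bil Q f (ps_smult c g) = ps_smult c (bil Q f g)"
proof -
  have pd: "pd J (ps_smult c f) = ps_smult c (pd J f)" for J c f
    by (simp add: pd_def fun_eq_iff fun_apply)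
  show "bil Q (ps_smult c f) g = ps_smult c (bil Q f g)"
    by (induction Q rule: pm_induct)
       (simp_all add: bil_add bil_single pd ps_mult_smult mpol_act_smult ps_smult_add)
  show "bil Q f (ps_smult c g) = ps_smult c (bil Q f g)"
    by (induction Q rule: pm_induct)
       (simp_all add: bil_add bil_single pd ps_mult_smult mpol_act_smult ps_smult_add)
qed

lemma bil_add_right: "bil Q f (g + h) = bil Q f g + bil Q f h"
    "bil Q (g + h) f = bil Q g f + bil Q h f"
proof -
  have pd: "pd J (g + h) = pd J g + pd J h" for J
    by (simp add: pd_def fun_eq_iff fun_apply algebra_simps)
  show "bil Q f (g + h) = bil Q f g + bil Q f h"
    by (induction Q rule: pm_induct)
       (simp_all add: bil_add bil_single ps_mult_add mpol_act_add_right)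
  show "bil Q (g + h) f = bil Q g f + bil Q h f"
    by (induction Q rule: pm_induct)
       (simp_all add: bil_add bil_single pd ps_mult_add mpol_act_add_right)
qed

lemma bil_uminus_right: "bil Q f (- g) = - bil Q f g" "bil Q (- f) g = - bil Q f g"
  using bil_smult(2)[of Q f "-1" g] bil_smult(1)[of Q "-1" f g] by (simp_all add: ps_smult_uminus)

text \<open>The sign in the substitution of -\<lambda> agrees with the sign in
  \<open>mpol_act\<close>: a polynomial coefficient of the first argument acts on the first power
  series only. \<open>bil_evr\<close> is the counterpart for the second argument; together they are
  sesquilinearity read on operators.\<close>

lemma bil_evl: "bil (evl p * Q) f g = bil Q (mpol_act p f) g"
proof (induction p arbitrary: f rule: mpol_induct)
  case (const c)
  show ?case unfolding ev_const bil_emb_const mpol_act_const bil_smult ..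
next
  case (add p q)
  show ?case unfolding ev_add distrib_right bil_add mpol_act_add add bil_add_right ..
next
  case (var i p)
  have "bil (evl (pvar i * p) * Q) f g = - bil (lam i * (evl p * Q)) f g"
    by (simp add: ev_var bil_uminus mult.assoc)
  then show ?case unfolding bil_lam var mpol_act_var mpol_act_deriv bil_uminus_right .
qed

lemma bil_evr: "bil (evr p * Q) f g = bil Q f (mpol_act p g)"
proof (induction p arbitrary: g rule: mpol_induct)
  case (const c)
  show ?case unfolding ev_const bil_emb_const mpol_act_const bil_smult ..
next
  case (add p q)
  show ?case unfolding ev_add distrib_right bil_add mpol_act_add add bil_add_right ..
next
  case (var i p)
  have "bil (evr (pvar i * p) * Q) f g = bil ((lam i + par i) * (evr p * Q)) f g"
    by (simp add: ev_var mult.assoc)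
  then show ?case unfolding bil_lam_par var mpol_act_var mpol_act_deriv bil_uminus_right .
qed

lemma bil_1: "bil 1 f g = ps_mult f g"
proof -
  have "bil (Poly_Mapping.single 0 1) f g = ps_mult f g" by (simp only: bil_single pd_0 mpol_act_1)
  then show ?thesis by simp
qed

text \<open>\<open>Q(-\<lambda>-\<partial>)\<close>; all variables commute here, so the order of the operators in \<open>skew_subst\<close> is
  immaterial on coordinates.\<close>

definition skewP :: "'k lpol \<Rightarrow> 'k::comm_ring_1 lpol" where
  "skewP Q = psum (\<lambda>J q. emb q * (\<Prod>i\<in>UNIV. (- lam i - par i) ^ J i)) Q"

lemma skewP_add: "skewP (P + Q) = skewP P + skewP Q"
  unfolding skewP_def by (rule psum_add) (simp_all add: emb_simps distrib_right)

lemma skewP_0 [simp]: "skewP 0 = 0"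
  by (simp add: skewP_def)

lemma skewP_single: "skewP (Poly_Mapping.single J q) = emb q * (\<Prod>i\<in>UNIV. (- lam i - par i) ^ J i)"
  unfolding skewP_def by (rule psum_single) (simp add: emb_simps)

lemma skewP_mult: "skewP (P * Q) = skewP P * skewP Q"
proof (induction P rule: pm_induct)
  case (single J q P)
  have "skewP (Poly_Mapping.single J q * Q) = skewP (Poly_Mapping.single J q) * skewP Q"
  proof (induction Q rule: pm_induct)
    case (single K r Q)
    have "skewP (Poly_Mapping.single J q * Poly_Mapping.single K r)
        = skewP (Poly_Mapping.single J q) * skewP (Poly_Mapping.single K r)"
      by (simp add: mult_single skewP_single emb_simps power_add prod.distrib fun_apply mult_ac)
    then show ?case using single by (simp add: distrib_left skewP_add)
  qed simp
  then show ?case using single by (simp add: distrib_right skewP_add)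
qed simp

lemma skewP_emb: "skewP (emb q) = emb q"
  unfolding emb_def[of q] skewP_single by (simp add: emb_def fun_apply)

lemma skewP_lam: "skewP (lam i) = - lam i - par i"
  using prod_unit[of "\<lambda>i. - lam i - par i" i 0] unfolding lam_def skewP_single by (simp add: fun_apply emb_simps)

lemma skewP_uminus: "skewP (- p) = - skewP p"
  using skewP_add[of "- p" p] by (simp add: eq_neg_iff_add_eq_0)

lemma skewP_diff: "skewP (p - q) = skewP p - skewP q"
  using skewP_add[of p "- q"] by (simp add: skewP_uminus)

lemma skewP_sum: "skewP (\<Sum>a\<in>A. P a) = (\<Sum>a\<in>A. skewP (P a))"
  using sum_comp_morphism[of skewP P A] by (simp add: skewP_add o_def)

text \<open>Replacing \<lambda> by -\<lambda>-\<partial> turns -\<lambda> into \<lambda>+\<partial>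
  and back, so it exchanges the roles of the two arguments.\<close>

lemma skewP_evl: "skewP (evl p) = evr p"
  by (induction p rule: mpol_induct) (simp_all add: ev_const ev_add ev_var skewP_add skewP_mult skewP_emb skewP_lam
      skewP_uminus left_diff_distrib distrib_right)

lemma skewP_evr: "skewP (evr p) = evl p"
  by (induction p rule: mpol_induct) (simp_all add: ev_const ev_add ev_var skewP_add skewP_mult skewP_emb skewP_lam
      skewP_uminus left_diff_distrib distrib_right)

section \<open>Kronecker deltas and the alternating symbol\<close>

lemma sum_of_bool: "(\<Sum>m\<in>UNIV. of_bool (m = j) * f m) = f j"
  for f :: "ix \<Rightarrow> 'a::comm_ring_1"
proof -
  have "(\<Sum>m\<in>UNIV. of_bool (m = j) * f m) = (\<Sum>m\<in>UNIV. if m = j then f m else 0)"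
    by (intro sum.cong) auto
  then show ?thesis by simp
qed

lemma bij_case_ix:
  assumes "distinct [i, j, k, l, t]"
  shows "bij (case_ix i j k l t :: ix \<Rightarrow> ix)"
proof -
  have "inj (case_ix i j k l t)"
    using assms by (auto simp: inj_def split: ix.splits)
  moreover from this have "surj (case_ix i j k l t)"
    using endo_inj_surj[of UNIV "case_ix i j k l t"] by simp
  ultimately show ?thesis by (simp add: bij_def)
qed

text \<open>Exchanging two positions is composition on the right with a transposition, which is
  odd.\<close>

lemma sign_case_ix_swap:
  assumes "distinct [i, j, k, l, t]" "a \<noteq> b"
    and "case_ix i j k l t \<circ> transpose a b = case_ix i' j' k' l' t'"
  shows "sign (case_ix i' j' k' l' t') = - sign (case_ix i j k l t)"
  using assms
  by (simp flip: assms(3) add: sign_compose bij_case_ix permutation sign_swap_id permutation_swap_id)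

lemma eps_swap:
  "eps j i k l t = - eps i j k l t"
  "eps i k j l t = - eps i j k l t"
  "eps i j l k t = - eps i j k l t"
  "eps i j k t l = - eps i j k l t"
proof -
  show "eps j i k l t = - eps i j k l t"
    using sign_case_ix_swap[of i j k l t I1 I2 j i k l t]
    by (auto simp: eps_def fun_eq_iff transpose_def split: ix.splits)
  show "eps i k j l t = - eps i j k l t"
    using sign_case_ix_swap[of i j k l t I2 I3 i k j l t]
    by (auto simp: eps_def fun_eq_iff transpose_def split: ix.splits)
  show "eps i j l k t = - eps i j k l t"
    using sign_case_ix_swap[of i j k l t I3 I4 i j l k t]
    by (auto simp: eps_def fun_eq_iff transpose_def split: ix.splits)
  show "eps i j k t l = - eps i j k l t"
    using sign_case_ix_swap[of i j k l t I4 I5 i j k t l]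
    by (auto simp: eps_def fun_eq_iff transpose_def split: ix.splits)
qed

text \<open>Four adjacent exchanges, hence an even permutation. This makes the product of two forms
  symmetric, as the bracket of odd elements has to be.\<close>

lemma eps_pairs: "eps k l i j t = eps i j k l t"
  by (simp only: eps_swap(2)[of k l i j t] eps_swap(1)[of k i l j t] eps_swap(3)[of i k l j t]
      eps_swap(2)[of i k j l t] minus_minus)

lemma eps_shuffle: "eps p i r j t = - eps i j p r t"
  by (simp only: eps_swap(1)[of p i r j t] eps_swap(3)[of i p r j t] eps_swap(2)[of i p j r t] minus_minus)

lemma emb_const_eps: "emb (pconst (eps i j k l t)) = eps i j k l t"
  by (simp add: eps_def emb_simps emb_def)

section \<open>Coordinates\<close>

text \<open>The 5 + 25 coordinates of the free ambient module. They are linear over F[\<partial>]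
  and separate points, so an identity between \<lambda>-brackets can be checked coordinate by
  coordinate in the commutative ring \<open>lpol\<close>.\<close>

definition re_proj :: "('k::comm_ring_1 re_amb \<Rightarrow> 'k mpol) \<Rightarrow> bool" where
  "re_proj \<pi> \<longleftrightarrow> (\<exists>t. \<pi> = (\<lambda>r. fst r t)) \<or> (\<exists>j k. \<pi> = (\<lambda>r. snd r j k))"

lemma re_proj_fst: "re_proj (\<lambda>r. fst r t)" and re_proj_snd: "re_proj (\<lambda>r. snd r j k)"
  by (auto simp: re_proj_def)

lemma re_act_simps: "fst (re_act p x) t = p * fst x t" "snd (re_act p x) j k = p * snd x j k"
  by (simp_all add: re_act_def split_beta)

lemma re_proj_simps:
  assumes "re_proj \<pi>"
  shows "\<pi> 0 = 0" "\<pi> (x + y) = \<pi> x + \<pi> y" "\<pi> (- x) = - \<pi> x" "\<pi> (re_act p x) = p * \<pi> x"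
  using assms by (auto simp: re_proj_def fun_apply re_act_simps)

lemma re_amb_eqI:
  assumes "\<And>\<pi>. re_proj \<pi> \<Longrightarrow> \<pi> x = \<pi> y"
  shows "x = y"
proof (rule prod_eqI)
  show "fst x = fst y" using assms[OF re_proj_fst] by (rule ext)
  show "snd x = snd y" by (intro ext) (rule assms[OF re_proj_snd])
qed

lemma lpol_amb_eqI:
  assumes "\<And>\<pi>. re_proj \<pi> \<Longrightarrow> Poly_Mapping.map \<pi> X = Poly_Mapping.map \<pi> Y"
  shows "X = Y"
proof (rule poly_mapping_eqI, rule re_amb_eqI)
  fix J and \<pi> :: "'a re_amb \<Rightarrow> 'a mpol" assume \<pi>: "re_proj \<pi>"
  then show "\<pi> (Poly_Mapping.lookup X J) = \<pi> (Poly_Mapping.lookup Y J)"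
    using arg_cong[OF assms[OF \<pi>], of "\<lambda>Z. Poly_Mapping.lookup Z J"] by (simp add: re_proj_simps)
qed

lemma map_add_morphism:
  assumes "F 0 = 0" "\<And>x y. F (x + y) = F x + F y"
  shows "Poly_Mapping.map F (X + Y) = Poly_Mapping.map F X + Poly_Mapping.map F Y"
  by (rule poly_mapping_eqI) (simp add: assms lookup_add)

lemma map_0 [simp]: "Poly_Mapping.map F 0 = 0"
  by (rule poly_mapping_eqI) (simp add: map.rep_eq)

lemma re_act_0 [simp]: "re_act p 0 = 0" "re_act 0 x = 0" "re_act 1 x = x"
  by (auto intro!: re_amb_eqI simp: re_proj_simps)

lemma re_act_add: "re_act p (x + y) = re_act p x + re_act p y" "re_act (p + q) x = re_act p x + re_act q x"
  by (auto intro!: re_amb_eqI simp: re_proj_simps algebra_simps)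

lemma re_act_mult: "re_act p (re_act q x) = re_act (p * q) x"
  by (auto intro!: re_amb_eqI simp: re_proj_simps mult.assoc)

interpretation re: module re_act
  by unfold_locales (simp_all add: re_act_add re_act_mult)

lemma lam_mult_psum: "lam_mult i X = psum (\<lambda>J r. Poly_Mapping.single (J + unit_mexp i) r) X"
  by (simp add: lam_mult_def psum_def)

lemma lam_mult_add: "lam_mult i (X + Y) = lam_mult i X + lam_mult i Y"
  unfolding lam_mult_psum by (rule psum_add) (simp_all add: single_add)

lemma lam_mult_single: "lam_mult i (Poly_Mapping.single J r) = Poly_Mapping.single (J + unit_mexp i) r"
  by (simp add: lam_mult_psum)

lemma lam_mult_0 [simp]: "lam_mult i 0 = 0"
  by (simp add: lam_mult_psum)

text \<open>On a coordinate, multiplication by \<lambda> and the action of F[\<partial>] both become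
  multiplication in \<open>lpol\<close>.\<close>

lemma proj_map_simps:
  assumes "re_proj \<pi>"
  shows "Poly_Mapping.map \<pi> (X + Y) = Poly_Mapping.map \<pi> X + Poly_Mapping.map \<pi> Y"
    "Poly_Mapping.map \<pi> (- X) = - Poly_Mapping.map \<pi> X"
    "Poly_Mapping.map \<pi> (X - Y) = Poly_Mapping.map \<pi> X - Poly_Mapping.map \<pi> Y"
    "Poly_Mapping.map \<pi> (Poly_Mapping.single J r) = Poly_Mapping.single J (\<pi> r)"
    "Poly_Mapping.map \<pi> (lam_mult i X) = lam i * Poly_Mapping.map \<pi> X"
    "Poly_Mapping.map \<pi> (Poly_Mapping.map (re_act p) X) = emb p * Poly_Mapping.map \<pi> X"
    "Poly_Mapping.map \<pi> (sum f A) = (\<Sum>a\<in>A. Poly_Mapping.map \<pi> (f a))"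
proof -
  note s = re_proj_simps[OF assms]
  show add: "Poly_Mapping.map \<pi> (X + Y) = Poly_Mapping.map \<pi> X + Poly_Mapping.map \<pi> Y" for X Y
    by (rule map_add_morphism) (simp_all add: s)
  show m: "Poly_Mapping.map \<pi> (- X) = - Poly_Mapping.map \<pi> X" for X
    using add[of "- X" X] by (simp add: eq_neg_iff_add_eq_0)
  show "Poly_Mapping.map \<pi> (X - Y) = Poly_Mapping.map \<pi> X - Poly_Mapping.map \<pi> Y"
    using add[of X "- Y"] by (simp add: m)
  show si: "Poly_Mapping.map \<pi> (Poly_Mapping.single J r) = Poly_Mapping.single J (\<pi> r)" for J r
    by (rule poly_mapping_eqI) (simp add: s lookup_single when_def)
  show "Poly_Mapping.map \<pi> (lam_mult i X) = lam i * Poly_Mapping.map \<pi> X"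
  proof (induction X rule: pm_induct)
    case (single K c p)
    show ?case unfolding lam_mult_add add distrib_left lam_mult_single si lam_single single
      by (simp add: add.commute)
  qed simp
  show "Poly_Mapping.map \<pi> (Poly_Mapping.map (re_act p) X) = emb p * Poly_Mapping.map \<pi> X"
  proof (induction X rule: pm_induct)
    case (single K c q)
    have si': "Poly_Mapping.map (re_act p) (Poly_Mapping.single K c) = Poly_Mapping.single K (re_act p c)"
      by (rule poly_mapping_eqI) (simp add: lookup_single when_def)
    have add': "Poly_Mapping.map (re_act p) (X + Y) = Poly_Mapping.map (re_act p) X + Poly_Mapping.map (re_act p) Y" for X Y
      by (rule map_add_morphism) (simp_all add: re_act_add)
    show ?case unfolding add' add distrib_left si' si emb_single single s by (rule refl)
  qed simp
  show "Poly_Mapping.map \<pi> (sum f A) = (\<Sum>a\<in>A. Poly_Mapping.map \<pi> (f a))"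
    using sum_comp_morphism[of "Poly_Mapping.map \<pi>" f A] by (simp add: add o_def)
qed

definition assemble :: "(ix \<Rightarrow> 'k lpol) \<Rightarrow> (ix \<Rightarrow> ix \<Rightarrow> 'k lpol) \<Rightarrow> (mexp \<Rightarrow>\<^sub>0 'k::comm_ring_1 re_amb)" where
  "assemble A B = Abs_poly_mapping
     (\<lambda>J. (\<lambda>t. Poly_Mapping.lookup (A t) J, \<lambda>j k. Poly_Mapping.lookup (B j k) J))"

text \<open>The support lies in the union of the supports of 30 coordinates, hence is finite, and
  \<open>Abs_poly_mapping\<close> loses nothing.\<close>

lemma lookup_assemble:
  "Poly_Mapping.lookup (assemble A B) J = (\<lambda>t. Poly_Mapping.lookup (A t) J, \<lambda>j k. Poly_Mapping.lookup (B j k) J)"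
proof -
  have "{J. (\<lambda>t. Poly_Mapping.lookup (A t) J, \<lambda>j k. Poly_Mapping.lookup (B j k) J) \<noteq> 0} \<subseteq>
      (\<Union>t. Poly_Mapping.keys (A t)) \<union> (\<Union>j. \<Union>k. Poly_Mapping.keys (B j k))"
    by (auto simp: zero_prod_def fun_eq_iff fun_apply in_keys_iff)
  then have "finite {J. (\<lambda>t. Poly_Mapping.lookup (A t) J, \<lambda>j k. Poly_Mapping.lookup (B j k) J) \<noteq> 0}"
    by (rule finite_subset) auto
  then show ?thesis unfolding assemble_def by (subst lookup_Abs_poly_mapping) auto
qed

lemma map_assemble:
  "Poly_Mapping.map (\<lambda>r. fst r t) (assemble A B) = A t"
  "Poly_Mapping.map (\<lambda>r. snd r j k) (assemble A B) = B j k"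
proof -
  show "Poly_Mapping.map (\<lambda>r. fst r t) (assemble A B) = A t"
    by (rule poly_mapping_eqI) (simp add: fun_apply lookup_assemble)
  show "Poly_Mapping.map (\<lambda>r. snd r j k) (assemble A B) = B j k"
    by (rule poly_mapping_eqI) (simp add: fun_apply lookup_assemble)
qed

section \<open>The bracket on the ambient module\<close>

text \<open>The even and the odd component of the bracket of \<open>E(5,10)\<close>, with \<open>\<lambda>\<^sub>m\<close> in place of a derivative
  of the first argument and \<open>- (\<lambda>\<^sub>m + \<partial>\<^sub>m)\<close> in place of a derivative of the second one.\<close>

definition brE :: "'k re_amb \<Rightarrow> 'k re_amb \<Rightarrow> ix \<Rightarrow> 'k::field_char_0 lpol" where
  "brE x y t = - (\<Sum>m\<in>UNIV. evl (fst x m) * ((lam m + par m) * evr (fst y t)))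
     - (\<Sum>m\<in>UNIV. evr (fst y m) * (lam m * evl (fst x t)))
     + emb (pconst (1 / 4)) * (\<Sum>i\<in>UNIV. \<Sum>j\<in>UNIV. \<Sum>k\<in>UNIV. \<Sum>l\<in>UNIV.
        emb (pconst (eps i j k l t)) * (evl (snd x i j) * evr (snd y k l)))"

definition brO :: "'k re_amb \<Rightarrow> 'k re_amb \<Rightarrow> ix \<Rightarrow> ix \<Rightarrow> 'k::field_char_0 lpol" where
  "brO x y j k =
     (\<Sum>m\<in>UNIV. evl (fst x m) * (- ((lam m + par m) * evr (snd y j k)) + lam j * evr (snd y m k) + lam k * evr (snd y j m)))
   - (\<Sum>m\<in>UNIV. evr (fst y m) * (lam m * evl (snd x j k) - (lam j + par j) * evl (snd x m k) - (lam k + par k) * evl (snd x j m)))"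

definition amb_br :: "'k re_amb \<Rightarrow> 'k re_amb \<Rightarrow> (mexp \<Rightarrow>\<^sub>0 'k::field_char_0 re_amb)" where
  "amb_br x y = assemble (brE x y) (brO x y)"

lemma map_amb_br:
  "Poly_Mapping.map (\<lambda>r. fst r t) (amb_br x y) = brE x y t"
  "Poly_Mapping.map (\<lambda>r. snd r j k) (amb_br x y) = brO x y j k"
  by (simp_all add: amb_br_def map_assemble)

lemma brE_left_add: "brE (x + x') y t = brE x y t + brE x' y t"
  unfolding brE_def fst_add snd_add plus_fun_apply ev_add ring_distribs sum.distrib by simp

text \<open>Every summand contains exactly one factor \<open>evl\<close> of a coordinate of
  \<open>x\<close>, and \<open>evl\<close> is multiplicative, so \<open>evl p\<close> factors out.
  This is sesquilinearity for a whole polynomial at once; the next lemmas treat the other component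
  and the other argument alike.\<close>

lemma brE_left_mult: "brE (re_act p x) y t = evl p * brE x y t"
  unfolding brE_def re_act_simps ev_mult
  by (simp only: mult.assoc mult.left_commute[of _ "evl p"] sum_distrib_left[symmetric]
      right_diff_distrib[symmetric] distrib_left[symmetric] mult_minus_right[symmetric])

lemma brO_left_add: "brO (x + x') y j k = brO x y j k + brO x' y j k"
  unfolding brO_def fst_add snd_add plus_fun_apply ev_add
  by (simp add: algebra_simps sum.distrib sum_subtractf sum_negf)

lemma brO_left_mult: "brO (re_act p x) y j k = evl p * brO x y j k"
  unfolding brO_def re_act_simps ev_mult
  by (simp only: mult.assoc mult.left_commute[of _ "evl p"] sum_distrib_left[symmetric]
      right_diff_distrib[symmetric] distrib_left[symmetric] mult_minus_right[symmetric])

lemma brE_right_add: "brE x (y + y') t = brE x y t + brE x y' t"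
  unfolding brE_def fst_add snd_add plus_fun_apply ev_add ring_distribs sum.distrib by simp

lemma brE_right_mult: "brE x (re_act p y) t = evr p * brE x y t"
  unfolding brE_def re_act_simps ev_mult
  by (simp only: mult.assoc mult.left_commute[of _ "evr p"] sum_distrib_left[symmetric]
      right_diff_distrib[symmetric] distrib_left[symmetric] mult_minus_right[symmetric])

lemma brO_right_add: "brO x (y + y') j k = brO x y j k + brO x y' j k"
  unfolding brO_def fst_add snd_add plus_fun_apply ev_add
  by (simp add: algebra_simps sum.distrib sum_subtractf sum_negf)

lemma brO_right_mult: "brO x (re_act p y) j k = evr p * brO x y j k"
  unfolding brO_def re_act_simps ev_mult
  by (simp only: mult.assoc mult.left_commute[of _ "evr p"] sum_distrib_left[symmetric]
      right_diff_distrib[symmetric] distrib_left[symmetric] mult_minus_right[symmetric])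

section \<open>Values of the bracket on the generators\<close>

lemma ev_of_bool: "ev t (of_bool b * p) = of_bool b * ev t p"
  by (cases b) auto

lemma emb_of_bool: "emb (of_bool b * p) = of_bool b * emb p"
  by (cases b) (auto simp: emb_simps)

lemma re_a_simps: "fst (re_a i j) t = of_bool (t = j) * pvar i - of_bool (t = i) * pvar j" "snd (re_a i j) = 0"
  by (auto simp: re_a_def re_act_simps re_dx_def fun_apply fun_eq_iff)

lemma re_b_simps:
  fixes k :: ix
  defines "b \<equiv> re_b k :: 'k::comm_ring_1 re_amb"
  shows "fst b = 0" "snd b p q = of_bool (q = k) * pvar p - of_bool (p = k) * pvar q"
proof -
  show "fst b = 0"
    by (auto simp: b_def re_b_def fst_sum sum_apply re_act_simps re_d_def fun_apply fun_eq_iff)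
  have summand: "snd (re_act (pvar h) (re_d h k)) p q
      = of_bool (h = p) * (pvar h * of_bool (q = k)) - of_bool (h = q) * (pvar h * of_bool (p = k) :: 'k mpol)" for h
    unfolding re_act_simps re_d_def by (cases "h = p"; cases "h = q") simp_all
  show "snd b p q = of_bool (q = k) * pvar p - of_bool (p = k) * pvar q"
    unfolding b_def re_b_def snd_sum sum_apply summand sum_subtractf sum_of_bool by (simp only: mult.commute)
qed

lemmas gen_simps = re_a_simps re_b_simps fun_apply ev_diff ev_uminus ev_of_bool ev_pvar emb_simps emb_of_bool

lemma ev_gen:
  "evl (fst (re_a i j) m) = of_bool (m = i) * lam j - of_bool (m = j) * lam i"
  "evr (fst (re_a i j) m) = of_bool (m = j) * (lam i + par i) - of_bool (m = i) * (lam j + par j)"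
  "evl (snd (re_b k) p q) = of_bool (p = k) * lam q - of_bool (q = k) * lam p"
  "evr (snd (re_b k) p q) = of_bool (q = k) * (lam p + par p) - of_bool (p = k) * (lam q + par q)"
  "emb (snd (re_b k) p q) = of_bool (q = k) * par p - of_bool (p = k) * par q"
  by (simp_all add: gen_simps)

lemma sum_evl_a: "(\<Sum>m\<in>UNIV. evl (fst (re_a i j) m) * G m) = lam j * G i - lam i * G j"
proof -
  have "(\<Sum>m\<in>UNIV. evl (fst (re_a i j) m) * G m)
      = - (\<Sum>m\<in>UNIV. of_bool (m = j) * (lam i * G m)) + (\<Sum>m\<in>UNIV. of_bool (m = i) * (lam j * G m))"
    unfolding ev_gen by (simp add: algebra_simps sum_subtractf sum.distrib sum_negf)
  then show ?thesis by (simp add: sum_of_bool)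
qed

lemma sum_evr_a: "(\<Sum>m\<in>UNIV. evr (fst (re_a i j) m) * G m) = (lam i + par i) * G j - (lam j + par j) * G i"
proof -
  have "(\<Sum>m\<in>UNIV. evr (fst (re_a i j) m) * G m)
      = (\<Sum>m\<in>UNIV. of_bool (m = j) * ((lam i + par i) * G m)) - (\<Sum>m\<in>UNIV. of_bool (m = i) * ((lam j + par j) * G m))"
    unfolding ev_gen by (simp add: algebra_simps sum_subtractf sum.distrib sum_negf)
  then show ?thesis by (simp add: sum_of_bool)
qed

lemma single_as_lam: "Poly_Mapping.single (unit_mexp i) q = lam i * emb q"
  "Poly_Mapping.single (unit_mexp i + unit_mexp j) q = lam i * lam j * emb q"
  by (simp_all add: lam_def emb_def mult_single)

lemma amb_br_aa:
  "amb_br (re_a i j) (re_a r s) =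
        Poly_Mapping.single (unit_mexp j + unit_mexp r) (re_a s i) + Poly_Mapping.single (unit_mexp i + unit_mexp r) (re_a j s)
        + Poly_Mapping.single (unit_mexp i + unit_mexp s) (re_a r j) + Poly_Mapping.single (unit_mexp j + unit_mexp s) (re_a i r)
        + Poly_Mapping.single (unit_mexp i) (re_act (pvar j) (re_a r s))
        + Poly_Mapping.single (unit_mexp j) (re_act (pvar i) (re_a s r))"
  (is "_ = ?R")
proof (rule lpol_amb_eqI)
  fix \<pi> :: "'a re_amb \<Rightarrow> 'a mpol" assume "re_proj \<pi>"
  moreover have "Poly_Mapping.map (\<lambda>r. fst r t) (amb_br (re_a i j) (re_a r s)) = Poly_Mapping.map (\<lambda>r. fst r t) ?R" for t
    unfolding map_amb_br proj_map_simps[OF re_proj_fst] brE_def sum_evl_a sum_evr_a single_as_lam re_act_simps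
    by (simp add: gen_simps algebra_simps)
  moreover have "Poly_Mapping.map (\<lambda>r. snd r p q) (amb_br (re_a i j) (re_a r s)) = Poly_Mapping.map (\<lambda>r. snd r p q) ?R" for p q
    unfolding map_amb_br proj_map_simps[OF re_proj_snd] brO_def sum_evl_a sum_evr_a single_as_lam re_act_simps
    by (simp add: gen_simps)
  ultimately show "Poly_Mapping.map \<pi> (amb_br (re_a i j) (re_a r s)) = Poly_Mapping.map \<pi> ?R"
    by (auto simp: re_proj_def)
qed

lemma amb_br_ab:
  "amb_br (re_a i j) (re_b k) =
        Poly_Mapping.single (unit_mexp i) (re_act (pvar j) (re_b k)) - Poly_Mapping.single (unit_mexp j) (re_act (pvar i) (re_b k))
        + (if i = k then \<Sum>r\<in>UNIV. Poly_Mapping.single (unit_mexp j + unit_mexp r) (re_b r) else 0)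
        - (if j = k then \<Sum>r\<in>UNIV. Poly_Mapping.single (unit_mexp i + unit_mexp r) (re_b r) else 0)"
  (is "_ = ?R")
proof (rule lpol_amb_eqI)
  fix \<pi> :: "'a re_amb \<Rightarrow> 'a mpol" assume "re_proj \<pi>"
  moreover have "Poly_Mapping.map (\<lambda>r. fst r t) (amb_br (re_a i j) (re_b k)) = Poly_Mapping.map (\<lambda>r. fst r t) ?R" for t
    unfolding map_amb_br proj_map_simps[OF re_proj_fst] brE_def sum_evl_a single_as_lam re_act_simps
      if_distrib[of "Poly_Mapping.map _"]
    by (simp add: gen_simps)
  moreover have "Poly_Mapping.map (\<lambda>r. snd r p q) (amb_br (re_a i j) (re_b k)) = Poly_Mapping.map (\<lambda>r. snd r p q) ?R" for p q
  proof -
    \<comment> \<open>The coordinate \<open>(p, q)\<close> of \<open>b_r\<close> is nonzero only if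
      \<open>r\<close> is \<open>p\<close> or \<open>q\<close>, so the sum over \<open>r\<close>
      collapses to two terms.\<close>
    have S: "(\<Sum>r\<in>UNIV. lam x * lam r * emb (snd (re_b r) p q)) = lam x * (lam q * par p - lam p * par q)" for x
    proof -
      have "(\<Sum>r\<in>UNIV. lam x * lam r * emb (snd (re_b r) p q))
        = (\<Sum>r\<in>UNIV. of_bool (r = q) * (lam x * lam r * par p)) - (\<Sum>r\<in>UNIV. of_bool (r = p) * (lam x * lam r * par q))"
        unfolding ev_gen by (simp add: algebra_simps sum_subtractf eq_commute)
      also have "\<dots> = lam x * (lam q * par p - lam p * par q)"
        unfolding sum_of_bool by (simp add: algebra_simps)
      finally show ?thesis .
    qed
    show ?thesis
      unfolding map_amb_br proj_map_simps[OF re_proj_snd] brO_def sum_evl_a single_as_lam re_act_simps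
        if_distrib[of "Poly_Mapping.map _"] S
      unfolding ev_gen
      by (cases "i = k"; cases "j = k"; cases "p = k"; cases "q = k"; simp add: gen_simps algebra_simps)
  qed
  ultimately show "Poly_Mapping.map \<pi> (amb_br (re_a i j) (re_b k)) = Poly_Mapping.map \<pi> ?R"
    by (auto simp: re_proj_def)
qed

text \<open>\<open>lpol\<close> is no field, but it contains the constants of a field of
  characteristic 0, so a positive integer can be cancelled by multiplying with its inverse
  constant.\<close>

lemma lpol_cancel:
  fixes x :: "'k::field_char_0 lpol"
  assumes "n \<noteq> 0"
  shows "emb (pconst (1 / of_nat n)) * (of_nat n * x) = x"
proof -
  have "emb (pconst (1 / of_nat n)) * (emb (pconst (of_nat n)) * x) = emb (pconst (1 / of_nat n * of_nat n)) * x"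
    unfolding pconst_mult emb_simps mult.assoc ..
  moreover have "emb (pconst (of_nat n)) = (of_nat n :: 'k lpol)"
    by (simp add: pconst_def emb_def)
  moreover have "1 / of_nat n * of_nat n = (1 :: 'k)" using assms by simp
  ultimately show ?thesis by (simp only: pconst_1 emb_simps mult_1_left)
qed

lemma lpol_eq_neg:
  fixes x :: "'k::field_char_0 lpol"
  assumes "x = - x"
  shows "x = 0"
proof -
  have "x + x = 0" using assms by (simp only: eq_neg_iff_add_eq_0)
  then have "of_nat 2 * x = 0" by (simp only: of_nat_numeral mult_2)
  moreover have "emb (pconst (1 / of_nat 2)) * (of_nat 2 * x) = x" by (rule lpol_cancel) simp
  ultimately show ?thesis by (simp only: mult_zero_right)
qed

text \<open>Each of the two contractions with an alternating tensor counts a pair of indices twice;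
  the resulting 4 cancels the 1/4. The terms quadratic in \<lambda> drop out because
  \<open>eps\<close> is alternating in \<open>p\<close>, \<open>r\<close>.\<close>

lemma brE_bb: "brE (re_b i) (re_b j) t = (\<Sum>p\<in>UNIV. \<Sum>r\<in>UNIV. eps i j p r t * (lam p * par r))"
proof -
  \<comment> \<open>The coordinates of \<open>b_i\<close> consist of two terms that differ by an
    exchange of indices and a sign. Against an alternating \<open>G\<close> both contribute the
    same.\<close>
  have L: "(\<Sum>p\<in>UNIV. \<Sum>q\<in>UNIV. evl (snd (re_b i) p q) * G p q) = 2 * (\<Sum>p\<in>UNIV. - lam p * G p i)"
    if "\<And>p q. G q p = - G p q" for G
  proof -
    have "(\<Sum>p\<in>UNIV. \<Sum>q\<in>UNIV. evl (snd (re_b i) p q) * G p q)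
       = (\<Sum>p\<in>UNIV. \<Sum>q\<in>UNIV. of_bool (q = i) * (- lam p * G p q)) - (\<Sum>p\<in>UNIV. \<Sum>q\<in>UNIV. of_bool (p = i) * (- lam q * G p q))"
      unfolding ev_gen by (simp add: algebra_simps sum_subtractf sum.distrib sum_negf)
    moreover have "(\<Sum>p\<in>UNIV. \<Sum>q\<in>UNIV. of_bool (p = i) * (- lam q * G p q)) = (\<Sum>q\<in>UNIV. \<Sum>p\<in>UNIV. of_bool (p = i) * (- lam q * G p q))"
      by (rule sum.swap)
    ultimately have "(\<Sum>p\<in>UNIV. \<Sum>q\<in>UNIV. evl (snd (re_b i) p q) * G p q) = (\<Sum>p\<in>UNIV. - lam p * G p i) - (\<Sum>q\<in>UNIV. - lam q * G i q)"
      by (simp only: sum_of_bool)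
    also have "(\<Sum>q\<in>UNIV. - lam q * G i q) = - (\<Sum>q\<in>UNIV. - lam q * G q i)"
      by (simp add: that[of _ i] sum_negf)
    finally show ?thesis by simp
  qed
  have R: "(\<Sum>p\<in>UNIV. \<Sum>q\<in>UNIV. evr (snd (re_b j) p q) * G p q) = 2 * (\<Sum>p\<in>UNIV. (lam p + par p) * G p j)"
    if "\<And>p q. G q p = - G p q" for G
  proof -
    have "(\<Sum>p\<in>UNIV. \<Sum>q\<in>UNIV. evr (snd (re_b j) p q) * G p q)
       = (\<Sum>p\<in>UNIV. \<Sum>q\<in>UNIV. of_bool (q = j) * ((lam p + par p) * G p q)) - (\<Sum>p\<in>UNIV. \<Sum>q\<in>UNIV. of_bool (p = j) * ((lam q + par q) * G p q))"
      unfolding ev_gen by (simp add: algebra_simps sum_subtractf sum.distrib sum_negf)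
    moreover have "(\<Sum>p\<in>UNIV. \<Sum>q\<in>UNIV. of_bool (p = j) * ((lam q + par q) * G p q))
        = (\<Sum>q\<in>UNIV. \<Sum>p\<in>UNIV. of_bool (p = j) * ((lam q + par q) * G p q))"
      by (rule sum.swap)
    ultimately have "(\<Sum>p\<in>UNIV. \<Sum>q\<in>UNIV. evr (snd (re_b j) p q) * G p q) = (\<Sum>p\<in>UNIV. (lam p + par p) * G p j) - (\<Sum>q\<in>UNIV. (lam q + par q) * G j q)"
      by (simp only: sum_of_bool)
    also have "(\<Sum>q\<in>UNIV. (lam q + par q) * G j q) = - (\<Sum>q\<in>UNIV. (lam q + par q) * G q j)"
      by (simp add: that[of _ j] sum_negf)
    finally show ?thesis by simp
  qed
  let ?e = "\<lambda>p q r s. eps p q r s t :: 'a lpol"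
  have "(\<Sum>p\<in>UNIV. \<Sum>q\<in>UNIV. \<Sum>r\<in>UNIV. \<Sum>s\<in>UNIV. ?e p q r s * (evl (snd (re_b i) p q) * evr (snd (re_b j) r s)))
     = (\<Sum>p\<in>UNIV. \<Sum>q\<in>UNIV. evl (snd (re_b i) p q) * (\<Sum>r\<in>UNIV. \<Sum>s\<in>UNIV. evr (snd (re_b j) r s) * ?e p q r s))"
    by (simp add: sum_distrib_left mult_ac)
  also have "\<dots> = (\<Sum>p\<in>UNIV. \<Sum>q\<in>UNIV. evl (snd (re_b i) p q) * (2 * (\<Sum>r\<in>UNIV. (lam r + par r) * ?e p q r j)))"
  proof -
    have "(\<Sum>r\<in>UNIV. \<Sum>s\<in>UNIV. evr (snd (re_b j) r s) * ?e p q r s) = 2 * (\<Sum>r\<in>UNIV. (lam r + par r) * ?e p q r j)" for p q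
      by (rule R) (rule eps_swap(3))
    then show ?thesis by simp
  qed
  also have "\<dots> = 2 * (\<Sum>p\<in>UNIV. - lam p * (2 * (\<Sum>r\<in>UNIV. (lam r + par r) * ?e p i r j)))"
  proof (rule L)
    fix p q
    show "2 * (\<Sum>r\<in>UNIV. (lam r + par r) * ?e q p r j) = - (2 * (\<Sum>r\<in>UNIV. (lam r + par r) * ?e p q r j))"
      unfolding eps_swap(1)[of q p] by (simp add: sum_negf)
  qed
  also have "\<dots> = 4 * (\<Sum>p\<in>UNIV. \<Sum>r\<in>UNIV. ?e i j p r * (lam p * (lam r + par r)))"
  proof -
    have sh: "?e p i r j = - ?e i j p r" for p r by (rule eps_shuffle)
    show ?thesis unfolding sh by (simp add: sum_distrib_left sum_negf mult_ac)
  qed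
  also have "(\<Sum>p\<in>UNIV. \<Sum>r\<in>UNIV. ?e i j p r * (lam p * (lam r + par r)))
     = (\<Sum>p\<in>UNIV. \<Sum>r\<in>UNIV. ?e i j p r * (lam p * lam r)) + (\<Sum>p\<in>UNIV. \<Sum>r\<in>UNIV. ?e i j p r * (lam p * par r))"
    by (simp add: algebra_simps sum.distrib)
  \<comment> \<open>A symmetric factor against an alternating one: exchanging \<open>p\<close> and
    \<open>r\<close> shows that the sum is its own negative.\<close>
  also have "(\<Sum>p\<in>UNIV. \<Sum>r\<in>UNIV. ?e i j p r * (lam p * lam r)) = 0"
  proof -
    let ?S = "\<Sum>p\<in>UNIV. \<Sum>r\<in>UNIV. ?e i j p r * (lam p * lam r)"
    have "?S = (\<Sum>p\<in>UNIV. \<Sum>r\<in>UNIV. ?e i j r p * (lam r * lam p))" by (rule sum.swap)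
    also have "\<dots> = (\<Sum>p\<in>UNIV. \<Sum>r\<in>UNIV. - (?e i j p r * (lam p * lam r)))"
    proof (intro sum.cong refl)
      fix p r
      show "?e i j r p * (lam r * lam p) = - (?e i j p r * (lam p * lam r))"
        unfolding eps_swap(3)[of i j r p] by (simp add: mult.commute)
    qed
    also have "\<dots> = - ?S" by (simp add: sum_negf)
    finally show ?thesis by (rule lpol_eq_neg)
  qed
  finally have "(\<Sum>p\<in>UNIV. \<Sum>q\<in>UNIV. \<Sum>r\<in>UNIV. \<Sum>s\<in>UNIV. ?e p q r s * (evl (snd (re_b i) p q) * evr (snd (re_b j) r s)))
     = 4 * (\<Sum>p\<in>UNIV. \<Sum>r\<in>UNIV. ?e i j p r * (lam p * par r))" by simp
  note quad = this
  have cancel: "emb (pconst (1 / 4)) * (4 * x) = x" for x :: "'a lpol"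
    using lpol_cancel[of 4 x] by simp
  have zero: "fst (re_b k) m = 0" for k m by (simp add: re_b_simps(1) fun_apply)
  show ?thesis
    unfolding brE_def emb_const_eps zero ev_0 mult_zero_left mult_zero_right sum.neutral_const quad cancel
    by simp
qed

lemma brO_bb: "brO (re_b i) (re_b j) p q = 0"
  by (simp add: brO_def re_b_simps(1) fun_apply)

lemma sum_UNIV_distinct:
  fixes f :: "ix \<Rightarrow> 'a::comm_monoid_add"
  assumes "distinct [i, j, h, k, l]"
  shows "(\<Sum>m\<in>UNIV. f m) = f i + f j + f h + f k + f l"
proof -
  have "card {i, j, h, k, l} = card (UNIV :: ix set)" using assms by (simp add: UNIV_ix)
  then have U: "UNIV = {i, j, h, k, l}" using card_subset_eq[of UNIV "{i, j, h, k, l}"] by simp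
  show ?thesis unfolding U using assms by (simp add: add.assoc)
qed

lemma eps_eq_0 [simp]: "\<not> distinct [i, j, k, l, t] \<Longrightarrow> eps i j k l t = 0"
  unfolding eps_def by (rule if_not_P)

lemma amb_br_bb_same: "amb_br (re_b i) (re_b i) = 0"
proof (rule lpol_amb_eqI)
  fix \<pi> :: "'a re_amb \<Rightarrow> 'a mpol" assume "re_proj \<pi>"
  moreover have "brE (re_b i) (re_b i) t = (0 :: 'a lpol)" for t
    by (simp add: brE_bb)
  ultimately show "Poly_Mapping.map \<pi> (amb_br (re_b i) (re_b i)) = Poly_Mapping.map \<pi> 0"
    by (auto simp: re_proj_def map_amb_br brO_bb)
qed

lemma amb_br_bb:
  assumes d: "distinct [i, j, h, k, l]"
  shows "amb_br (re_b i) (re_b j) = Poly_Mapping.map (re_act (pconst (eps i j h k l)))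
     (Poly_Mapping.single (unit_mexp h) (re_a k l) + Poly_Mapping.single (unit_mexp k) (re_a l h)
      + Poly_Mapping.single (unit_mexp l) (re_a h k))"
  (is "_ = ?R")
proof (rule lpol_amb_eqI)
  fix \<pi> :: "'a re_amb \<Rightarrow> 'a mpol" assume "re_proj \<pi>"
  moreover have "Poly_Mapping.map (\<lambda>r. fst r t) (amb_br (re_b i) (re_b j)) = Poly_Mapping.map (\<lambda>r. fst r t) ?R" for t
  proof -
    let ?e = "eps i j h k l :: 'a lpol"
    have t: "t = i \<or> t = j \<or> t = h \<or> t = k \<or> t = l"
    proof (rule ccontr)
      assume "\<not> ?thesis"
      then have "card {t, i, j, h, k, l} = 6" using d by simp
      moreover have "card {t, i, j, h, k, l} \<le> card (UNIV :: ix set)" by (rule card_mono) auto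
      ultimately show False by (simp add: UNIV_ix)
    qed
    \<comment> \<open>The five nontrivial rearrangements of \<open>h\<close>, \<open>k\<close>,
      \<open>l\<close>: three transpositions with sign -1 and two 3-cycles with sign 1.\<close>
    have e: "eps i j k h l = - ?e" "eps i j h l k = - ?e" "eps i j l k h = - ?e"
        "eps i j k l h = ?e" "eps i j l h k = ?e"
      by (simp_all only: eps_swap(3)[of i j k h l] eps_swap(4)[of i j h l k] eps_swap(3)[of i j l k h]
          eps_swap(4)[of i j k l h] eps_swap(3)[of i j l h k] minus_minus)
    have "Poly_Mapping.map (\<lambda>r. fst r t) (amb_br (re_b i) (re_b j)) =
       ?e * (lam h * (of_bool (t = l) * par k - of_bool (t = k) * par l)
           + lam k * (of_bool (t = h) * par l - of_bool (t = l) * par h)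
           + lam l * (of_bool (t = k) * par h - of_bool (t = h) * par k))"
      unfolding map_amb_br brE_bb sum_UNIV_distinct[OF d]
      using t d by (elim disjE) (simp_all add: e algebra_simps)
    also have "\<dots> = Poly_Mapping.map (\<lambda>r. fst r t) ?R"
      unfolding proj_map_simps[OF re_proj_fst] single_as_lam emb_const_eps
      by (simp add: gen_simps)
    finally show ?thesis .
  qed
  moreover have "Poly_Mapping.map (\<lambda>r. snd r p q) (amb_br (re_b i) (re_b j)) = Poly_Mapping.map (\<lambda>r. snd r p q) ?R" for p q
    unfolding map_amb_br brO_bb proj_map_simps[OF re_proj_snd] by (simp add: gen_simps)
  ultimately show "Poly_Mapping.map \<pi> (amb_br (re_b i) (re_b j)) = Poly_Mapping.map \<pi> ?R"
    by (auto simp: re_proj_def)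
qed

lemma amb_br_add:
  "amb_br (x + x') y = amb_br x y + amb_br x' y" "amb_br x (y + y') = amb_br x y + amb_br x y'"
  by (rule lpol_amb_eqI, auto simp: re_proj_def map_amb_br proj_map_simps[OF re_proj_fst] proj_map_simps[OF re_proj_snd]
      brE_left_add brO_left_add brE_right_add brO_right_add)+

lemma amb_br_const:
  "amb_br (re_act (pconst c) x) y = Poly_Mapping.map (re_act (pconst c)) (amb_br x y)"
  "amb_br x (re_act (pconst c) y) = Poly_Mapping.map (re_act (pconst c)) (amb_br x y)"
  by (rule lpol_amb_eqI, auto simp: re_proj_def map_amb_br proj_map_simps[OF re_proj_fst] proj_map_simps[OF re_proj_snd]
      brE_left_mult brO_left_mult brE_right_mult brO_right_mult ev_const)+

lemma amb_br_var:
  "amb_br (re_act (pvar i) x) y = - lam_mult i (amb_br x y)"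
  "amb_br x (re_act (pvar i) y) = Poly_Mapping.map (re_act (pvar i)) (amb_br x y) + lam_mult i (amb_br x y)"
  by (rule lpol_amb_eqI, auto simp: re_proj_def map_amb_br proj_map_simps[OF re_proj_fst] proj_map_simps[OF re_proj_snd]
      brE_left_mult brO_left_mult brE_right_mult brO_right_mult ev_pvar distrib_right)+

subsection \<open>Skew-symmetry\<close>

definition skew :: "(mexp \<Rightarrow>\<^sub>0 'k re_amb) \<Rightarrow> (mexp \<Rightarrow>\<^sub>0 'k::comm_ring_1 re_amb)" where
  "skew P = psum (\<lambda>J r. op_power (\<lambda>i Q. - lam_mult i Q - Poly_Mapping.map (re_act (pvar i)) Q) J
       (Poly_Mapping.single 0 r)) P"

lemma skew_subst_RE: "skew_subst (RE_with_bracket br) P = skew P"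
  by (simp add: skew_subst_def skew_def psum_def cder_def[abs_def] RE_with_bracket_def)

text \<open>On a coordinate the operators iterated in \<open>skew\<close> are multiplications by
  -\<lambda>-\<partial>, so their composition is a product in a commutative ring, which is the
  substitution \<open>skewP\<close>.\<close>

lemma map_skew:
  assumes "re_proj \<pi>"
  shows "Poly_Mapping.map \<pi> (skew P) = skewP (Poly_Mapping.map \<pi> P)"
proof -
  let ?T = "\<lambda>i Q. - lam_mult i Q - Poly_Mapping.map (re_act (pvar i)) Q"
  note s = re_proj_simps[OF assms] and m = proj_map_simps[OF assms]
  have T: "Poly_Mapping.map \<pi> ((?T i ^^ n) Q) = (- lam i - par i) ^ n * Poly_Mapping.map \<pi> Q" for i n Q
  proof (induction n)
    case (Suc n)
    then show ?case by (simp add: m left_diff_distrib mult.assoc)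
  qed simp
  have "Poly_Mapping.map \<pi> (op_power ?T J (Poly_Mapping.single 0 r))
      = emb (\<pi> r) * (\<Prod>i\<in>UNIV. (- lam i - par i) ^ J i)" for J r
    unfolding op_power_def o_apply T m UNIV_ix_prod emb_def[of "\<pi> r"] by (simp only: mult_ac)
  then have "Poly_Mapping.map \<pi> (skew P) = psum (\<lambda>J r. emb (\<pi> r) * (\<Prod>i\<in>UNIV. (- lam i - par i) ^ J i)) P"
    unfolding skew_def by (subst psum_comp) (simp_all add: m)
  also have "\<dots> = skewP (Poly_Mapping.map \<pi> P)"
    unfolding skewP_def by (rule psum_map[symmetric]) (simp_all add: s emb_simps)
  finally show ?thesis .
qed

lemma skewP_lam_par: "skewP (lam i + par i) = - lam i"
  by (simp add: skewP_add skewP_lam skewP_emb)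

lemmas skewP_rules = skewP_lam_par skewP_sum skewP_diff skewP_uminus skewP_mult skewP_evl skewP_evr skewP_emb skewP_lam

text \<open>The substitution carries the Lie derivative along \<open>x\<close> in the bracket of
  \<open>x\<close>, \<open>y\<close> into the subtracted one in the bracket of \<open>y\<close>,
  \<open>x\<close>, and vice versa.\<close>

lemma skewP_brO: "skewP (brO x y j k) = - brO y x j k"
proof -
  let ?A = "\<Sum>m\<in>UNIV. evl (fst x m) * (- ((lam m + par m) * evr (snd y j k)) + lam j * evr (snd y m k) + lam k * evr (snd y j m))"
  let ?B = "\<Sum>m\<in>UNIV. evr (fst y m) * (lam m * evl (snd x j k) - (lam j + par j) * evl (snd x m k) - (lam k + par k) * evl (snd x j m))"
  have "skewP ?A = (\<Sum>m\<in>UNIV. evr (fst x m) * (lam m * evl (snd y j k) - (lam j + par j) * evl (snd y m k) - (lam k + par k) * evl (snd y j m)))"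
    unfolding skewP_sum by (rule sum.cong[OF refl]) (simp add: skewP_add[of "_ * _"] skewP_add[of "_ + _ * _"] skewP_add[of "- _"] skewP_rules algebra_simps)
  moreover have "skewP ?B = (\<Sum>m\<in>UNIV. evl (fst y m) * (- ((lam m + par m) * evr (snd x j k)) + lam j * evr (snd x m k) + lam k * evr (snd x j m)))"
    unfolding skewP_sum by (rule sum.cong[OF refl]) (simp only: skewP_rules, simp add: algebra_simps)
  ultimately show ?thesis unfolding brO_def skewP_diff by simp
qed

text \<open>If one of the form parts vanishes, so does the product of forms. What is left are the
  two halves of the commutator, which the substitution exchanges.\<close>

lemma skewP_brE_even:
  assumes "snd x = 0 \<or> snd y = 0"
  shows "skewP (brE x y t) = - brE y x t"
proof -
  have brE: "brE x y t = - (\<Sum>m\<in>UNIV. evl (fst x m) * ((lam m + par m) * evr (fst y t)))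
     - (\<Sum>m\<in>UNIV. evr (fst y m) * (lam m * evl (fst x t)))"
     "brE y x t = - (\<Sum>m\<in>UNIV. evl (fst y m) * ((lam m + par m) * evr (fst x t)))
     - (\<Sum>m\<in>UNIV. evr (fst x m) * (lam m * evl (fst y t)))"
    using assms by (auto simp: brE_def fun_apply)
  have 1: "skewP (\<Sum>m\<in>UNIV. evl (fst x m) * ((lam m + par m) * evr (fst y t)))
     = - (\<Sum>m\<in>UNIV. evr (fst x m) * (lam m * evl (fst y t)))"
    unfolding skewP_rules sum_negf[symmetric] by (rule sum.cong[OF refl]) simp
  have 2: "skewP (\<Sum>m\<in>UNIV. evr (fst y m) * (lam m * evl (fst x t)))
     = - (\<Sum>m\<in>UNIV. evl (fst y m) * ((lam m + par m) * evr (fst x t)))"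
    unfolding skewP_rules sum_negf[symmetric] by (rule sum.cong[OF refl]) (simp add: algebra_simps)
  show ?thesis unfolding brE skewP_diff skewP_uminus 1 2 by simp
qed

text \<open>Here only the product of forms survives. The substitution exchanges its two factors, and
  \<open>eps\<close> is invariant under exchanging the two pairs of indices, which yields the
  opposite sign for two odd arguments.\<close>

lemma skewP_brE_odd:
  assumes "fst x = 0" "fst y = 0"
  shows "skewP (brE x y t) = brE y x t"
proof -
  have "(\<Sum>i\<in>UNIV. \<Sum>j\<in>UNIV. \<Sum>k\<in>UNIV. \<Sum>l\<in>UNIV. eps i j k l t * (evr (snd x i j) * evl (snd y k l)))
      = (\<Sum>k\<in>UNIV. \<Sum>l\<in>UNIV. \<Sum>i\<in>UNIV. \<Sum>j\<in>UNIV. eps i j k l t * (evr (snd x i j) * evl (snd y k l)) :: 'a lpol)"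
    by (simp only: sum.cartesian_product) (rule sum.reindex_bij_witness[of _ "\<lambda>(i, j, k, l). (k, l, i, j)" "\<lambda>(i, j, k, l). (k, l, i, j)"], auto)
  also have "\<dots> = (\<Sum>k\<in>UNIV. \<Sum>l\<in>UNIV. \<Sum>i\<in>UNIV. \<Sum>j\<in>UNIV. eps k l i j t * (evl (snd y k l) * evr (snd x i j)))"
    by (intro sum.cong refl) (simp only: eps_pairs mult.commute)
  finally show ?thesis
    using assms by (simp add: brE_def fun_apply skewP_rules flip: emb_const_eps)
qed

lemma amb_br_skew:
  "snd x = 0 \<or> snd y = 0 \<Longrightarrow> amb_br y x = - skew (amb_br x y)"
proof (rule lpol_amb_eqI)
  fix \<pi> :: "'a re_amb \<Rightarrow> 'a mpol" assume "re_proj \<pi>" and *: "snd x = 0 \<or> snd y = 0"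
  then show "Poly_Mapping.map \<pi> (amb_br y x) = Poly_Mapping.map \<pi> (- skew (amb_br x y))"
    unfolding proj_map_simps(2)[OF \<open>re_proj \<pi>\<close>] map_skew[OF \<open>re_proj \<pi>\<close>]
    by (auto simp: re_proj_def map_amb_br skewP_brE_even skewP_brO)
qed

lemma brO_odd: "fst x = 0 \<Longrightarrow> fst y = 0 \<Longrightarrow> brO x y j k = 0"
  by (simp add: brO_def fun_apply)

lemma amb_br_skew_odd:
  "fst x = 0 \<Longrightarrow> fst y = 0 \<Longrightarrow> amb_br y x = skew (amb_br x y)"
proof (rule lpol_amb_eqI)
  fix \<pi> :: "'a re_amb \<Rightarrow> 'a mpol" assume "re_proj \<pi>" and *: "fst x = 0" "fst y = 0"
  then show "Poly_Mapping.map \<pi> (amb_br y x) = Poly_Mapping.map \<pi> (skew (amb_br x y))"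
    unfolding map_skew[OF \<open>re_proj \<pi>\<close>]
    by (auto simp: re_proj_def map_amb_br skewP_brE_odd brO_odd)
qed

section \<open>Existence and uniqueness of the bracket of RE(5,10)\<close>

definition re_part :: "bit \<Rightarrow> 'k::comm_ring_1 re_amb set" where
  "re_part p = re.span (if p = 0 then {re_a i j | i j. True} else range re_b)"

definition re_carr :: "'k::comm_ring_1 re_amb set" where
  "re_carr = re_part 0 + re_part 1"

lemma RE_simps:
  "cpart (RE_with_bracket br) = re_part" "ccarr (RE_with_bracket br) = re_carr"
  "cder (RE_with_bracket br) i = re_act (pvar i)" "cscal (RE_with_bracket br) c = re_act (pconst c)"
  "cbr (RE_with_bracket br) = br"
  by (simp_all add: RE_with_bracket_def re_part_def re_carr_def ccarr_def cder_def cscal_def fun_eq_iff)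

lemma re_part_0: "re_part 0 = re.span {re_a i j | i j. True}"
  and re_part_1: "re_part 1 = re.span (range re_b)"
  by (simp_all add: re_part_def)

lemma re_carr_span: "re_carr = re.span ({re_a i j | i j. True} \<union> range re_b)"
  unfolding re_carr_def re_part_0 re_part_1 re.span_Un set_plus_def by blast

text \<open>Scalars from F[\<partial>] are split into constants and single variables because
  linearity and sesquilinearity of a \<lambda>-bracket are stated for these only.\<close>

lemma re_span_induct [consumes 1, case_names base zero add const var]:
  assumes "x \<in> re.span G"
    and "\<And>g. g \<in> G \<Longrightarrow> P g" "P 0" "\<And>x y. P x \<Longrightarrow> P y \<Longrightarrow> P (x + y)"
    and "\<And>c x. P x \<Longrightarrow> P (re_act (pconst c) x)" "\<And>i x. P x \<Longrightarrow> P (re_act (pvar i) x)"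
  shows "P x"
proof -
  have act: "P (re_act p x)" if "P x" for p x
  proof (induction p rule: mpol_induct)
    case (const c)
    show ?case by (rule assms(5)[OF that])
  next
    case (add p q)
    then show ?case unfolding re_act_add by (rule assms(4))
  next
    case (var i p)
    then show ?case unfolding re_act_mult[symmetric] by (rule assms(6))
  qed
  show ?thesis
  proof (rule re.span_induct[OF assms(1)])
    show "re.subspace {x. P x}"
      unfolding re.subspace_def mem_Collect_eq by (intro conjI allI ballI impI assms(3) assms(4) act) simp_all
  qed (rule assms(2))
qed

lemma re_part_simps:
  "0 \<in> re_part p" "x \<in> re_part p \<Longrightarrow> y \<in> re_part p \<Longrightarrow> x + y \<in> re_part p"
  "x \<in> re_part p \<Longrightarrow> - x \<in> re_part p" "x \<in> re_part p \<Longrightarrow> y \<in> re_part p \<Longrightarrow> x - y \<in> re_part p"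
  "x \<in> re_part p \<Longrightarrow> re_act q x \<in> re_part p"
  by (simp_all add: re_part_def re.span_zero re.span_add re.span_neg re.span_diff re.span_scale)

lemma re_carr_simps:
  "0 \<in> re_carr" "x \<in> re_carr \<Longrightarrow> y \<in> re_carr \<Longrightarrow> x + y \<in> re_carr"
  "x \<in> re_carr \<Longrightarrow> re_act q x \<in> re_carr"
  by (simp_all add: re_carr_span re.span_zero re.span_add re.span_scale)

lemma re_a_part: "re_a i j \<in> re_part 0" and re_b_part: "re_b k \<in> re_part 1"
  by (auto simp: re_part_def intro!: re.span_base)

lemma re_part_carr: "x \<in> re_part p \<Longrightarrow> x \<in> re_carr"
  using re.span_mono[of "{re_a i j | i j. True}" "{re_a i j | i j. True} \<union> range re_b"]
    re.span_mono[of "range re_b" "{re_a i j | i j. True} \<union> range re_b"]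
  by (cases p) (auto simp: re_part_def re_carr_span)

lemma re_part_snd: "x \<in> re_part 0 \<Longrightarrow> snd x = 0"
  unfolding re_part_0
  by (induction rule: re_span_induct) (auto simp: re_a_simps re_act_def split_beta fun_eq_iff fun_apply)

lemma re_part_fst: "x \<in> re_part 1 \<Longrightarrow> fst x = 0"
  unfolding re_part_1
  by (induction rule: re_span_induct) (auto simp: re_b_simps re_act_def split_beta fun_eq_iff fun_apply)

section \<open>The submodule is closed under the bracket of the ambient module\<close>

definition coeffs_in :: "'r::zero set \<Rightarrow> (mexp \<Rightarrow>\<^sub>0 'r) \<Rightarrow> bool" where
  "coeffs_in V X \<longleftrightarrow> (\<forall>J. Poly_Mapping.lookup X J \<in> V)"

lemma coeffs_in_simps:
  "coeffs_in (re_part p) 0"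
  "coeffs_in (re_part p) X \<Longrightarrow> coeffs_in (re_part p) Y \<Longrightarrow> coeffs_in (re_part p) (X + Y)"
  "coeffs_in (re_part p) X \<Longrightarrow> coeffs_in (re_part p) (- X)"
  "coeffs_in (re_part p) X \<Longrightarrow> coeffs_in (re_part p) Y \<Longrightarrow> coeffs_in (re_part p) (X - Y)"
  "r \<in> re_part p \<Longrightarrow> coeffs_in (re_part p) (Poly_Mapping.single J r)"
  "coeffs_in (re_part p) X \<Longrightarrow> coeffs_in (re_part p) (Poly_Mapping.map (re_act q) X)"
  by (auto simp: coeffs_in_def lookup_add lookup_minus lookup_single when_def re_part_simps)

lemma coeffs_in_sum: "(\<And>a. a \<in> A \<Longrightarrow> coeffs_in (re_part p) (f a)) \<Longrightarrow> coeffs_in (re_part p) (sum f A)"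
  by (induction A rule: infinite_finite_induct) (auto simp: coeffs_in_simps)

lemma coeffs_in_lam_mult: "coeffs_in (re_part p) X \<Longrightarrow> coeffs_in (re_part p) (lam_mult i X)"
  unfolding lam_mult_def by (intro coeffs_in_sum coeffs_in_simps) (auto simp: coeffs_in_def)

lemma coeffs_in_skew:
  assumes "coeffs_in (re_part p) X"
  shows "coeffs_in (re_part p) (skew X)"
proof -
  let ?T = "\<lambda>i Q. - lam_mult i Q - Poly_Mapping.map (re_act (pvar i)) Q"
  have T: "coeffs_in (re_part p) ((?T i ^^ n) Q)" if "coeffs_in (re_part p) Q" for i n Q
    using that by (induction n) (auto intro!: coeffs_in_simps coeffs_in_lam_mult)
  show ?thesis
    unfolding skew_def psum_def op_power_def o_apply
    by (intro coeffs_in_sum T coeffs_in_simps) (use assms in \<open>auto simp: coeffs_in_def\<close>)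
qed

lemma coeffs_in_aa: "coeffs_in (re_part 0) (amb_br (re_a i j) (re_a r s))"
  unfolding amb_br_aa by (intro coeffs_in_simps re_part_simps re_a_part)

lemma coeffs_in_ab: "coeffs_in (re_part 1) (amb_br (re_a i j) (re_b k))"
  unfolding amb_br_ab by (auto intro!: coeffs_in_simps coeffs_in_sum re_part_simps re_b_part)

lemma ex_distinct_ix:
  fixes i j :: ix
  assumes "i \<noteq> j"
  shows "\<exists>h k l. distinct [i, j, h, k, l]"
proof -
  have "card (UNIV :: ix set) = 5" by (simp add: UNIV_ix)
  then have "card (UNIV - {i, j}) = 3" using assms by (subst card_Diff_subset) simp_all
  then obtain h k l where "UNIV - {i, j} = {h, k, l}" "h \<noteq> k" "k \<noteq> l" "h \<noteq> l"
    by (auto simp: card_3_iff)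
  then have "distinct [i, j, h, k, l]" using assms by auto
  then show ?thesis by blast
qed

lemma amb_br_ba: "amb_br (re_b k) (re_a i j) = - skew (amb_br (re_a i j) (re_b k))"
  by (rule amb_br_skew) (simp add: re_a_simps)

lemma coeffs_in_gen:
  assumes "x \<in> (if p = 0 then {re_a i j | i j. True} else range re_b)"
    and "y \<in> (if q = 0 then {re_a i j | i j. True} else range re_b)"
  shows "coeffs_in (re_part (p + q)) (amb_br x y)"
proof -
  have bb: "coeffs_in (re_part 0) (amb_br (re_b i) (re_b j))" for i j
  proof (cases "i = j")
    case True
    then show ?thesis by (simp add: amb_br_bb_same coeffs_in_simps)
  next
    case False
    then obtain h k l where "distinct [i, j, h, k, l]" using ex_distinct_ix by blast
    then show ?thesis unfolding amb_br_bb[OF \<open>distinct _\<close>] by (intro coeffs_in_simps re_a_part)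
  qed
  have ba: "coeffs_in (re_part 1) (amb_br (re_b k) (re_a i j))" for i j k
    unfolding amb_br_ba by (intro coeffs_in_simps(3) coeffs_in_skew coeffs_in_ab)
  show ?thesis
    using assms by (cases p; cases q) (auto simp: bb ba coeffs_in_aa coeffs_in_ab)
qed

lemma amb_br_0 [simp]: "amb_br 0 y = 0" "amb_br x 0 = 0"
  using amb_br_add(1)[of 0 0 y] amb_br_add(2)[of x 0 0] by simp_all

text \<open>Multiplication by \<lambda> shifts coefficients and \<partial> acts inside the
  submodule. By sesquilinearity in each argument it is therefore enough to inspect the generators,
  whose brackets are visibly combinations of generators.\<close>

lemma coeffs_in_amb_br:
  assumes x: "x \<in> re_part p" and y: "y \<in> re_part q"
  shows "coeffs_in (re_part (p + q)) (amb_br x y)"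
  using x unfolding re_part_def[of p]
proof (induction x rule: re_span_induct)
  case (base g)
  note g = base
  from y show ?case unfolding re_part_def[of q]
  proof (induction y rule: re_span_induct)
    case (base g')
    show ?case by (rule coeffs_in_gen[OF g base])
  qed (auto simp: amb_br_add amb_br_const amb_br_var intro!: coeffs_in_simps coeffs_in_lam_mult)
qed (auto simp: amb_br_add amb_br_const amb_br_var intro!: coeffs_in_simps coeffs_in_lam_mult)

lemma amb_br_carr:
  assumes "x \<in> re_carr" "y \<in> re_carr"
  shows "Poly_Mapping.lookup (amb_br x y) J \<in> re_carr"
proof -
  have part: "Poly_Mapping.lookup (amb_br a b) J \<in> re_carr" if "a \<in> re_part p" "b \<in> re_part q" for a b p q
    using coeffs_in_amb_br[OF that] unfolding coeffs_in_def by (blast intro: re_part_carr)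
  from assms obtain x0 x1 y0 y1 where
    "x = x0 + x1" "y = y0 + y1" "x0 \<in> re_part 0" "x1 \<in> re_part 1" "y0 \<in> re_part 0" "y1 \<in> re_part 1"
    unfolding re_carr_def by (elim set_plus_elim) blast
  then show ?thesis
    by (simp only: amb_br_add lookup_add) (intro re_carr_simps(2) part; assumption)
qed

definition re_br :: "'k re_amb \<Rightarrow> 'k re_amb \<Rightarrow> (mexp \<Rightarrow>\<^sub>0 'k::field_char_0 re_amb)" where
  "re_br x y = (if x \<in> re_carr \<and> y \<in> re_carr then amb_br x y else 0)"

lemma re_br_eq: "x \<in> re_carr \<Longrightarrow> y \<in> re_carr \<Longrightarrow> re_br x y = amb_br x y"
  by (simp add: re_br_def)

lemma re_gen_carr: "re_a i j \<in> re_carr" "re_b k \<in> re_carr"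
  using re_a_part re_b_part re_part_carr by blast+

lemma is_RE_bracket_iff:
  fixes br :: "'k::field_char_0 re_amb \<Rightarrow> _"
  shows "is_RE_bracket br \<longleftrightarrow>
    lambda_bracket (RE_with_bracket br) \<and> sesquilinear (RE_with_bracket br) \<and>
    skew_symmetric (RE_with_bracket br) \<and>
    (\<forall>i j r s. br (re_a i j) (re_a r s) = amb_br (re_a i j) (re_a r s)) \<and>
    (\<forall>i j k. br (re_a i j) (re_b k) = amb_br (re_a i j) (re_b k)) \<and>
    (\<forall>i. br (re_b i) (re_b i) = 0) \<and>
    (\<forall>i j h k l. distinct [i, j, h, k, l] \<longrightarrow> br (re_b i) (re_b j) =
       Poly_Mapping.map (re_act (pconst (eps i j h k l)))
        (Poly_Mapping.single (unit_mexp h) (re_a k l) + Poly_Mapping.single (unit_mexp k) (re_a l h)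
         + Poly_Mapping.single (unit_mexp l) (re_a h k)))"
  by (simp only: is_RE_bracket_def Let_def RE_simps amb_br_aa amb_br_ab)

lemma is_RE_bracket_re_br: "is_RE_bracket (re_br :: 'k::field_char_0 re_amb \<Rightarrow> _)"
proof -
  let ?R = "RE_with_bracket (re_br :: 'k re_amb \<Rightarrow> _)"
  have "lambda_bracket ?R"
    unfolding lambda_bracket_def RE_simps
  proof (intro conjI allI ballI)
    fix p q J and a b :: "'k re_amb" assume "a \<in> re_part p" "b \<in> re_part q"
    then show "Poly_Mapping.lookup (re_br a b) J \<in> re_part (p + q)"
      using coeffs_in_amb_br[of a p b q] unfolding coeffs_in_def
      by (simp only: re_br_eq[OF re_part_carr re_part_carr])
  qed (auto simp: re_br_eq re_carr_simps amb_br_add amb_br_const)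
  moreover have "sesquilinear ?R"
    unfolding sesquilinear_def RE_simps by (auto simp: re_br_eq re_carr_simps amb_br_var)
  moreover have "skew_symmetric ?R"
    unfolding skew_symmetric_def RE_simps skew_subst_RE
  proof (intro allI ballI)
    fix p q :: bit and x y :: "'k re_amb" assume xy: "x \<in> re_part p" "y \<in> re_part q"
    have "amb_br y x = - super_sign p q (skew (amb_br x y))"
    proof (cases "p = 1 \<and> q = 1")
      case True
      then have "amb_br y x = skew (amb_br x y)" using xy by (intro amb_br_skew_odd) (auto simp: re_part_fst)
      then show ?thesis using True by (simp add: super_sign_def)
    next
      case False
      then have "snd x = 0 \<or> snd y = 0" using xy by (cases p; cases q) (auto simp: re_part_snd)
      then have "amb_br y x = - skew (amb_br x y)" by (rule amb_br_skew)
      then show ?thesis using False by (auto simp: super_sign_def)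
    qed
    then show "re_br y x = - super_sign p q (skew (re_br x y))"
      using xy by (simp add: re_br_eq re_part_carr)
  qed
  ultimately show ?thesis
    by (simp add: is_RE_bracket_iff re_br_eq re_gen_carr amb_br_bb amb_br_bb_same)
qed

text \<open>The prescribed values leave out the brackets of \<open>b_k\<close> with
  \<open>a_ij\<close>, which follow from skew-symmetry. For distinct \<open>i\<close>,
  \<open>j\<close> the value on \<open>b_i\<close>, \<open>b_j\<close> is read off after completing
  \<open>i\<close>, \<open>j\<close> to an enumeration of all five indices. Sesquilinearity does the
  rest.\<close>

lemma is_RE_bracket_unique:
  fixes br :: "'k::field_char_0 re_amb \<Rightarrow> _"
  assumes "is_RE_bracket br" and x: "x \<in> re_carr" and y: "y \<in> re_carr"
  shows "br x y = amb_br x y"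
proof -
  note A = assms(1)[unfolded is_RE_bracket_iff]
  note lin = A[THEN conjunct1, unfolded lambda_bracket_def RE_simps]
    and ses = A[THEN conjunct2, THEN conjunct1, unfolded sesquilinear_def RE_simps]
    and sk = A[THEN conjunct2, THEN conjunct2, THEN conjunct1, unfolded skew_symmetric_def RE_simps skew_subst_RE]
  note B = A[THEN conjunct2, THEN conjunct2, THEN conjunct2]
  have aa: "br (re_a i j) (re_a r s) = amb_br (re_a i j) (re_a r s)" for i j r s
    using B by (simp only:)
  have ab: "br (re_a i j) (re_b k) = amb_br (re_a i j) (re_b k)" for i j k
    using B by (simp only:)
  have ba: "br (re_b k) (re_a i j) = amb_br (re_b k) (re_a i j)" for i j k
    using sk[rule_format, OF re_a_part[of i j] re_b_part[of k]] unfolding ab amb_br_ba by (simp add: super_sign_def)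
  have bb: "br (re_b i) (re_b j) = amb_br (re_b i) (re_b j)" for i j
  proof (cases "i = j")
    case True
    then show ?thesis using B by (simp add: amb_br_bb_same)
  next
    case False
    then obtain h k l where d: "distinct [i, j, h, k, l]" using ex_distinct_ix by blast
    show ?thesis unfolding amb_br_bb[OF d]
      using B[THEN conjunct2, THEN conjunct2, THEN conjunct2, rule_format, OF d] .
  qed
  let ?G = "{re_a i j :: 'k re_amb | i j. True} \<union> range re_b"
  have G: "g \<in> re_carr" if "g \<in> ?G" for g using that by (auto simp: re_gen_carr)
  have gen: "br g g' = amb_br g g'" if "g \<in> ?G" "g' \<in> ?G" for g g'
    using that by (auto simp: aa ab ba bb)
  have add: "br (u + u') v = br u v + br u' v" "br v (u + u') = br v u + br v u'"
    if u: "u \<in> re_carr" and u': "u' \<in> re_carr" and v: "v \<in> re_carr" for u u' v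
    by (rule lin[THEN conjunct2, THEN conjunct1, rule_format, OF u u' v],
        rule lin[THEN conjunct2, THEN conjunct2, THEN conjunct1, rule_format, OF v u u'])
  note l3 = lin[THEN conjunct2, THEN conjunct2, THEN conjunct2, rule_format]
  have const: "br (re_act (pconst c) u) v = Poly_Mapping.map (re_act (pconst c)) (br u v)"
    "br v (re_act (pconst c) u) = Poly_Mapping.map (re_act (pconst c)) (br v u)"
    if u: "u \<in> re_carr" and v: "v \<in> re_carr" for c u v
    by (rule l3[OF u v, THEN conjunct1], rule l3[OF v u, THEN conjunct2])
  have var: "br (re_act (pvar i) u) v = - lam_mult i (br u v)"
    "br v (re_act (pvar i) u) = Poly_Mapping.map (re_act (pvar i)) (br v u) + lam_mult i (br v u)"
    if u: "u \<in> re_carr" and v: "v \<in> re_carr" for i u v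
    by (rule ses[rule_format, OF u v, THEN conjunct1], rule ses[rule_format, OF v u, THEN conjunct2])
  have br0: "br 0 z = 0" "br z 0 = 0" if "z \<in> re_carr" for z
    using add[OF re_carr_simps(1) re_carr_simps(1) that] by simp_all
  \<comment> \<open>Membership is proved along with the equation because the linearity of
    \<open>br\<close> is available on \<open>re_carr\<close> only.\<close>
  have left: "x \<in> re_carr \<and> br x g = amb_br x g" if "x \<in> re_carr" "g \<in> ?G" for x g
  proof -
    note g = G[OF that(2)]
    show ?thesis
      using that(1)[unfolded re_carr_span]
    proof (induction x rule: re_span_induct)
      case (base g')
      then show ?case using gen[OF base that(2)] G by blast
    qed (use g br0 in \<open>simp_all add: re_carr_simps add const var amb_br_add amb_br_const amb_br_var\<close>)
  qed
  have "y \<in> re_carr \<and> br x y = amb_br x y"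
    using y[unfolded re_carr_span]
  proof (induction y rule: re_span_induct)
    case (base g')
    then show ?case using left[OF x base] G by blast
  qed (use x br0 in \<open>simp_all add: re_carr_simps add const var amb_br_add amb_br_const amb_br_var\<close>)
  then show ?thesis ..
qed

lemma RE_bracket_eq: "RE_bracket = (re_br :: 'k::field_char_0 re_amb \<Rightarrow> _)"
  unfolding RE_bracket_def
proof (rule the_equality)
  have off: "re_br x y = (0 :: mexp \<Rightarrow>\<^sub>0 'k re_amb)" if "x \<notin> re_carr \<or> y \<notin> re_carr" for x y
    using that unfolding re_br_def by (intro if_not_P) blast
  show "is_RE_bracket (re_br :: 'k re_amb \<Rightarrow> _) \<and> (\<forall>x y. x \<notin> ccarr (RE_with_bracket (re_br :: 'k re_amb \<Rightarrow> _))
      \<or> y \<notin> ccarr (RE_with_bracket (re_br :: 'k re_amb \<Rightarrow> _)) \<longrightarrow> re_br x y = (0 :: mexp \<Rightarrow>\<^sub>0 'k re_amb))"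
    unfolding RE_simps(2) using off is_RE_bracket_re_br by blast
next
  fix br :: "'k re_amb \<Rightarrow> 'k re_amb \<Rightarrow> (mexp \<Rightarrow>\<^sub>0 'k re_amb)"
  assume br: "is_RE_bracket br \<and> (\<forall>x y. x \<notin> ccarr (RE_with_bracket br) \<or> y \<notin> ccarr (RE_with_bracket br) \<longrightarrow> br x y = 0)"
  show "br = re_br"
  proof (intro ext)
    fix x y
    show "br x y = re_br x y"
    proof (cases "x \<in> re_carr \<and> y \<in> re_carr")
      case True
      then show ?thesis using is_RE_bracket_unique[OF br[THEN conjunct1], of x y] by (simp only: re_br_def if_True simp_thms)
    next
      case False
      then show ?thesis using br[THEN conjunct2, rule_format, of x y] unfolding RE_simps(2) re_br_def by auto
    qed
  qed
qed

lemma RE_5_10_simps: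
  fixes R :: "('k::field_char_0, 'k re_amb) conformal"
  defines "R \<equiv> RE_5_10"
  shows "cpart R = re_part" "ccarr R = re_carr" "cder R i = re_act (pvar i)" "cscal R c = re_act (pconst c)"
    "x \<in> re_carr \<Longrightarrow> y \<in> re_carr \<Longrightarrow> cbr R x y = amb_br x y"
  by (simp_all add: R_def RE_5_10_def RE_simps RE_bracket_eq re_br_eq)

section \<open>The formal Poincare lemma\<close>

definition ps_var_mult :: "ix \<Rightarrow> 'k ps \<Rightarrow> 'k::comm_ring_1 ps" where
  "ps_var_mult j f = (\<lambda>M. if M j = 0 then 0 else f (M - unit_mexp j))"

text \<open>An inverse of \<open>\<Sum>\<^sub>k x\<^sub>k \<partial>\<^sub>k + c\<close>; for \<open>c = 0\<close> division by zero makes it vanish on constants.\<close>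

definition inv_euler :: "nat \<Rightarrow> 'k ps \<Rightarrow> 'k::field_char_0 ps" where
  "inv_euler c f = (\<lambda>M. f M / of_nat (mdeg M + c))"

text \<open>The commutation relation of the Weyl algebra. Exponents with \<open>M j = 0\<close> are
  treated apart, since subtraction of exponents is truncated.\<close>

lemma ps_deriv_var_mult: "ps_deriv i (ps_var_mult j f) = ps_smult (of_bool (i = j)) f + ps_var_mult j (ps_deriv i f)"
proof
  fix M :: mexp
  have 1: "M + unit_mexp i - unit_mexp j = M - unit_mexp j + unit_mexp i" if "M j \<noteq> 0"
    using that by (auto simp: fun_eq_iff unit_mexp_def fun_apply)
  have 2: "M + unit_mexp i - unit_mexp i = M" by (auto simp: fun_eq_iff fun_apply)
  have 3: "M - unit_mexp i + unit_mexp i = M" if "M i \<noteq> 0"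
    using that by (auto simp: fun_eq_iff unit_mexp_def fun_apply)
  show "ps_deriv i (ps_var_mult j f) M = (ps_smult (of_bool (i = j)) f + ps_var_mult j (ps_deriv i f)) M"
  proof (cases "i = j")
    case True
    have L: "ps_deriv j (ps_var_mult j f) M = of_nat (M j + 1) * f M"
      using 2 True by (simp add: ps_deriv_def ps_var_mult_def fun_apply(1) unit_mexp_apply)
    show ?thesis
    proof (cases "M j = 0")
      case True
      then show ?thesis using L \<open>i = j\<close> by (simp add: ps_var_mult_def fun_apply(1))
    next
      case False
      then have "(M - unit_mexp j) j + 1 = M j" by (simp add: fun_apply unit_mexp_apply)
      then have "ps_deriv j f (M - unit_mexp j) = of_nat (M j) * f M"
        using 3 False \<open>i = j\<close> by (simp only: ps_deriv_def not_False_eq_True)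
      then show ?thesis using L False \<open>i = j\<close> by (simp add: ps_var_mult_def fun_apply(1) algebra_simps)
    qed
  next
    case False
    then show ?thesis
      by (cases "M j = 0") (auto simp: ps_deriv_def ps_var_mult_def 1 fun_apply unit_mexp_apply)
  qed
qed

lemma euler: "(\<Sum>k\<in>UNIV. ps_var_mult k (ps_deriv k f)) = (\<lambda>M. of_nat (mdeg M) * f M)"
proof
  fix M :: mexp
  have "ps_var_mult k (ps_deriv k f) M = of_nat (M k) * f M" for k
  proof (cases "M k = 0")
    case False
    then have "M - unit_mexp k + unit_mexp k = M" by (auto simp: fun_eq_iff unit_mexp_def fun_apply)
    moreover have "(M - unit_mexp k) k + 1 = M k" using False by (simp add: unit_mexp_def fun_apply)
    ultimately show ?thesis using False by (simp add: ps_var_mult_def ps_deriv_def del: of_nat_Suc of_nat_add)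
  qed (simp add: ps_var_mult_def)
  then show "(\<Sum>k\<in>UNIV. ps_var_mult k (ps_deriv k f)) M = of_nat (mdeg M) * f M"
    by (simp add: sum_apply mdeg_def sum_distrib_right)
qed

text \<open>A derivative lowers the degree by one, so the shift has to rise by one for the
  denominator to stay the same.\<close>

lemma ps_deriv_inv_euler: "ps_deriv i (inv_euler c f) = inv_euler (Suc c) (ps_deriv i f)"
  by (auto simp: fun_eq_iff ps_deriv_def inv_euler_def)

lemma inv_euler_add: "inv_euler c (f + g) = inv_euler c f + inv_euler c g"
  by (auto simp: fun_eq_iff fun_apply inv_euler_def add_divide_distrib)

lemma inv_euler_sum: "inv_euler c (\<Sum>a\<in>A. f a) = (\<Sum>a\<in>A. inv_euler c (f a))"
  using sum_comp_morphism[of "inv_euler c" f A]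
  by (simp add: inv_euler_add o_def) (simp add: inv_euler_def fun_eq_iff fun_apply)

lemma inv_euler_uminus: "inv_euler c (- f) = - inv_euler c f"
  by (auto simp: fun_eq_iff fun_apply inv_euler_def)

lemma inv_euler_euler:
  "c \<noteq> 0 \<Longrightarrow> inv_euler c ((\<Sum>k\<in>UNIV. ps_var_mult k (ps_deriv k f)) + ps_smult (of_nat c) f) = f"
  unfolding euler by (auto simp: fun_eq_iff fun_apply inv_euler_def simp flip: of_nat_add distrib_right)

lemma ps_var_mult_add: "ps_var_mult k (f + g) = ps_var_mult k f + ps_var_mult k g"
  by (auto simp: fun_eq_iff fun_apply ps_var_mult_def)

lemma ps_var_mult_uminus: "ps_var_mult k (- f) = - ps_var_mult k f"
  by (auto simp: fun_eq_iff fun_apply ps_var_mult_def)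

lemma ps_var_mult_0 [simp]: "ps_var_mult k 0 = 0"
  by (auto simp: fun_eq_iff fun_apply ps_var_mult_def)

lemma ps_var_mult_sum: "ps_var_mult k (\<Sum>a\<in>A. f a) = (\<Sum>a\<in>A. ps_var_mult k (f a))"
  using sum_comp_morphism[of "ps_var_mult k" f A] by (simp add: ps_var_mult_add o_def)

lemma sum_smult_of_bool:
  fixes j :: ix
  shows "(\<Sum>k\<in>UNIV. ps_smult (of_bool (k = j)) (f k)) = f j"
  "(\<Sum>k\<in>UNIV. ps_smult (of_bool (j = k)) (f k)) = f j"
proof -
  show *: "(\<Sum>k\<in>UNIV. ps_smult (of_bool (k = j)) (f k)) = f j"
    by (rule ext) (simp only: sum_apply ps_smult_apply sum_of_bool)
  show "(\<Sum>k\<in>UNIV. ps_smult (of_bool (j = k)) (f k)) = f j"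
    unfolding eq_commute[of j] by (rule *)
qed

lemma sum_const_ix: "(\<Sum>i\<in>(UNIV :: ix set). f) = ps_smult (of_nat 5) f"
  by (simp only: UNIV_ix_sum) (simp add: fun_eq_iff fun_apply)

text \<open>The witness contracts the 1-form with the Euler field. By closedness the derivative of
  this contraction is the Euler operator plus 1, applied to \<open>g r\<close>; differentiating
  \<open>inv_euler 0\<close> supplies the shift 1 that inverts it. Constant terms, on which
  \<open>inv_euler 0\<close> is zero, do not matter under a derivative.\<close>

lemma poincare_1:
  fixes g :: "ix \<Rightarrow> 'k::field_char_0 ps"
  assumes "\<And>i j. ps_deriv i (g j) = ps_deriv j (g i)"
  shows "\<exists>h. \<forall>k. g k = ps_deriv k h"
proof (intro exI allI)
  fix r
  have "ps_deriv r (\<Sum>k\<in>UNIV. ps_var_mult k (g k))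
      = (\<Sum>k\<in>UNIV. ps_smult (of_bool (r = k)) (g k)) + (\<Sum>k\<in>UNIV. ps_var_mult k (ps_deriv k (g r)))"
    unfolding ps_deriv_sum ps_deriv_var_mult assms[of r] sum.distrib ..
  also have "\<dots> = (\<Sum>k\<in>UNIV. ps_var_mult k (ps_deriv k (g r))) + ps_smult (of_nat 1) (g r)"
    unfolding sum_smult_of_bool by (simp add: add.commute)
  finally have "ps_deriv r (inv_euler 0 (\<Sum>k\<in>UNIV. ps_var_mult k (g k)))
      = inv_euler 1 ((\<Sum>k\<in>UNIV. ps_var_mult k (ps_deriv k (g r))) + ps_smult (of_nat 1) (g r))"
    unfolding ps_deriv_inv_euler by simp
  also have "\<dots> = g r" by (rule inv_euler_euler) simp
  finally show "g r = ps_deriv r (inv_euler 0 (\<Sum>k\<in>UNIV. ps_var_mult k (g k)))" ..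
qed

text \<open>The homotopy operator: contraction with the Euler field, divided by the weight.
  Coefficients of degree m in a 2-form have weight m + 2 and degree m + 1 after contraction, hence
  the shift 1.\<close>

definition potential :: "'k form2 \<Rightarrow> ix \<Rightarrow> 'k::field_char_0 ps" where
  "potential \<omega> j = inv_euler 1 (\<Sum>k\<in>UNIV. ps_var_mult k (\<omega> k j))"

lemma Omega2_clD:
  assumes "\<omega> \<in> Omega2_cl"
  shows "\<omega> i j = - \<omega> j i" "\<omega> i i = 0"
    "ps_deriv i (\<omega> j k) + ps_deriv j (\<omega> k i) + ps_deriv k (\<omega> i j) = 0"
  by (rule assms[unfolded Omega2_cl_def mem_Collect_eq, THEN conjunct1, rule_format],
      rule assms[unfolded Omega2_cl_def mem_Collect_eq, THEN conjunct2, THEN conjunct1, rule_format],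
      rule assms[unfolded Omega2_cl_def mem_Collect_eq, THEN conjunct2, THEN conjunct2, rule_format])

lemma Omega2_clI:
  assumes "\<And>i j. \<omega> i j = - \<omega> j i" "\<And>i. \<omega> i i = 0"
    "\<And>i j k. ps_deriv i (\<omega> j k) + ps_deriv j (\<omega> k i) + ps_deriv k (\<omega> i j) = 0"
  shows "\<omega> \<in> Omega2_cl"
  unfolding Omega2_cl_def mem_Collect_eq by (intro conjI allI assms)

text \<open>Cartan's formula for the Euler field: on a closed form the differential of the
  contraction is the Lie derivative, which on coefficients is the Euler operator plus 2, one for
  each differential.\<close>

lemma poincare_2:
  assumes "\<omega> \<in> Omega2_cl"
  shows "ps_deriv i (potential \<omega> j) - ps_deriv j (potential \<omega> i) = \<omega> i j"
proof -
  have anti: "\<omega> j i = - \<omega> i j" for i j by (rule Omega2_clD[OF assms])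
  note closed = Omega2_clD(3)[OF assms]
  have d: "ps_deriv i (\<Sum>k\<in>UNIV. ps_var_mult k (\<omega> k j)) = \<omega> i j + (\<Sum>k\<in>UNIV. ps_var_mult k (ps_deriv i (\<omega> k j)))" for i j
    unfolding ps_deriv_sum ps_deriv_var_mult sum.distrib sum_smult_of_bool ..
  have c: "ps_deriv i (\<omega> k j) - ps_deriv j (\<omega> k i) = ps_deriv k (\<omega> i j)" for k
    using minus_unique[OF closed[of i j k]] by (simp add: anti[of j k] ps_deriv_uminus)
  have "ps_deriv i (\<Sum>k\<in>UNIV. ps_var_mult k (\<omega> k j)) - ps_deriv j (\<Sum>k\<in>UNIV. ps_var_mult k (\<omega> k i))
      = \<omega> i j - \<omega> j i + (\<Sum>k\<in>UNIV. ps_var_mult k (ps_deriv i (\<omega> k j) - ps_deriv j (\<omega> k i)))"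
    unfolding d diff_conv_add_uminus ps_var_mult_add ps_var_mult_uminus sum.distrib sum_negf by simp
  also have "\<dots> = (\<Sum>k\<in>UNIV. ps_var_mult k (ps_deriv k (\<omega> i j))) + ps_smult (of_nat 2) (\<omega> i j)"
    unfolding c by (simp add: anti[of j i] fun_eq_iff fun_apply)
  finally have "inv_euler 2 (ps_deriv i (\<Sum>k\<in>UNIV. ps_var_mult k (\<omega> k j)) - ps_deriv j (\<Sum>k\<in>UNIV. ps_var_mult k (\<omega> k i))) = \<omega> i j"
    using inv_euler_euler[of 2 "\<omega> i j"] by simp
  then show ?thesis
    unfolding potential_def ps_deriv_inv_euler
    by (simp add: diff_conv_add_uminus inv_euler_add inv_euler_uminus numeral_2_eq_2 del: add_uminus_conv_diff)
qed

text \<open>The wedge of the Euler field with \<open>X\<close>. For divergence free \<open>X\<close>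
  its divergence is the Euler operator plus 4 on \<open>X\<close>, where 4 = 5 - 1 combines the five
  variables with one delta term. Taking the divergence raises the shift, so 3 is the right one
  here.\<close>

definition bivector :: "'k vfield \<Rightarrow> ix \<Rightarrow> ix \<Rightarrow> 'k::field_char_0 ps" where
  "bivector X i j = inv_euler 3 (ps_var_mult i (X j) - ps_var_mult j (X i))"

lemma poincare_div_1:
  assumes "X \<in> S5"
  shows "(\<Sum>i\<in>UNIV. ps_deriv i (bivector X i j)) = X j"
proof -
  have div: "(\<Sum>i\<in>UNIV. ps_deriv i (X i)) = 0" using assms by (simp add: S5_def)
  have "(\<Sum>i\<in>UNIV. ps_deriv i (ps_var_mult i (X j) - ps_var_mult j (X i)))
     = (\<Sum>i\<in>(UNIV :: ix set). X j) + (\<Sum>i\<in>UNIV. ps_var_mult i (ps_deriv i (X j)))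
       - ((\<Sum>i\<in>UNIV. ps_smult (of_bool (i = j)) (X i)) + ps_var_mult j (\<Sum>i\<in>UNIV. ps_deriv i (X i)))"
    unfolding ps_deriv_diff ps_deriv_var_mult sum_subtractf sum.distrib ps_var_mult_sum by simp
  also have "\<dots> = (\<Sum>i\<in>UNIV. ps_var_mult i (ps_deriv i (X j))) + ps_smult (of_nat 4) (X j)"
    unfolding sum_smult_of_bool div sum_const_ix by (simp add: fun_eq_iff fun_apply algebra_simps)
  finally have "inv_euler 4 (\<Sum>i\<in>UNIV. ps_deriv i (ps_var_mult i (X j) - ps_var_mult j (X i))) = X j"
    using inv_euler_euler[of 4 "X j"] by simp
  then show ?thesis unfolding bivector_def ps_deriv_inv_euler inv_euler_sum[symmetric] by simp
qed

lemma bivector_anti: "bivector X j i = - bivector X i j"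
  unfolding bivector_def inv_euler_uminus[symmetric] by simp

text \<open>The wedge of the Euler field with \<open>F\<close>, of which only cyclic invariance is
  recorded. Its divergence is the Euler operator plus 3 on \<open>F\<close>: five from the
  variables, minus one for each of the two delta terms. Hence the shift 2 before
  differentiating.\<close>

lemma poincare_div_2:
  fixes F :: "ix \<Rightarrow> ix \<Rightarrow> 'k::field_char_0 ps"
  assumes anti: "\<And>i j. F j i = - F i j" and div: "\<And>j. (\<Sum>i\<in>UNIV. ps_deriv i (F i j)) = 0"
  shows "\<exists>G. (\<forall>i j. F i j = (\<Sum>k\<in>UNIV. ps_deriv k (G k i j))) \<and> (\<forall>i j k. G k i j = G i j k)"
proof (intro exI conjI allI)
  let ?G = "\<lambda>k i j. inv_euler 2 (ps_var_mult k (F i j) + ps_var_mult i (F j k) + ps_var_mult j (F k i))"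
  show "?G k i j = ?G i j k" for i j k by (simp add: add_ac)
  fix i j
  have div': "(\<Sum>k\<in>UNIV. ps_deriv k (F j k)) = 0" for j
    using div[of j] by (simp add: anti[of j] ps_deriv_uminus sum_negf)
  have "(\<Sum>k\<in>UNIV. ps_deriv k (ps_var_mult k (F i j) + ps_var_mult i (F j k) + ps_var_mult j (F k i)))
     = (\<Sum>k\<in>(UNIV :: ix set). F i j) + (\<Sum>k\<in>UNIV. ps_var_mult k (ps_deriv k (F i j)))
       + ((\<Sum>k\<in>UNIV. ps_smult (of_bool (k = i)) (F j k)) + ps_var_mult i (\<Sum>k\<in>UNIV. ps_deriv k (F j k)))
       + ((\<Sum>k\<in>UNIV. ps_smult (of_bool (k = j)) (F k i)) + ps_var_mult j (\<Sum>k\<in>UNIV. ps_deriv k (F k i)))"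
    unfolding ps_deriv_add ps_deriv_var_mult sum.distrib ps_var_mult_sum by simp
  also have "\<dots> = (\<Sum>k\<in>UNIV. ps_var_mult k (ps_deriv k (F i j))) + ps_smult (of_nat 3) (F i j)"
    unfolding sum_smult_of_bool div div' sum_const_ix anti[of i j]
    by (simp add: fun_eq_iff fun_apply algebra_simps)
  finally have "inv_euler 3 (\<Sum>k\<in>UNIV. ps_deriv k (ps_var_mult k (F i j) + ps_var_mult i (F j k) + ps_var_mult j (F k i))) = F i j"
    using inv_euler_euler[of 3 "F i j"] by simp
  then show "F i j = (\<Sum>k\<in>UNIV. ps_deriv k (?G k i j))"
    unfolding ps_deriv_inv_euler inv_euler_sum[symmetric] by (simp add: numeral_3_eq_3)
qed

section \<open>The realisation of the annihilation superalgebra\<close>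

definition e_scal :: "'k \<Rightarrow> 'k vfield \<times> 'k form2 \<Rightarrow> 'k::comm_ring_1 vfield \<times> 'k form2" where
  "e_scal c = (\<lambda>(X, \<omega>). (\<lambda>i. ps_smult c (X i), \<lambda>i j. ps_smult c (\<omega> i j)))"

definition e_brk :: "'k vfield \<times> 'k form2 \<Rightarrow> 'k vfield \<times> 'k form2 \<Rightarrow> 'k::field_char_0 vfield \<times> 'k form2" where
  "e_brk = (\<lambda>(X, \<omega>) (Y, \<eta>). (commutator X Y + form_bracket \<omega> \<eta>, lie_deriv X \<eta> - lie_deriv Y \<omega>))"

definition phi :: "'k re_amb \<Rightarrow> 'k ps \<Rightarrow> 'k::field_char_0 vfield \<times> 'k form2" where
  "phi r f = (\<lambda>t. mpol_act (fst r t) f, \<lambda>j k. mpol_act (snd r j k) f)"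

lemma e_eqI:
  assumes "\<And>t. fst x t = fst y t" "\<And>j k. snd x j k = snd y j k"
  shows "x = (y :: 'k vfield \<times> 'k form2)"
  using assms by (intro prod_eqI ext) auto

lemma e_scal_simps: "fst (e_scal c x) t = ps_smult c (fst x t)" "snd (e_scal c x) j k = ps_smult c (snd x j k)"
  by (simp_all add: e_scal_def split_beta)

lemma phi_simps: "fst (phi r f) t = mpol_act (fst r t) f" "snd (phi r f) j k = mpol_act (snd r j k) f"
  by (simp_all add: phi_def)

lemma e_scal_add: "e_scal c (x + y) = e_scal c x + e_scal c y" "e_scal (a + b) x = e_scal a x + e_scal b x"
  by (auto intro!: e_eqI simp: e_scal_simps fun_apply(1) ps_smult_add)

lemma e_scal_mult: "e_scal a (e_scal b x) = e_scal (a * b) x" "e_scal 1 x = x" "e_scal 0 x = 0" "e_scal c 0 = 0"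
  by (auto intro!: e_eqI simp: e_scal_simps zero_prod_def fun_apply(2))

lemma e_scal_minus: "e_scal (- 1) x = - x"
  by (auto intro!: e_eqI simp: e_scal_simps fun_apply(3) ps_smult_uminus)

lemma phi_add: "phi (r + s) f = phi r f + phi s f" "phi r (f + g) = phi r f + phi r g"
  by (auto intro!: e_eqI simp: phi_simps fun_apply(1) mpol_act_add mpol_act_add_right)

lemma mpol_act_const_mult: "mpol_act (pconst c * p) f = ps_smult c (mpol_act p f)"
proof (induction p rule: mpol_induct)
  case (const d)
  show ?case unfolding pconst_mult[symmetric] mpol_act_const by simp
next
  case (add p q)
  then show ?case by (simp add: mpol_act_add distrib_left ps_smult_add)
next
  case (var i p)
  then show ?case
    by (simp add: mult.left_commute[of _ "pvar i"] mpol_act_var ps_deriv_smult ps_smult_uminus)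
qed

lemma phi_const: "phi (re_act (pconst c) r) f = e_scal c (phi r f)"
  by (auto intro!: e_eqI simp: phi_simps e_scal_simps re_act_simps mpol_act_const_mult)

lemma phi_smult: "phi r (ps_smult c f) = e_scal c (phi r f)"
  by (auto intro!: e_eqI simp: phi_simps e_scal_simps mpol_act_smult)

lemma phi_var: "phi (re_act (pvar i) r) f = - phi r (ps_deriv i f)"
  by (auto intro!: e_eqI simp: phi_simps fun_apply(3) re_act_simps mpol_act_var mpol_act_deriv)

lemma phi_0 [simp]: "phi 0 f = 0" "phi r 0 = 0"
  using phi_add(1)[of 0 0 f] phi_add(2)[of r 0 0] by simp_all

lemma phi_a: "fst (phi (re_a i j) f) t = ps_smult (of_bool (t = i)) (ps_deriv j f) - ps_smult (of_bool (t = j)) (ps_deriv i f)"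
    "snd (phi (re_a i j) f) = 0"
proof -
  show "fst (phi (re_a i j) f) t = ps_smult (of_bool (t = i)) (ps_deriv j f) - ps_smult (of_bool (t = j)) (ps_deriv i f)"
    by (cases "t = i"; cases "t = j") (simp_all add: phi_simps re_a_simps mpol_act_pvar mpol_act_uminus)
  show "snd (phi (re_a i j) f) = 0"
    by (intro ext) (simp add: phi_simps re_a_simps fun_apply)
qed

lemma phi_b: "snd (phi (re_b k) f) p q = ps_smult (of_bool (p = k)) (ps_deriv q f) - ps_smult (of_bool (q = k)) (ps_deriv p f)"
    "fst (phi (re_b k) f) = 0"
proof -
  show "snd (phi (re_b k) f) p q = ps_smult (of_bool (p = k)) (ps_deriv q f) - ps_smult (of_bool (q = k)) (ps_deriv p f)"
    by (cases "p = k"; cases "q = k") (simp_all add: phi_simps re_b_simps mpol_act_pvar mpol_act_uminus)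
  show "fst (phi (re_b k) f) = 0"
    by (intro ext) (simp add: phi_simps re_b_simps fun_apply)
qed

lemma S5_closed: "0 \<in> S5" "X \<in> S5 \<Longrightarrow> Y \<in> S5 \<Longrightarrow> X + Y \<in> S5" "X \<in> S5 \<Longrightarrow> (\<lambda>i. ps_smult c (X i)) \<in> S5"
  by (simp_all add: S5_def fun_apply(1,2) ps_deriv_add sum.distrib ps_deriv_smult flip: ps_smult_sum)

lemma Omega2_closed: "0 \<in> Omega2_cl" "\<omega> \<in> Omega2_cl \<Longrightarrow> \<eta> \<in> Omega2_cl \<Longrightarrow> \<omega> + \<eta> \<in> Omega2_cl"
  "\<omega> \<in> Omega2_cl \<Longrightarrow> (\<lambda>i j. ps_smult c (\<omega> i j)) \<in> Omega2_cl"
proof -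
  show "0 \<in> Omega2_cl" by (simp add: Omega2_cl_def fun_apply(2))
  assume w: "\<omega> \<in> Omega2_cl"
  note w_simps = Omega2_clD(2,3)[OF w]
  show "\<omega> + \<eta> \<in> Omega2_cl" if e: "\<eta> \<in> Omega2_cl"
  proof (rule Omega2_clI)
    fix i j k
    show "(\<omega> + \<eta>) i j = - (\<omega> + \<eta>) j i"
      using Omega2_clD(1)[OF w, of i j] Omega2_clD(1)[OF e, of i j] by (simp add: fun_apply(1))
    show "(\<omega> + \<eta>) i i = 0"
      using w_simps Omega2_clD(2)[OF e] by (simp add: fun_apply(1))
    have "ps_deriv i (\<omega> j k + \<eta> j k) + ps_deriv j (\<omega> k i + \<eta> k i) + ps_deriv k (\<omega> i j + \<eta> i j)
      = (ps_deriv i (\<omega> j k) + ps_deriv j (\<omega> k i) + ps_deriv k (\<omega> i j))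
      + (ps_deriv i (\<eta> j k) + ps_deriv j (\<eta> k i) + ps_deriv k (\<eta> i j))"
      unfolding ps_deriv_add by (simp add: add_ac)
    also have "\<dots> = 0" using w_simps Omega2_clD(3)[OF e] by simp
    finally show "ps_deriv i ((\<omega> + \<eta>) j k) + ps_deriv j ((\<omega> + \<eta>) k i) + ps_deriv k ((\<omega> + \<eta>) i j) = 0"
      by (simp add: fun_apply(1))
  qed
  show "(\<lambda>i j. ps_smult c (\<omega> i j)) \<in> Omega2_cl"
  proof (rule Omega2_clI)
    fix i j
    show "ps_smult c (\<omega> i j) = - ps_smult c (\<omega> j i)"
      unfolding Omega2_clD(1)[OF w, of i j] by (simp add: ps_smult_uminus)
  qed (use w_simps in \<open>simp_all add: ps_deriv_smult flip: ps_smult_add\<close>)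
qed

definition e_carr :: "('k::field_char_0 vfield \<times> 'k form2) set" where
  "e_carr = S5 \<times> Omega2_cl"

lemma e_carr_closed: "0 \<in> e_carr" "x \<in> e_carr \<Longrightarrow> y \<in> e_carr \<Longrightarrow> x + y \<in> e_carr" "x \<in> e_carr \<Longrightarrow> e_scal c x \<in> e_carr"
  by (auto simp: e_carr_def e_scal_def S5_closed Omega2_closed zero_prod_def)

lemma e_carr_sum: "(\<And>a. a \<in> A \<Longrightarrow> f a \<in> e_carr) \<Longrightarrow> sum f A \<in> e_carr"
  by (induction A rule: infinite_finite_induct) (auto simp: e_carr_closed)

lemma e_carr_uminus: "x \<in> e_carr \<Longrightarrow> - x \<in> e_carr"
  using e_carr_closed(3)[of x "-1"] by (simp add: e_scal_minus)

lemma phi_a_carr: "phi (re_a i j) f \<in> e_carr"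
proof -
  have "(\<Sum>t\<in>UNIV. ps_deriv t (fst (phi (re_a i j) f) t)) =
     (\<Sum>t\<in>UNIV. ps_smult (of_bool (t = i)) (ps_deriv t (ps_deriv j f))) - (\<Sum>t\<in>UNIV. ps_smult (of_bool (t = j)) (ps_deriv t (ps_deriv i f)))"
    by (simp add: phi_a ps_deriv_diff ps_deriv_smult sum_subtractf)
  also have "\<dots> = 0" unfolding sum_smult_of_bool by (simp add: ps_deriv_commute[of i])
  finally show ?thesis
    by (simp add: e_carr_def S5_def mem_Times_iff phi_a(2) Omega2_closed)
qed

text \<open>The form attached to \<open>b_k\<close> and \<open>f\<close> is the wedge of
  \<open>dx_k\<close> with \<open>df\<close>, which is exact up to sign and so closed.\<close>

lemma phi_b_carr: "phi (re_b k) f \<in> e_carr"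
proof -
  have "snd (phi (re_b k) f) \<in> Omega2_cl"
    by (rule Omega2_clI) (simp_all add: phi_b ps_deriv_diff ps_deriv_smult ps_deriv_commute)
  then show ?thesis by (simp add: e_carr_def mem_Times_iff phi_b(2) S5_closed)
qed

lemma phi_carr:
  assumes "r \<in> re_carr"
  shows "phi r f \<in> e_carr"
  using assms[unfolded re_carr_span]
  by (induction arbitrary: f rule: re_span_induct)
     (auto simp: phi_add phi_const phi_var phi_a_carr phi_b_carr intro!: e_carr_closed e_carr_uminus)

lemma psum_phi:
  "fst (psum (\<lambda>J r. phi r (ps_mult (pd J f) g)) X) t = bil (Poly_Mapping.map (\<lambda>r. fst r t) X) f g"
  "snd (psum (\<lambda>J r. phi r (ps_mult (pd J f) g)) X) j k = bil (Poly_Mapping.map (\<lambda>r. snd r j k) X) f g"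
proof -
  have "fst (psum (\<lambda>J r. phi r (ps_mult (pd J f) g)) X) t = psum (\<lambda>J r. mpol_act (fst r t) (ps_mult (pd J f) g)) X"
    by (subst psum_comp[of "\<lambda>x. fst x t"]) (auto simp: fun_eq_iff fun_apply phi_simps)
  also have "\<dots> = bil (Poly_Mapping.map (\<lambda>r. fst r t) X) f g"
    unfolding bil_def by (rule psum_map[symmetric]) (simp_all add: fun_apply fun_eq_iff)
  finally show "fst (psum (\<lambda>J r. phi r (ps_mult (pd J f) g)) X) t = bil (Poly_Mapping.map (\<lambda>r. fst r t) X) f g" .
  have "snd (psum (\<lambda>J r. phi r (ps_mult (pd J f) g)) X) j k = psum (\<lambda>J r. mpol_act (snd r j k) (ps_mult (pd J f) g)) X"
    by (subst psum_comp[of "\<lambda>x. snd x j k"]) (auto simp: fun_eq_iff fun_apply phi_simps)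
  also have "\<dots> = bil (Poly_Mapping.map (\<lambda>r. snd r j k) X) f g"
    unfolding bil_def by (rule psum_map[symmetric]) (simp_all add: fun_apply fun_eq_iff)
  finally show "snd (psum (\<lambda>J r. phi r (ps_mult (pd J f) g)) X) j k = bil (Poly_Mapping.map (\<lambda>r. snd r j k) X) f g" .
qed

lemma bil_evr_1: "bil (evr p) f g = ps_mult f (mpol_act p g)"
  using bil_evr[of p 1 f g] by (simp add: bil_1)

lemma bil_evl_1: "bil (evl p) f g = ps_mult (mpol_act p f) g"
  using bil_evl[of p 1 f g] by (simp add: bil_1)

lemma ps_smult_diff: "ps_smult c (f - g) = ps_smult c f - ps_smult c g"
  by (auto simp: fun_eq_iff fun_apply algebra_simps)

lemma e_brk_fst: "fst (e_brk x y) t =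
    (\<Sum>i\<in>UNIV. ps_mult (fst x i) (ps_deriv i (fst y t))) - (\<Sum>i\<in>UNIV. ps_mult (fst y i) (ps_deriv i (fst x t)))
    + ps_smult (1 / 4) (\<Sum>i\<in>UNIV. \<Sum>j\<in>UNIV. \<Sum>k\<in>UNIV. \<Sum>l\<in>UNIV.
        ps_smult (eps i j k l t) (ps_mult (snd x i j) (snd y k l)))"
  by (simp add: e_brk_def split_beta fun_apply(1) commutator_def form_bracket_def sum_subtractf)

lemma e_brk_snd: "snd (e_brk x y) j k =
    (\<Sum>i\<in>UNIV. ps_mult (fst x i) (ps_deriv i (snd y j k)) + ps_mult (ps_deriv j (fst x i)) (snd y i k)
       + ps_mult (ps_deriv k (fst x i)) (snd y j i))
  - (\<Sum>i\<in>UNIV. ps_mult (fst y i) (ps_deriv i (snd x j k)) + ps_mult (ps_deriv j (fst y i)) (snd x i k)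
       + ps_mult (ps_deriv k (fst y i)) (snd x j i))"
  by (simp add: e_brk_def split_beta fun_apply(4) lie_deriv_def)

text \<open>On products of power series \<open>\<lambda>\<^sub>i\<close> differentiates the first factor and \<open>- \<partial>\<^sub>i\<close> the whole product,
  which turns \<open>amb_br\<close> into the bracket of \<open>E(5,10)\<close>.\<close>

lemma phi_amb_br:
  "psum (\<lambda>J r. phi r (ps_mult (pd J f) g)) (amb_br a b) = e_brk (phi a f) (phi b g)"
proof (rule e_eqI)
  fix t
  show "fst (psum (\<lambda>J r. phi r (ps_mult (pd J f) g)) (amb_br a b)) t = fst (e_brk (phi a f) (phi b g)) t"
    unfolding psum_phi map_amb_br e_brk_fst phi_simps brE_def
    unfolding bil_add bil_diff bil_uminus bil_sum bil_emb_const bil_evl bil_evr bil_lam_par bil_lam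
      bil_evr_1 bil_evl_1 mpol_act_deriv
    by (simp add: sum_negf ps_mult_commute[of "mpol_act (fst b _) g"])
next
  fix j k
  show "snd (psum (\<lambda>J r. phi r (ps_mult (pd J f) g)) (amb_br a b)) j k = snd (e_brk (phi a f) (phi b g)) j k"
    unfolding psum_phi map_amb_br e_brk_snd phi_simps brO_def
    unfolding bil_add bil_diff bil_uminus bil_sum bil_emb_const bil_evl bil_evr bil_lam_par bil_lam
      bil_evr_1 bil_evl_1 mpol_act_deriv
    by (simp add: ps_mult_commute[of "mpol_act (fst b _) g"] ps_mult_commute[of "ps_deriv _ (mpol_act (fst b _) g)"])
qed

lemma e_brk_add: "e_brk (x + x') y = e_brk x y + e_brk x' y" "e_brk x (y + y') = e_brk x y + e_brk x y'"
  by (rule e_eqI, simp_all only: e_brk_fst e_brk_snd fst_add snd_add plus_fun_apply ps_mult_add ps_deriv_add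
      ps_smult_add sum.distrib, simp_all only: add_ac diff_conv_add_uminus minus_add_distrib)+

lemma e_brk_scal: "e_brk (e_scal c x) y = e_scal c (e_brk x y)" "e_brk x (e_scal c y) = e_scal c (e_brk x y)"
  by (rule e_eqI, simp_all only: e_brk_fst e_brk_snd e_scal_simps ps_mult_smult ps_deriv_smult ps_smult_sum
      ps_smult_add ps_smult_diff ps_smult_simps mult_ac)+

section \<open>The tensor product\<close>

lemma tscal_lookup: "Poly_Mapping.lookup (tscal c u) K = c * Poly_Mapping.lookup u K"
  by (simp add: tscal_def)

interpretation tens: module tscal
  by unfold_locales (simp_all add: poly_mapping_eq_iff fun_eq_iff tscal_lookup lookup_add distrib_left distrib_right fun_apply mult.assoc)

definition tmap :: "('k, 'k re_amb) tens \<Rightarrow> 'k::field_char_0 vfield \<times> 'k form2" where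
  "tmap u = psum (\<lambda>K c. e_scal c (phi (fst K) (snd K))) u"

lemma tmap_add: "tmap (u + v) = tmap u + tmap v"
  unfolding tmap_def by (rule psum_add) (simp_all add: e_scal_mult e_scal_add)

lemma tmap_0 [simp]: "tmap 0 = 0"
  by (simp add: tmap_def)

lemma tmap_sum: "tmap (sum f A) = (\<Sum>a\<in>A. tmap (f a))"
  using sum_comp_morphism[of tmap f A] by (simp add: tmap_add o_def)

lemma tmap_tscal: "tmap (tscal c u) = e_scal c (tmap u)"
proof -
  have "tmap (tscal c u) = psum (\<lambda>K d. e_scal (c * d) (phi (fst K) (snd K))) u"
    unfolding tmap_def tscal_def by (rule psum_map) (simp_all add: e_scal_mult)
  also have "\<dots> = e_scal c (tmap u)"
    unfolding tmap_def by (subst psum_comp) (simp_all add: e_scal_mult e_scal_add)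
  finally show ?thesis .
qed

lemma tmap_tens: "tmap (tens r f) = phi r f"
  by (simp add: tmap_def tens_def e_scal_mult)

lemma tmap_uminus: "tmap (- u) = - tmap u"
  using tmap_add[of "- u" u] by (simp add: eq_neg_iff_add_eq_0)

lemma tmap_diff: "tmap (u - v) = tmap u - tmap v"
  using tmap_add[of u "- v"] by (simp add: tmap_uminus)

text \<open>Carrier, parity components, degree components and neighbourhoods are all given by a
  condition on the pairs in the support; this is their common form.\<close>

definition tens_on :: "('r \<Rightarrow> 'k ps \<Rightarrow> bool) \<Rightarrow> ('k::comm_ring_1, 'r) tens set" where
  "tens_on P = {u. \<forall>(r, f)\<in>Poly_Mapping.keys u. P r f}"

lemma tens_on_closed:
  "0 \<in> tens_on P" "u \<in> tens_on P \<Longrightarrow> v \<in> tens_on P \<Longrightarrow> u + v \<in> tens_on P"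
  "u \<in> tens_on P \<Longrightarrow> tscal c u \<in> tens_on P" "P r f \<Longrightarrow> tens r f \<in> tens_on P"
proof -
  show "u + v \<in> tens_on P" if "u \<in> tens_on P" "v \<in> tens_on P"
    using that keys_add[of u v] by (fastforce simp: tens_on_def)
  show "tscal c u \<in> tens_on P" if "u \<in> tens_on P"
    using that by (fastforce simp: tens_on_def in_keys_iff tscal_lookup)
qed (auto simp: tens_on_def tens_def)

lemma tens_on_sum: "(\<And>a. a \<in> A \<Longrightarrow> f a \<in> tens_on P) \<Longrightarrow> sum f A \<in> tens_on P"
  by (induction A rule: infinite_finite_induct) (auto simp: tens_on_closed)

lemma tens_on_subspace: "tens.subspace (tens_on P)"
  by (simp add: tens.subspace_def tens_on_closed)

lemma tens_expand: "u = (\<Sum>K\<in>Poly_Mapping.keys u. tscal (Poly_Mapping.lookup u K) (tens (fst K) (snd K)))"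
proof (rule poly_mapping_eqI)
  fix K
  have "(\<Sum>L\<in>Poly_Mapping.keys u. Poly_Mapping.lookup u L * (if L = K then 1 else 0)) = Poly_Mapping.lookup u K"
    by (simp add: if_distrib[of "(*) _"] in_keys_iff cong: if_cong)
  then show "Poly_Mapping.lookup u K =
      Poly_Mapping.lookup (\<Sum>K\<in>Poly_Mapping.keys u. tscal (Poly_Mapping.lookup u K) (tens (fst K) (snd K))) K"
    by (simp add: lookup_sum tscal_lookup tens_def lookup_single when_def)
qed

abbreviation (input) RE :: "('k::field_char_0, 'k re_amb) conformal" where "RE \<equiv> RE_5_10"

abbreviation tcarr :: "('k::field_char_0, 'k re_amb) tens set" where
  "tcarr \<equiv> tens_on (\<lambda>r f. r \<in> re_carr)"

lemma tmap_carr: "u \<in> tcarr \<Longrightarrow> tmap u \<in> e_carr"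
  unfolding tmap_def psum_def by (intro e_carr_sum e_carr_closed phi_carr) (auto simp: tens_on_def)

lemma ann_bracket_carr:
  assumes "u \<in> tcarr" "v \<in> tcarr"
  shows "ann_bracket RE u v \<in> tcarr"
proof -
  have cbr: "Poly_Mapping.lookup (cbr RE r s) J \<in> re_carr" if "r \<in> re_carr" "s \<in> re_carr" for r s :: "'a re_amb" and J
    unfolding RE_5_10_simps(5)[OF that] by (rule amb_br_carr[OF that])
  show ?thesis
    unfolding ann_bracket_def split_beta nprod_def RE_5_10_simps(4)
    by (intro tens_on_sum tens_on_closed(3,4) re_carr_simps(3) cbr) (use assms in \<open>auto simp: tens_on_def\<close>)
qed

text \<open>The J! hidden in \<open>nprod\<close> cancels the 1/J! of the bracket, so each pair of
  basis tensors gives a sum over the coefficients of the \<lambda>-bracket, to which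
  \<open>phi_amb_br\<close> applies. The rest is bilinearity.\<close>

lemma tmap_bracket:
  assumes "u \<in> tcarr" "v \<in> tcarr"
  shows "tmap (ann_bracket RE u v) = e_brk (tmap u) (tmap v)"
proof -
  let ?c = "\<lambda>K L. Poly_Mapping.lookup u K * Poly_Mapping.lookup v L"
  have summand: "(\<Sum>J\<in>Poly_Mapping.keys (cbr RE (fst K) (fst L)). tmap (tscal (?c K L * (1 / mfact J))
        (tens (nprod RE J (fst K) (fst L)) (ps_mult (op_power ps_deriv J (snd K)) (snd L)))))
      = e_brk (e_scal (Poly_Mapping.lookup u K) (phi (fst K) (snd K))) (e_scal (Poly_Mapping.lookup v L) (phi (fst L) (snd L)))"
    if K: "K \<in> Poly_Mapping.keys u" and L: "L \<in> Poly_Mapping.keys v" for K L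
  proof -
    have carr: "fst K \<in> re_carr" "fst L \<in> re_carr"
      using assms K L by (auto simp: tens_on_def)
    have "(\<Sum>J\<in>Poly_Mapping.keys (cbr RE (fst K) (fst L)). tmap (tscal (?c K L * (1 / mfact J))
        (tens (nprod RE J (fst K) (fst L)) (ps_mult (op_power ps_deriv J (snd K)) (snd L)))))
      = (\<Sum>J\<in>Poly_Mapping.keys (amb_br (fst K) (fst L)). e_scal (?c K L)
          (phi (Poly_Mapping.lookup (amb_br (fst K) (fst L)) J) (ps_mult (pd J (snd K)) (snd L))))"
      unfolding RE_5_10_simps(5)[OF carr] nprod_def RE_5_10_simps(4) tmap_tscal tmap_tens phi_const e_scal_mult op_power_ps_deriv
      by (simp add: mfact_pos)
    also have "\<dots> = e_scal (?c K L) (psum (\<lambda>J r. phi r (ps_mult (pd J (snd K)) (snd L))) (amb_br (fst K) (fst L)))"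
      unfolding psum_def
      using sum_comp_morphism[of "e_scal (?c K L)", OF e_scal_mult(4) e_scal_add(1)] by (simp add: o_def)
    also have "\<dots> = e_brk (e_scal (Poly_Mapping.lookup u K) (phi (fst K) (snd K))) (e_scal (Poly_Mapping.lookup v L) (phi (fst L) (snd L)))"
      unfolding phi_amb_br e_brk_scal e_scal_mult by (simp add: mult.commute)
    finally show ?thesis .
  qed
  have e0: "e_brk 0 y = 0" "e_brk x 0 = 0" for x y :: "'a vfield \<times> 'a form2"
    using e_brk_add(1)[of 0 0 y] e_brk_add(2)[of x 0 0] by simp_all
  have "tmap (ann_bracket RE u v) = (\<Sum>K\<in>Poly_Mapping.keys u. \<Sum>L\<in>Poly_Mapping.keys v.
      e_brk (e_scal (Poly_Mapping.lookup u K) (phi (fst K) (snd K))) (e_scal (Poly_Mapping.lookup v L) (phi (fst L) (snd L))))"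
    unfolding ann_bracket_def split_beta tmap_sum prod.collapse
    by (intro sum.cong refl summand)
  also have "\<dots> = (\<Sum>K\<in>Poly_Mapping.keys u. e_brk (e_scal (Poly_Mapping.lookup u K) (phi (fst K) (snd K))) (tmap v))"
  proof -
    have "(\<Sum>a\<in>A. e_brk x (f a)) = e_brk x (sum f A)" for x :: "'a vfield \<times> 'a form2" and f and A :: "('a re_amb \<times> 'a ps) set"
      using sum_comp_morphism[of "e_brk x" f A, OF e0(2) e_brk_add(2)] by (simp add: o_def)
    then show ?thesis unfolding tmap_def psum_def by simp
  qed
  also have "\<dots> = e_brk (tmap u) (tmap v)"
    unfolding tmap_def[of u] psum_def
    using sum_comp_morphism[of "\<lambda>x. e_brk x (tmap v)", OF e0(1) e_brk_add(1)] by (simp add: o_def)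
  finally show ?thesis .
qed

subsection \<open>The kernel\<close>

definition rel :: "('k::field_char_0, 'k re_amb) tens set" where
  "rel = ann_rel RE"

lemma rel_closed: "0 \<in> rel" "u \<in> rel \<Longrightarrow> v \<in> rel \<Longrightarrow> u + v \<in> rel" "u \<in> rel \<Longrightarrow> v \<in> rel \<Longrightarrow> u - v \<in> rel"
    "u \<in> rel \<Longrightarrow> - u \<in> rel" "u \<in> rel \<Longrightarrow> tscal c u \<in> rel"
  unfolding rel_def ann_rel_def
  by (rule tens.span_zero tens.span_add tens.span_diff tens.span_neg tens.span_scale; assumption)+

lemma rel_gens:
  "r \<in> re_carr \<Longrightarrow> s \<in> re_carr \<Longrightarrow> tens (r + s) f - tens r f - tens s f \<in> rel"
  "r \<in> re_carr \<Longrightarrow> tens r (f + g) - tens r f - tens r g \<in> rel"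
  "r \<in> re_carr \<Longrightarrow> tens (re_act (pconst c) r) f - tscal c (tens r f) \<in> rel"
  "r \<in> re_carr \<Longrightarrow> tens r (ps_smult c f) - tscal c (tens r f) \<in> rel"
  "r \<in> re_carr \<Longrightarrow> tens (re_act (pvar i) r) f + tens r (ps_deriv i f) \<in> rel"
  unfolding rel_def ann_rel_def RE_5_10_simps by (rule tens.span_base; blast)+

text \<open>The five kinds of relations vanish in E(5,10) by bilinearity of \<open>phi\<close> and
  because \<partial> acts there as minus a derivative of the power series.\<close>

lemma rel_kernel:
  fixes u :: "('k::field_char_0, 'k re_amb) tens"
  shows "u \<in> rel \<Longrightarrow> u \<in> tcarr \<and> tmap u = 0"
proof -
  let ?K = "{u \<in> tcarr. tmap u = 0} :: ('k, 'k re_amb) tens set"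
  have sub: "tens.subspace ?K"
    by (auto simp: tens.subspace_def tens_on_closed tmap_add tmap_tscal e_scal_mult)
  have m: "u - v \<in> tcarr" if "u \<in> tcarr" "v \<in> tcarr" for u v :: "('k, 'k re_amb) tens"
    using tens.subspace_diff[OF tens_on_subspace that] .
  have t: "tens r f \<in> tcarr" if "r \<in> re_carr" for r :: "'k re_amb" and f
    using that by (rule tens_on_closed(4))
  note simps = m t re_carr_simps tens_on_closed(2,3) tmap_diff tmap_add tmap_tens tmap_tscal
    phi_add phi_const phi_smult phi_var
  have K1: "tens (r + s) f - tens r f - tens s f \<in> ?K" if "r \<in> re_carr" "s \<in> re_carr" for r s :: "'k re_amb" and f
    using that by (simp add: simps)
  have K2: "tens r (f + g) - tens r f - tens r g \<in> ?K" if "r \<in> re_carr" for r :: "'k re_amb" and f g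
    using that by (simp add: simps)
  have K3: "tens (re_act (pconst c) r) f - tscal c (tens r f) \<in> ?K" if "r \<in> re_carr" for r :: "'k re_amb" and c f
    using that by (simp add: simps)
  have K4: "tens r (ps_smult c f) - tscal c (tens r f) \<in> ?K" if "r \<in> re_carr" for r :: "'k re_amb" and c f
    using that by (simp add: simps)
  have K5: "tens (re_act (pvar i) r) f + tens r (ps_deriv i f) \<in> ?K" if "r \<in> re_carr" for r :: "'k re_amb" and i f
    using that by (simp add: simps)
  have "rel \<subseteq> ?K"
    unfolding rel_def ann_rel_def RE_5_10_simps
    by (rule tens.span_minimal[OF _ sub], intro Un_least subsetI; elim CollectE exE conjE; simp only:)
       (simp_all only: K1 K2 K3 K4 K5)
  then show "u \<in> rel \<Longrightarrow> u \<in> tcarr \<and> tmap u = 0" by blast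
qed

definition eqv :: "('k::field_char_0, 'k re_amb) tens \<Rightarrow> ('k, 'k re_amb) tens \<Rightarrow> bool" where
  "eqv u v \<longleftrightarrow> u - v \<in> rel"

lemma eqv_refl [simp]: "eqv u u"
  by (simp add: eqv_def rel_closed)

lemma eqv_sym: "eqv u v \<Longrightarrow> eqv v u"
  using rel_closed(4)[of "u - v"] by (simp add: eqv_def)

lemma eqv_trans [trans]: "eqv u v \<Longrightarrow> eqv v w \<Longrightarrow> eqv u w"
  using rel_closed(2)[of "u - v" "v - w"] by (simp add: eqv_def)

lemma eqv_add: "eqv u u' \<Longrightarrow> eqv v v' \<Longrightarrow> eqv (u + v) (u' + v')"
  using rel_closed(2)[of "u - u'" "v - v'"] by (simp add: eqv_def algebra_simps)

lemma eqv_uminus: "eqv u u' \<Longrightarrow> eqv (- u) (- u')"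
  using rel_closed(4)[of "u - u'"] by (simp add: eqv_def algebra_simps)

lemma eqv_tscal: "eqv u u' \<Longrightarrow> eqv (tscal c u) (tscal c u')"
  using rel_closed(5)[of "u - u'" c] by (simp add: eqv_def tens.scale_right_diff_distrib)

lemma eqv_sum: "(\<And>a. a \<in> A \<Longrightarrow> eqv (f a) (g a)) \<Longrightarrow> eqv (sum f A) (sum g A)"
  by (induction A rule: infinite_finite_induct) (auto intro: eqv_add)

lemma eqv_gens:
  "r \<in> re_carr \<Longrightarrow> s \<in> re_carr \<Longrightarrow> eqv (tens (r + s) f) (tens r f + tens s f)"
  "r \<in> re_carr \<Longrightarrow> eqv (tens r (f + g)) (tens r f + tens r g)"
  "r \<in> re_carr \<Longrightarrow> eqv (tens (re_act (pconst c) r) f) (tscal c (tens r f))"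
  "r \<in> re_carr \<Longrightarrow> eqv (tens r (ps_smult c f)) (tscal c (tens r f))"
  "r \<in> re_carr \<Longrightarrow> eqv (tens (re_act (pvar i) r) f) (- tens r (ps_deriv i f))"
  using rel_gens(1)[of r s f] rel_gens(2)[of r f g] rel_gens(3)[of r c f] rel_gens(4)[of r c f] rel_gens(5)[of r i f]
  by (simp_all add: eqv_def diff_diff_eq)

lemma eqv_0: "r \<in> re_carr \<Longrightarrow> eqv (tens r 0) 0" "eqv (tens 0 f) 0"
  using eqv_gens(4)[of r 0 0] eqv_gens(3)[of 0 0 f] re_carr_simps(1) by simp_all

lemma eqv_tens_sum:
  assumes "r \<in> re_carr"
  shows "eqv (tens r (\<Sum>a\<in>A. f a)) (\<Sum>a\<in>A. tens r (f a))"
proof (induction A rule: infinite_finite_induct)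
  case (insert a A)
  have "eqv (tens r (f a + sum f A)) (tens r (f a) + tens r (sum f A))" by (rule eqv_gens(2)[OF assms])
  also have "eqv \<dots> (tens r (f a) + (\<Sum>a\<in>A. tens r (f a)))" by (intro eqv_add eqv_refl insert)
  finally show ?case using insert by simp
qed (simp_all add: eqv_0 assms)

lemma eqv_sum_tens:
  assumes "\<And>a. a \<in> A \<Longrightarrow> r a \<in> re_carr"
  shows "(\<Sum>a\<in>A. r a) \<in> re_carr \<and> eqv (tens (\<Sum>a\<in>A. r a) f) (\<Sum>a\<in>A. tens (r a) f)"
  using assms
proof (induction A rule: infinite_finite_induct)
  case (insert a A)
  then have IH: "sum r A \<in> re_carr" "eqv (tens (sum r A) f) (\<Sum>a\<in>A. tens (r a) f)" by auto
  have "eqv (tens (r a + sum r A) f) (tens (r a) f + tens (sum r A) f)"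
    using insert IH by (intro eqv_gens(1)) auto
  also have "eqv \<dots> (tens (r a) f + (\<Sum>a\<in>A. tens (r a) f))" by (intro eqv_add eqv_refl IH)
  finally show ?case using insert IH by (simp add: re_carr_simps)
qed (simp_all add: eqv_0 re_carr_simps)

section \<open>Representatives supported on the generators\<close>

definition std :: "(ix \<Rightarrow> ix \<Rightarrow> 'k ps) \<Rightarrow> (ix \<Rightarrow> 'k ps) \<Rightarrow> ('k::field_char_0, 'k re_amb) tens" where
  "std F g = (\<Sum>i\<in>UNIV. \<Sum>j\<in>UNIV. tens (re_a i j) (F i j)) + (\<Sum>k\<in>UNIV. tens (re_b k) (g k))"

definition std_like :: "('k::field_char_0, 'k re_amb) tens \<Rightarrow> bool" where
  "std_like u \<longleftrightarrow> (\<exists>F g. eqv u (std F g))"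

lemma std_like_eqv: "eqv u v \<Longrightarrow> std_like v \<Longrightarrow> std_like u"
  unfolding std_like_def using eqv_trans by blast

lemma std_like_add:
  assumes "std_like u" "std_like v"
  shows "std_like (u + v)"
proof -
  obtain F g F' g' where u: "eqv u (std F g)" and v: "eqv v (std F' g')"
    using assms by (auto simp: std_like_def)
  have "eqv (std (\<lambda>i j. F i j + F' i j) (\<lambda>k. g k + g' k))
     ((\<Sum>i\<in>UNIV. \<Sum>j\<in>UNIV. tens (re_a i j) (F i j) + tens (re_a i j) (F' i j)) + (\<Sum>k\<in>UNIV. tens (re_b k) (g k) + tens (re_b k) (g' k)))"
    unfolding std_def by (intro eqv_add eqv_sum eqv_gens(2) re_gen_carr)
  also have "\<dots> = std F g + std F' g'"
    by (simp add: std_def sum.distrib add_ac)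
  finally have "eqv (u + v) (std (\<lambda>i j. F i j + F' i j) (\<lambda>k. g k + g' k))"
    using eqv_trans[OF eqv_add[OF u v]] eqv_sym by blast
  then show ?thesis unfolding std_like_def by blast
qed

lemma std_like_tscal:
  assumes "std_like u"
  shows "std_like (tscal c u)"
proof -
  obtain F g where u: "eqv u (std F g)" using assms by (auto simp: std_like_def)
  have "eqv (std (\<lambda>i j. ps_smult c (F i j)) (\<lambda>k. ps_smult c (g k)))
     ((\<Sum>i\<in>UNIV. \<Sum>j\<in>UNIV. tscal c (tens (re_a i j) (F i j))) + (\<Sum>k\<in>UNIV. tscal c (tens (re_b k) (g k))))"
    unfolding std_def by (intro eqv_add eqv_sum eqv_gens(4) re_gen_carr)
  also have "\<dots> = tscal c (std F g)"
    by (simp add: std_def tens.scale_right_distrib tens.scale_sum_right)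
  finally have "eqv (tscal c u) (std (\<lambda>i j. ps_smult c (F i j)) (\<lambda>k. ps_smult c (g k)))"
    using eqv_trans[OF eqv_tscal[OF u]] eqv_sym by blast
  then show ?thesis unfolding std_like_def by blast
qed

lemma std_like_0: "std_like 0"
proof -
  have "eqv (std (\<lambda>i j. 0) (\<lambda>k. 0)) ((\<Sum>i\<in>(UNIV::ix set). \<Sum>j\<in>(UNIV::ix set). 0) + (\<Sum>k\<in>(UNIV::ix set). 0))"
    unfolding std_def by (intro eqv_add eqv_sum eqv_0 re_gen_carr)
  then have "eqv 0 (std (\<lambda>i j. 0) (\<lambda>k. 0))" using eqv_sym by simp
  then show ?thesis unfolding std_like_def by blast
qed

text \<open>The padding entries \<open>tens r 0\<close> are basis vectors of the free space, so they
  disappear only modulo the relations.\<close>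

lemma std_like_gen: "std_like (tens (re_a p q) f)" "std_like (tens (re_b p) f)"
proof -
  have "eqv (\<Sum>k\<in>UNIV. tens (re_b k) 0) (\<Sum>k\<in>(UNIV :: ix set). 0 :: ('a, 'a re_amb) tens)"
      "eqv (\<Sum>i\<in>UNIV. \<Sum>j\<in>UNIV. tens (re_a i j) 0) (\<Sum>i\<in>(UNIV :: ix set). \<Sum>j\<in>(UNIV :: ix set). 0 :: ('a, 'a re_amb) tens)"
    by (intro eqv_sum eqv_0 re_gen_carr)+
  then have 0: "eqv (\<Sum>k\<in>UNIV. tens (re_b k) 0) (0 :: ('a, 'a re_amb) tens)"
      "eqv (\<Sum>i\<in>UNIV. \<Sum>j\<in>UNIV. tens (re_a i j) 0) (0 :: ('a, 'a re_amb) tens)"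
    by simp_all
  have "eqv (std (\<lambda>i j. if i = p \<and> j = q then f else 0) (\<lambda>k. 0))
     ((\<Sum>i\<in>UNIV. \<Sum>j\<in>UNIV. if i = p \<and> j = q then tens (re_a i j) f else 0) + 0)"
    unfolding std_def by (intro eqv_add eqv_sum 0) (auto intro: eqv_0 re_gen_carr)
  also have "\<dots> = (\<Sum>i\<in>UNIV. if i = p then (\<Sum>j\<in>UNIV. if j = q then tens (re_a i j) f else 0) else 0)"
    unfolding add_0_right by (intro sum.cong) auto
  also have "\<dots> = tens (re_a p q) f" by simp
  finally show "std_like (tens (re_a p q) f)" unfolding std_like_def using eqv_sym by blast
  have "eqv (std (\<lambda>i j. 0) (\<lambda>k. if k = p then f else 0))
     (0 + (\<Sum>k\<in>UNIV. if k = p then tens (re_b k) f else 0))"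
    unfolding std_def by (intro eqv_add eqv_sum 0) (auto intro: eqv_0 re_gen_carr)
  also have "\<dots> = tens (re_b p) f" by simp
  finally show "std_like (tens (re_b p) f)" unfolding std_like_def using eqv_sym by blast
qed

text \<open>Modulo the relations \<partial> passes from the module element to the power series as
  minus a derivative. The power series changes on the way, so the induction quantifies over
  it.\<close>

lemma std_like_tens:
  assumes "r \<in> re_carr"
  shows "std_like (tens r f)"
proof -
  have "r \<in> re_carr \<and> (\<forall>f. std_like (tens r f))"
    using assms[unfolded re_carr_span]
  proof (induction r rule: re_span_induct)
    case (base g)
    then show ?case by (auto simp: std_like_gen re_gen_carr)
  next
    case zero
    show ?case by (intro conjI allI std_like_eqv[OF eqv_0(2) std_like_0] re_carr_simps)
  next
    case (add x y)
    then show ?case by (intro conjI allI std_like_eqv[OF eqv_gens(1) std_like_add] re_carr_simps) auto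
  next
    case (const c x)
    then show ?case by (intro conjI allI std_like_eqv[OF eqv_gens(3) std_like_tscal] re_carr_simps) auto
  next
    case (var i x)
    have e: "eqv (tens (re_act (pvar i) x) f) (tscal (- 1) (tens x (ps_deriv i f)))" for f
      using eqv_gens(5)[of x i f] var by simp
    show ?case by (intro conjI allI std_like_eqv[OF e std_like_tscal]) (use var in \<open>simp_all add: re_carr_simps\<close>)
  qed
  then show ?thesis by blast
qed

lemma std_like_carr:
  assumes "u \<in> tcarr"
  shows "std_like u"
proof -
  have "std_like (\<Sum>K\<in>A. tscal (Poly_Mapping.lookup u K) (tens (fst K) (snd K)))" if "A \<subseteq> Poly_Mapping.keys u" for A
    using that
  proof (induction A rule: infinite_finite_induct)
    case (insert K A)
    then have "fst K \<in> re_carr" using assms by (auto simp: tens_on_def)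
    then show ?case using insert by (auto intro!: std_like_add std_like_tscal std_like_tens)
  qed (auto simp: std_like_0)
  from this[OF order_refl] show ?thesis using tens_expand[of u] by simp
qed

lemma std_carr: "std F g \<in> tcarr"
  unfolding std_def by (intro tens_on_closed tens_on_sum re_gen_carr)

text \<open>The even part is minus the divergence of the antisymmetrised \<open>F\<close>, the odd
  part minus the exterior derivative of the 1-form \<open>g\<close>. This is where the Poincare
  lemma meets the tensor product.\<close>

lemma tmap_std:
  "fst (tmap (std F g)) t = (\<Sum>j\<in>UNIV. ps_deriv j (F t j)) - (\<Sum>i\<in>UNIV. ps_deriv i (F i t))"
  "snd (tmap (std F g)) p q = ps_deriv q (g p) - ps_deriv p (g q)"
proof -
  have "fst (tmap (std F g)) t = (\<Sum>i\<in>UNIV. \<Sum>j\<in>UNIV. fst (phi (re_a i j) (F i j)) t)"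
    by (simp add: std_def tmap_add tmap_sum tmap_tens fst_sum sum_apply fun_apply(1,2) phi_b)
  also have "\<dots> = (\<Sum>j\<in>UNIV. \<Sum>i\<in>UNIV. ps_smult (of_bool (t = i)) (ps_deriv j (F i j))) - (\<Sum>i\<in>UNIV. \<Sum>j\<in>UNIV. ps_smult (of_bool (t = j)) (ps_deriv i (F i j)))"
    unfolding phi_a sum_subtractf by (subst sum.swap) (rule refl)
  also have "\<dots> = (\<Sum>j\<in>UNIV. ps_deriv j (F t j)) - (\<Sum>i\<in>UNIV. ps_deriv i (F i t))"
    unfolding sum_smult_of_bool ..
  finally show "fst (tmap (std F g)) t = (\<Sum>j\<in>UNIV. ps_deriv j (F t j)) - (\<Sum>i\<in>UNIV. ps_deriv i (F i t))" .
  have "snd (tmap (std F g)) p q = (\<Sum>k\<in>UNIV. snd (phi (re_b k) (g k)) p q)"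
    by (simp add: std_def tmap_add tmap_sum tmap_tens snd_sum sum_apply fun_apply(1,2) phi_a(2))
  also have "\<dots> = ps_deriv q (g p) - ps_deriv p (g q)"
    unfolding phi_b sum_subtractf sum_smult_of_bool ..
  finally show "snd (tmap (std F g)) p q = ps_deriv q (g p) - ps_deriv p (g q)" .
qed

lemma re_cyclic: "re_act (pvar k) (re_a i j) + re_act (pvar i) (re_a j k) + re_act (pvar j) (re_a k i) = 0"
proof (rule prod_eqI; intro ext)
  fix t
  show "fst (re_act (pvar k) (re_a i j) + re_act (pvar i) (re_a j k) + re_act (pvar j) (re_a k i)) t = fst 0 t"
    by (simp add: fun_apply re_act_simps re_a_simps algebra_simps)
  fix p q
  show "snd (re_act (pvar k) (re_a i j) + re_act (pvar i) (re_a j k) + re_act (pvar j) (re_a k i)) p q = snd 0 p q"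
    by (simp add: fun_apply re_act_simps re_a_simps)
qed

lemma re_b_sum: "(\<Sum>k\<in>UNIV. re_act (pvar k) (re_b k)) = 0"
proof (rule prod_eqI; intro ext)
  fix t
  show "fst (\<Sum>k\<in>UNIV. re_act (pvar k) (re_b k)) t = fst 0 t"
    by (simp add: fst_sum sum_apply fun_apply re_act_simps re_b_simps)
  fix p q
  have "snd (\<Sum>k\<in>UNIV. re_act (pvar k) (re_b k)) p q
     = (\<Sum>k\<in>UNIV. of_bool (k = q) * (pvar k * pvar p)) - (\<Sum>k\<in>UNIV. of_bool (k = p) * (pvar k * pvar q))"
    unfolding snd_sum sum_apply re_act_simps re_b_simps eq_commute[of q] eq_commute[of p]
    by (simp add: algebra_simps sum_subtractf)
  also have "\<dots> = 0" unfolding sum_of_bool by (simp add: mult.commute)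
  finally show "snd (\<Sum>k\<in>UNIV. re_act (pvar k) (re_b k)) p q = snd 0 p q" by (simp add: fun_apply)
qed

lemma re_a_swap: "re_a j i = re_act (pconst (- 1)) (re_a i j)"
  by (rule re_amb_eqI) (simp add: re_proj_simps pconst_minus re_a_def)

lemma eqv_cancel:
  assumes "eqv (tscal c u) 0" "c \<noteq> 0"
  shows "eqv u 0"
  using eqv_tscal[OF assms(1), of "1 / c"] assms(2) by simp

lemma sum_rotate:
  fixes f :: "ix \<Rightarrow> ix \<Rightarrow> ix \<Rightarrow> 'a::comm_monoid_add"
  shows "(\<Sum>i\<in>UNIV. \<Sum>j\<in>UNIV. \<Sum>k\<in>UNIV. f k i j) = (\<Sum>i\<in>UNIV. \<Sum>j\<in>UNIV. \<Sum>k\<in>UNIV. f i j k)"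
proof -
  have "(\<Sum>i\<in>UNIV. \<Sum>j\<in>UNIV. \<Sum>k\<in>UNIV. f k i j) = (\<Sum>i\<in>UNIV. \<Sum>k\<in>UNIV. \<Sum>j\<in>UNIV. f k i j)"
    by (intro sum.cong refl sum.swap)
  also have "\<dots> = (\<Sum>k\<in>UNIV. \<Sum>i\<in>UNIV. \<Sum>j\<in>UNIV. f k i j)" by (rule sum.swap)
  finally show ?thesis .
qed

text \<open>The factors 2 and 3 arise from symmetrising over \<open>(i, j)\<close> and cyclically over \<open>(i, j, k)\<close>.\<close>

lemma kernel_even:
  assumes "\<And>t. (\<Sum>j\<in>UNIV. ps_deriv j (F t j)) = (\<Sum>i\<in>UNIV. ps_deriv i (F i t))"
  shows "eqv (\<Sum>i\<in>UNIV. \<Sum>j\<in>UNIV. tens (re_a i j) (F i j)) 0"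
proof -
  define F' where "F' i j = F i j - F j i" for i j
  have anti: "F' j i = - F' i j" for i j by (simp add: F'_def)
  have div: "(\<Sum>i\<in>UNIV. ps_deriv i (F' i j)) = 0" for j
    by (simp add: F'_def ps_deriv_diff sum_subtractf assms)
  obtain G where G: "\<And>i j. F' i j = (\<Sum>k\<in>UNIV. ps_deriv k (G k i j))" and cyc: "\<And>i j k. G k i j = G i j k"
    using poincare_div_2[of F', OF anti div] by blast
  let ?X = "\<Sum>i\<in>UNIV. \<Sum>j\<in>UNIV. tens (re_a i j) (F i j)"
  let ?Y = "\<Sum>i\<in>UNIV. \<Sum>j\<in>UNIV. tens (re_a i j) (F' i j)"
  let ?Z = "\<Sum>i\<in>UNIV. \<Sum>j\<in>UNIV. \<Sum>k\<in>UNIV. tens (re_act (pvar k) (re_a i j)) (G k i j)"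
  have neg: "eqv (tens (re_a i j) (- F j i)) (tens (re_a j i) (F j i))" for i j
  proof -
    have "eqv (tens (re_a i j) (ps_smult (- 1) (F j i))) (tscal (- 1) (tens (re_a i j) (F j i)))"
      by (rule eqv_gens(4)[OF re_gen_carr(1)])
    also have "eqv \<dots> (tens (re_act (pconst (- 1)) (re_a i j)) (F j i))"
      by (rule eqv_sym[OF eqv_gens(3)[OF re_gen_carr(1)]])
    finally show ?thesis by (simp add: ps_smult_uminus flip: re_a_swap[of j i])
  qed
  \<comment> \<open>Since \<open>a_ji = - a_ij\<close>, replacing \<open>F\<close> by its
    antisymmetrisation doubles the class.\<close>
  have "eqv ?Y (\<Sum>i\<in>UNIV. \<Sum>j\<in>UNIV. tens (re_a i j) (F i j) + tens (re_a j i) (F j i))"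
    unfolding F'_def diff_conv_add_uminus
    by (intro eqv_sum eqv_trans[OF eqv_gens(2)[OF re_gen_carr(1)]] eqv_add eqv_refl neg)
  also have "\<dots> = ?X + (\<Sum>i\<in>UNIV. \<Sum>j\<in>UNIV. tens (re_a j i) (F j i))"
    by (simp add: sum.distrib)
  also have "(\<Sum>i\<in>UNIV. \<Sum>j\<in>UNIV. tens (re_a j i) (F j i)) = ?X" by (rule sum.swap)
  also have "?X + ?X = tscal 2 ?X"
    by (simp only: one_add_one[symmetric] tens.scale_left_distrib tens.scale_one)
  finally have YX: "eqv ?Y (tscal 2 ?X)" .
  \<comment> \<open>Integration by parts: the derivative moves from the trivector \<open>G\<close>
    back onto the generator.\<close>
  have "eqv ?Y (\<Sum>i\<in>UNIV. \<Sum>j\<in>UNIV. \<Sum>k\<in>UNIV. tens (re_a i j) (ps_deriv k (G k i j)))"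
    unfolding G by (intro eqv_sum eqv_tens_sum re_gen_carr)
  also have "eqv \<dots> (\<Sum>i\<in>UNIV. \<Sum>j\<in>UNIV. \<Sum>k\<in>UNIV. - tens (re_act (pvar k) (re_a i j)) (G k i j))"
  proof (intro eqv_sum)
    fix i j k
    show "eqv (tens (re_a i j) (ps_deriv k (G k i j))) (- tens (re_act (pvar k) (re_a i j)) (G k i j))"
      using eqv_uminus[OF eqv_gens(5)[OF re_gen_carr(1), of k i j "G k i j"]] eqv_sym by simp
  qed
  also have "\<dots> = - ?Z" by (simp add: sum_negf)
  finally have YZ: "eqv ?Y (- ?Z)" .
  have c: "re_act (pvar k) (re_a i j) \<in> re_carr" for i j k
    by (intro re_carr_simps re_gen_carr)
  \<comment> \<open>A cyclic renaming of the summation indices rotates the generator while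
    \<open>G\<close> stays the same, so \<open>?Z\<close> has three forms with a common power
    series.\<close>
  have Z1: "?Z = (\<Sum>i\<in>UNIV. \<Sum>j\<in>UNIV. \<Sum>k\<in>UNIV. tens (re_act (pvar i) (re_a j k)) (G k i j))"
  proof -
    have "?Z = (\<Sum>i\<in>UNIV. \<Sum>j\<in>UNIV. \<Sum>k\<in>UNIV. tens (re_act (pvar i) (re_a j k)) (G i j k))"
      by (rule sum_rotate)
    also have "\<dots> = (\<Sum>i\<in>UNIV. \<Sum>j\<in>UNIV. \<Sum>k\<in>UNIV. tens (re_act (pvar i) (re_a j k)) (G k i j))"
      by (intro sum.cong refl arg_cong2[where f = tens] cyc[symmetric])
    finally show ?thesis .
  qed
  also have "\<dots> = (\<Sum>i\<in>UNIV. \<Sum>j\<in>UNIV. \<Sum>k\<in>UNIV. tens (re_act (pvar j) (re_a k i)) (G i j k))"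
    by (rule sum_rotate)
  also have "\<dots> = (\<Sum>i\<in>UNIV. \<Sum>j\<in>UNIV. \<Sum>k\<in>UNIV. tens (re_act (pvar j) (re_a k i)) (G k i j))"
    by (intro sum.cong refl arg_cong2[where f = tens] cyc[symmetric])
  finally have Z2: "?Z = (\<Sum>i\<in>UNIV. \<Sum>j\<in>UNIV. \<Sum>k\<in>UNIV. tens (re_act (pvar j) (re_a k i)) (G k i j))" .
  have "tscal 3 ?Z = tscal (1 + 1 + 1) ?Z" by simp
  also have "\<dots> = ?Z + ?Z + ?Z" by (simp only: tens.scale_left_distrib tens.scale_one)
  also have "\<dots> = (\<Sum>i\<in>UNIV. \<Sum>j\<in>UNIV. \<Sum>k\<in>UNIV. tens (re_act (pvar k) (re_a i j)) (G k i j)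
      + tens (re_act (pvar i) (re_a j k)) (G k i j) + tens (re_act (pvar j) (re_a k i)) (G k i j))"
    unfolding sum.distrib Z1[symmetric] Z2[symmetric] ..
  finally have Z3: "tscal 3 ?Z = (\<Sum>i\<in>UNIV. \<Sum>j\<in>UNIV. \<Sum>k\<in>UNIV. tens (re_act (pvar k) (re_a i j)) (G k i j)
      + tens (re_act (pvar i) (re_a j k)) (G k i j) + tens (re_act (pvar j) (re_a k i)) (G k i j))" .
  \<comment> \<open>With equal power series the three module elements may be added, and their sum is
    zero by \<open>re_cyclic\<close>.\<close>
  have "eqv (tens (re_act (pvar k) (re_a i j)) (G k i j)
      + tens (re_act (pvar i) (re_a j k)) (G k i j) + tens (re_act (pvar j) (re_a k i)) (G k i j)) 0" for i j k
  proof -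
    have "eqv (tens 0 (G k i j)) (tens (re_act (pvar k) (re_a i j) + re_act (pvar i) (re_a j k)) (G k i j) + tens (re_act (pvar j) (re_a k i)) (G k i j))"
      unfolding re_cyclic[of k i j, symmetric] by (intro eqv_gens(1) re_carr_simps c)
    also have "eqv \<dots> (tens (re_act (pvar k) (re_a i j)) (G k i j)
      + tens (re_act (pvar i) (re_a j k)) (G k i j) + tens (re_act (pvar j) (re_a k i)) (G k i j))"
      by (intro eqv_add eqv_refl eqv_gens(1) c)
    finally show ?thesis using eqv_0(2) eqv_sym eqv_trans by blast
  qed
  then have "eqv (tscal 3 ?Z) (\<Sum>i\<in>(UNIV::ix set). \<Sum>j\<in>(UNIV::ix set). \<Sum>k\<in>(UNIV::ix set). 0)"
    unfolding Z3 by (intro eqv_sum)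
  then have "eqv ?Z 0" using eqv_cancel[of 3 ?Z] by simp
  then have "eqv (- ?Z) 0" using eqv_uminus[of ?Z 0] by simp
  then have "eqv (tscal 2 ?X) 0"
    using eqv_trans[OF eqv_trans[OF eqv_sym[OF YX] YZ]] by blast
  then show ?thesis by (rule eqv_cancel) simp
qed

lemma kernel_odd:
  assumes "\<And>p q. ps_deriv q (g p) = ps_deriv p (g q)"
  shows "eqv (\<Sum>k\<in>UNIV. tens (re_b k) (g k)) 0"
proof -
  obtain h where h: "\<And>k. g k = ps_deriv k h" using poincare_1[of g] assms by blast
  have "eqv (\<Sum>k\<in>UNIV. tens (re_b k) (g k)) (\<Sum>k\<in>UNIV. - tens (re_act (pvar k) (re_b k)) h)"
  proof (intro eqv_sum)
    fix k
    show "eqv (tens (re_b k) (g k)) (- tens (re_act (pvar k) (re_b k)) h)"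
      unfolding h using eqv_uminus[OF eqv_gens(5)[OF re_gen_carr(2), of k k h]] eqv_sym by simp
  qed
  also have "\<dots> = - (\<Sum>k\<in>UNIV. tens (re_act (pvar k) (re_b k)) h)" by (simp add: sum_negf)
  also have "eqv \<dots> (- tens 0 h)"
  proof -
    have "eqv (tens (\<Sum>k\<in>UNIV. re_act (pvar k) (re_b k)) h) (\<Sum>k\<in>UNIV. tens (re_act (pvar k) (re_b k)) h)"
      by (rule eqv_sum_tens[of UNIV "\<lambda>k. re_act (pvar k) (re_b k)", THEN conjunct2]) (intro re_carr_simps(3) re_gen_carr(2))
    then show ?thesis unfolding re_b_sum by (rule eqv_uminus[OF eqv_sym])
  qed
  also have "eqv \<dots> (- 0)" by (intro eqv_uminus eqv_0)
  finally show ?thesis by simp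
qed

text \<open>On a representative supported on the generators the even and odd conditions decouple,
  and each half is a relation by itself.\<close>

lemma kernel:
  assumes "u \<in> tcarr" "tmap u = 0"
  shows "u \<in> rel"
proof -
  obtain F g where u: "eqv u (std F g)" using std_like_carr[OF assms(1)] by (auto simp: std_like_def)
  then have "tmap (std F g) = 0"
    using rel_kernel[of "u - std F g"] assms(2) by (simp add: eqv_def tmap_diff)
  then have "(\<Sum>j\<in>UNIV. ps_deriv j (F t j)) - (\<Sum>i\<in>UNIV. ps_deriv i (F i t)) = 0"
      "ps_deriv q (g p) - ps_deriv p (g q) = 0" for t p q
    using tmap_std(1)[of F g t] tmap_std(2)[of F g p q] by (simp_all add: fun_apply(2))
  then have "eqv (std F g) (0 + 0)"
    unfolding std_def by (intro eqv_add kernel_even kernel_odd) simp_all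
  with u have "eqv u 0" using eqv_trans by simp
  then show ?thesis by (simp add: eqv_def)
qed

text \<open>A section of \<open>tmap\<close>. Both index orders of the bivector contribute minus the
  field, hence the factor -1/2; the minus sign at the potential undoes the sign of the exterior
  derivative in \<open>tmap_std\<close>.\<close>

definition lift_e :: "'k::field_char_0 vfield \<times> 'k form2 \<Rightarrow> ('k, 'k re_amb) tens" where
  "lift_e x = std (\<lambda>i j. ps_smult (- 1 / 2) (bivector (fst x) i j)) (\<lambda>k. - potential (snd x) k)"

lemma tmap_lift:
  assumes "x \<in> e_carr"
  shows "tmap (lift_e x) = x"
proof (rule e_eqI)
  fix t
  have "(\<Sum>j\<in>UNIV. ps_deriv j (bivector (fst x) t j)) = - fst x t"
    unfolding bivector_anti[of _ t] ps_deriv_uminus sum_negf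
    using poincare_div_1[of "fst x" t] assms by (simp add: e_carr_def mem_Times_iff)
  then show "fst (tmap (lift_e x)) t = fst x t"
    unfolding lift_e_def tmap_std ps_deriv_smult ps_smult_sum[symmetric]
    using poincare_div_1[of "fst x" t] assms
    by (simp add: e_carr_def mem_Times_iff fun_eq_iff fun_apply)
next
  fix p q
  show "snd (tmap (lift_e x)) p q = snd x p q"
    unfolding lift_e_def tmap_std ps_deriv_uminus
    using poincare_2[of "snd x" p q] assms by (simp add: e_carr_def mem_Times_iff)
qed

lemma lift_carr: "lift_e x \<in> tcarr"
  unfolding lift_e_def by (rule std_carr)

section \<open>Quotients\<close>

text \<open>An algebra \<open>G\<close> need not satisfy any axioms: it is enough that the cosets of \<open>I\<close> are the fibres
  of a homomorphism \<open>\<theta>\<close> onto \<open>H\<close>.\<close>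

locale presentation =
  fixes G :: "('k, 'a) superalgebra" and I :: "'a set" and H :: "('k, 'b) superalgebra" and \<theta> :: "'a \<Rightarrow> 'b"
  assumes fibre: "x \<in> carr G \<Longrightarrow> coset G I x = {y \<in> carr G. \<theta> y = \<theta> x}"
    and surj: "\<theta> ` carr G = carr H"
    and add_carr: "x \<in> carr G \<Longrightarrow> y \<in> carr G \<Longrightarrow> add G x y \<in> carr G"
    and add_hom: "x \<in> carr G \<Longrightarrow> y \<in> carr G \<Longrightarrow> \<theta> (add G x y) = add H (\<theta> x) (\<theta> y)"
    and scal_carr: "x \<in> carr G \<Longrightarrow> scal G c x \<in> carr G"
    and scal_hom: "x \<in> carr G \<Longrightarrow> \<theta> (scal G c x) = scal H c (\<theta> x)"
    and brk_carr: "x \<in> carr G \<Longrightarrow> y \<in> carr G \<Longrightarrow> brk G x y \<in> carr G"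
    and brk_hom: "x \<in> carr G \<Longrightarrow> y \<in> carr G \<Longrightarrow> \<theta> (brk G x y) = brk H (\<theta> x) (\<theta> y)"
    and part_carr: "part G p \<subseteq> carr G" and part_hom: "\<theta> ` part G p = part H p"
    and gr_carr: "gr G n \<subseteq> carr G" and gr_hom: "\<theta> ` gr G n = gr H n"
    and nbh_carr: "nbh G n \<subseteq> carr G" and nbh_hom: "\<theta> ` nbh G n \<subseteq> nbh H n"
begin

definition induced :: "'a set \<Rightarrow> 'b" where
  "induced X = \<theta> (SOME x. x \<in> X)"

lemma coset_self: "x \<in> carr G \<Longrightarrow> x \<in> coset G I x"
  by (simp add: fibre)

lemma induced_coset: "x \<in> carr G \<Longrightarrow> induced (coset G I x) = \<theta> x"
  unfolding induced_def using someI[of "\<lambda>y. y \<in> coset G I x", OF coset_self] by (simp add: fibre)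

lemma coset_eq_iff: "x \<in> carr G \<Longrightarrow> y \<in> carr G \<Longrightarrow> coset G I x = coset G I y \<longleftrightarrow> \<theta> x = \<theta> y"
  by (auto simp: fibre)

lemma carr_quot: "X \<in> carr (quot G I) \<longleftrightarrow> (\<exists>x\<in>carr G. X = coset G I x)"
  by (auto simp: quot_def)

text \<open>If \<open>f\<close> respects the fibres of \<theta>, all cosets in the union coincide.
  Operations on the quotient, defined as unions over representatives, thereby become
  computable.\<close>

lemma UN_coset:
  assumes "x \<in> carr G" "\<And>x'. x' \<in> carr G \<Longrightarrow> \<theta> x' = \<theta> x \<Longrightarrow> f x' \<in> carr G \<and> \<theta> (f x') = \<theta> (f x)"
  shows "(\<Union>x'\<in>coset G I x. coset G I (f x')) = coset G I (f x)"
proof -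
  have "coset G I (f x') = coset G I (f x)" if "x' \<in> coset G I x" for x'
    using assms(1) assms(2)[of x'] assms(2)[of x] that by (subst coset_eq_iff) (auto simp: fibre)
  then show ?thesis using coset_self[OF assms(1)] by blast
qed

lemma add_quot:
  assumes "x \<in> carr G" "y \<in> carr G"
  shows "add (quot G I) (coset G I x) (coset G I y) = coset G I (add G x y)"
proof -
  have "add (quot G I) (coset G I x) (coset G I y) = (\<Union>x'\<in>coset G I x. \<Union>y'\<in>coset G I y. coset G I (add G x' y'))"
    by (simp add: quot_def)
  also have "\<dots> = (\<Union>x'\<in>coset G I x. coset G I (add G x' y))"
    by (intro SUP_cong refl UN_coset[OF assms(2)]) (use assms in \<open>auto simp: fibre add_carr add_hom\<close>)
  also have "\<dots> = coset G I (add G x y)"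
    using assms by (intro UN_coset) (auto simp: add_carr add_hom)
  finally show ?thesis .
qed

lemma brk_quot:
  assumes "x \<in> carr G" "y \<in> carr G"
  shows "brk (quot G I) (coset G I x) (coset G I y) = coset G I (brk G x y)"
proof -
  have "brk (quot G I) (coset G I x) (coset G I y) = (\<Union>x'\<in>coset G I x. \<Union>y'\<in>coset G I y. coset G I (brk G x' y'))"
    by (simp add: quot_def)
  also have "\<dots> = (\<Union>x'\<in>coset G I x. coset G I (brk G x' y))"
    by (intro SUP_cong refl UN_coset[OF assms(2)]) (use assms in \<open>auto simp: fibre brk_carr brk_hom\<close>)
  also have "\<dots> = coset G I (brk G x y)"
    using assms by (intro UN_coset) (auto simp: brk_carr brk_hom)
  finally show ?thesis .
qed

lemma scal_quot:
  assumes "x \<in> carr G"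
  shows "scal (quot G I) c (coset G I x) = coset G I (scal G c x)"
proof -
  have "scal (quot G I) c (coset G I x) = (\<Union>x'\<in>coset G I x. coset G I (scal G c x'))"
    by (simp add: quot_def)
  also have "\<dots> = coset G I (scal G c x)"
    using assms by (intro UN_coset) (auto simp: scal_carr scal_hom)
  finally show ?thesis .
qed

lemma quot_closed:
  "X \<in> carr (quot G I) \<Longrightarrow> Y \<in> carr (quot G I) \<Longrightarrow> add (quot G I) X Y \<in> carr (quot G I)"
  "X \<in> carr (quot G I) \<Longrightarrow> Y \<in> carr (quot G I) \<Longrightarrow> brk (quot G I) X Y \<in> carr (quot G I)"
  "X \<in> carr (quot G I) \<Longrightarrow> scal (quot G I) c X \<in> carr (quot G I)"
  unfolding carr_quot by (elim bexE; simp only: add_quot brk_quot scal_quot; blast intro: add_carr brk_carr scal_carr)+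

lemma induced_hom:
  "X \<in> carr (quot G I) \<Longrightarrow> Y \<in> carr (quot G I) \<Longrightarrow> induced (add (quot G I) X Y) = add H (induced X) (induced Y)"
  "X \<in> carr (quot G I) \<Longrightarrow> Y \<in> carr (quot G I) \<Longrightarrow> induced (brk (quot G I) X Y) = brk H (induced X) (induced Y)"
  "X \<in> carr (quot G I) \<Longrightarrow> induced (scal (quot G I) c X) = scal H c (induced X)"
  unfolding carr_quot
  by (auto simp: add_quot brk_quot scal_quot induced_coset add_carr brk_carr scal_carr add_hom brk_hom scal_hom)

lemma induced_bij: "bij_betw induced (carr (quot G I)) (carr H)"
proof -
  have "inj_on induced (carr (quot G I))"
  proof (rule inj_onI)
    fix X Y assume XY: "X \<in> carr (quot G I)" "Y \<in> carr (quot G I)" "induced X = induced Y"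
    then obtain x y where "x \<in> carr G" "y \<in> carr G" "X = coset G I x" "Y = coset G I y"
      unfolding carr_quot by blast
    with XY(3) show "X = Y" by (simp only: induced_coset coset_eq_iff)
  qed
  moreover have "induced ` carr (quot G I) = carr H"
    unfolding surj[symmetric] by (force simp: carr_quot induced_coset image_iff)
  ultimately show ?thesis by (simp add: bij_betw_def)
qed

lemma induced_image: "A \<subseteq> carr G \<Longrightarrow> induced ` coset G I ` A = \<theta> ` A"
  unfolding image_image by (intro image_cong refl) (auto simp: induced_coset)

lemma quot_sub:
  "part (quot G I) p \<subseteq> carr (quot G I)" "gr (quot G I) n \<subseteq> carr (quot G I)" "nbh (quot G I) n \<subseteq> carr (quot G I)"
  by (simp_all add: quot_def image_mono part_carr gr_carr nbh_carr)

lemma induced_part: "induced ` part (quot G I) p = part H p"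
  using induced_image[OF part_carr] part_hom by (simp add: quot_def)

lemma induced_gr: "induced ` gr (quot G I) n = gr H n"
  using induced_image[OF gr_carr] gr_hom by (simp add: quot_def)

lemma induced_nbh: "induced ` nbh (quot G I) n \<subseteq> nbh H n"
  using induced_image[OF nbh_carr] nbh_hom by (simp add: quot_def)

lemma iso: "graded_superalgebra_iso (quot G I) H induced"
  unfolding graded_superalgebra_iso_def by (auto simp: induced_bij induced_hom induced_part induced_gr)

lemma continuous: "continuous_linear (quot G I) H induced"
  unfolding continuous_linear_def using induced_nbh by blast

end

section \<open>Gradations\<close>

text \<open>With \<open>Q\<close> an equation this is homogeneity, with \<open>Q\<close> a lower
  bound it is membership in a neighbourhood; both are handled by the same lemmas.\<close>

definition e_deg :: "(int \<Rightarrow> bool) \<Rightarrow> 'k::field_char_0 vfield \<times> 'k form2 \<Rightarrow> bool" where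
  "e_deg Q x \<longleftrightarrow> (\<forall>i M. fst x i M \<noteq> 0 \<longrightarrow> Q (2 * int (mdeg M) - 2)) \<and>
     (\<forall>i j M. snd x i j M \<noteq> 0 \<longrightarrow> Q (2 * int (mdeg M) - 1))"

lemma e_deg_alt: "e_deg Q x \<longleftrightarrow> (\<forall>i M. \<not> Q (2 * int (mdeg M) - 2) \<longrightarrow> fst x i M = 0) \<and>
     (\<forall>i j M. \<not> Q (2 * int (mdeg M) - 1) \<longrightarrow> snd x i j M = 0)"
  unfolding e_deg_def by blast

lemma e_deg_closed: "e_deg Q 0" "e_deg Q x \<Longrightarrow> e_deg Q y \<Longrightarrow> e_deg Q (x + y)" "e_deg Q x \<Longrightarrow> e_deg Q (e_scal c x)"
  unfolding e_deg_alt by (auto simp: fun_apply e_scal_simps)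

lemma E_simps:
  "carr E_5_10 = e_carr" "add E_5_10 = (+)" "scal E_5_10 = e_scal" "brk E_5_10 = e_brk"
  "part E_5_10 p = {x \<in> e_carr. if p = 0 then snd x = 0 else fst x = 0}"
  "gr E_5_10 n = {x \<in> e_carr. e_deg (\<lambda>m. m = n) x}"
  "nbh E_5_10 n = {x \<in> e_carr. e_deg (\<lambda>m. n \<le> m) x}"
  by (auto simp: E_5_10_def e_carr_def e_scal_def e_brk_def e_deg_def S5_closed Omega2_closed fun_eq_iff)

lemma phi_single: "phi (re_act (Poly_Mapping.single J 1) r) f = e_scal ((- 1) ^ mdeg J) (phi r (pd J f))"
proof (induction J arbitrary: f rule: mexp_induct)
  case zero
  have "Poly_Mapping.single 0 1 = (1 :: 'a mpol)" by simp
  then show ?case by (simp only: re_act_0 pd_0 mdeg_simps power_0 e_scal_mult)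
next
  case (step i J)
  have "phi (re_act (Poly_Mapping.single (unit_mexp i + J) 1) r) f = - phi (re_act (Poly_Mapping.single J 1) r) (ps_deriv i f)"
    unfolding pvar_single[symmetric] re_act_mult[symmetric] phi_var ..
  also have "\<dots> = - e_scal ((- 1) ^ mdeg J) (phi r (pd J (ps_deriv i f)))"
    unfolding step ..
  also have "\<dots> = e_scal ((- 1) ^ mdeg (unit_mexp i + J)) (phi r (pd (unit_mexp i + J) f))"
    unfolding pd_unit_add e_scal_minus[symmetric] e_scal_mult mdeg_simps by simp
  finally show ?case .
qed

text \<open>Degree components are spaces over F only, since \<partial> changes the degree.\<close>

interpretation re_k: module "\<lambda>c. re_act (pconst c)"
  by unfold_locales (simp_all add: re_act_add re_act_mult pconst_add pconst_mult)

definition re_gr :: "int \<Rightarrow> 'k::field_char_0 re_amb set" where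
  "re_gr n = re_k.span
       ({re_act (Poly_Mapping.single J 1) (re_a i j) | J i j. - 4 - 2 * int (mdeg J) = n} \<union>
        {re_act (Poly_Mapping.single J 1) (re_b k) | J k. - 3 - 2 * int (mdeg J) = n})"

lemma cgr_RE: "cgr RE = re_gr"
  by (simp add: RE_5_10_def RE_with_bracket_def re_gr_def fun_eq_iff)

lemma re_gr_carr: "re_gr n \<subseteq> re_carr"
  unfolding re_gr_def
proof (rule re_k.span_minimal)
  show "re_k.subspace re_carr" by (simp add: re_k.subspace_def re_carr_simps)
qed (use re_carr_simps(3) re_gen_carr in blast)

lemma re_gen_gr:
  "re_a i j \<in> (re_gr (- 4) :: 'k::field_char_0 re_amb set)" "re_b k \<in> (re_gr (- 3) :: 'k re_amb set)"
proof -
  have one: "Poly_Mapping.single 0 1 = (1 :: 'k mpol)" by simp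
  have z: "- 4 - 2 * int (mdeg 0) = - 4" "- 3 - 2 * int (mdeg 0) = - 3"
    by (subst mdeg_simps(1), simp)+
  have "re_act (Poly_Mapping.single 0 1) (re_a i j :: 'k re_amb) \<in> re_gr (- 4)"
    unfolding re_gr_def by (rule re_k.span_base, rule UnI1, rule CollectI, rule exI[of _ 0], rule exI[of _ i],
        rule exI[of _ j], rule conjI[OF refl], rule z)
  then show "re_a i j \<in> (re_gr (- 4) :: 'k re_amb set)" by (simp only: one re_act_0)
  have "re_act (Poly_Mapping.single 0 1) (re_b k :: 'k re_amb) \<in> re_gr (- 3)"
    unfolding re_gr_def by (rule re_k.span_base, rule UnI2, rule CollectI, rule exI[of _ 0], rule exI[of _ k],
        rule conjI[OF refl], rule z)
  then show "re_b k \<in> (re_gr (- 3) :: 'k re_amb set)" by (simp only: one re_act_0)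
qed

lemma pd_support: "pd J f M \<noteq> 0 \<Longrightarrow> f (M + J) \<noteq> 0"
  by (auto simp: pd_def)

lemma ps_deriv_support: "ps_deriv i f M \<noteq> 0 \<Longrightarrow> f (M + unit_mexp i) \<noteq> 0"
  by (auto simp: ps_deriv_def)

text \<open>One derivative lowers the degree m of \<open>f\<close> to m - 1, and a field with such
  coefficients has degree 2(m-1) - 2 = 2m - 4, matching deg \<open>a_ij\<close> = -4. For forms
  2(m-1) - 1 = 2m - 3 matches deg \<open>b_k\<close> = -3.\<close>

lemma phi_gen_deg:
  assumes "\<And>M. f M \<noteq> 0 \<Longrightarrow> Q (2 * int (mdeg M) - 4)"
  shows "e_deg Q (phi (re_a i j) f)"
proof -
  have d: "Q (2 * int (mdeg M) - 2)" if "ps_deriv i f M \<noteq> 0" for i M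
    using assms[OF ps_deriv_support[OF that]] by (simp add: algebra_simps)
  show ?thesis
    unfolding e_deg_def phi_a using d by (auto simp: fun_apply split: if_splits)
qed

lemma phi_gen_deg_odd:
  assumes "\<And>M. f M \<noteq> 0 \<Longrightarrow> Q (2 * int (mdeg M) - 3)"
  shows "e_deg Q (phi (re_b k) f)"
proof -
  have d: "Q (2 * int (mdeg M) - 1)" if "ps_deriv i f M \<noteq> 0" for i M
    using assms[OF ps_deriv_support[OF that]] by (simp add: algebra_simps)
  show ?thesis
    unfolding e_deg_def phi_b using d by (auto simp: fun_apply split: if_splits)
qed

text \<open>A monomial in \<partial> of order |J| lowers the degree of the module element by 2|J|.
  Acting on \<open>f\<close> it lowers the exponents by |J|, which has the same effect on the degree
  of the image.\<close>

lemma phi_deg: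
  assumes "r \<in> re_gr d" and f: "\<And>M. f M \<noteq> 0 \<Longrightarrow> Q (d + 2 * int (mdeg M))"
  shows "e_deg Q (phi r f)"
proof -
  have "re_gr d \<subseteq> {r. e_deg Q (phi r f)}"
    unfolding re_gr_def
  proof (rule re_k.span_minimal)
    show "re_k.subspace {r. e_deg Q (phi r f)}"
      by (simp add: re_k.subspace_def e_deg_closed phi_add phi_const)
    have "e_deg Q (phi (re_act (Poly_Mapping.single J 1) (re_a i j)) f)" if "- 4 - 2 * int (mdeg J) = d" for J i j
      unfolding phi_single
    proof (rule e_deg_closed(3)[OF phi_gen_deg])
      fix M assume "pd J f M \<noteq> 0"
      from f[OF pd_support[OF this]] show "Q (2 * int (mdeg M) - 4)"
        unfolding that[symmetric] by (simp add: algebra_simps)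
    qed
    moreover have "e_deg Q (phi (re_act (Poly_Mapping.single J 1) (re_b k)) f)" if "- 3 - 2 * int (mdeg J) = d" for J k
      unfolding phi_single
    proof (rule e_deg_closed(3)[OF phi_gen_deg_odd])
      fix M assume "pd J f M \<noteq> 0"
      from f[OF pd_support[OF this]] show "Q (2 * int (mdeg M) - 3)"
        unfolding that[symmetric] by (simp add: algebra_simps)
    qed
    ultimately show "{re_act (Poly_Mapping.single J 1) (re_a i j) | J i j. - 4 - 2 * int (mdeg J) = d} \<union>
        {re_act (Poly_Mapping.single J 1) (re_b k) | J k. - 3 - 2 * int (mdeg J) = d} \<subseteq> {r. e_deg Q (phi r f)}"
      by blast
  qed
  then show ?thesis using assms(1) by blast
qed

section \<open>Images of the parity, degree and neighbourhood subspaces\<close>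

lemma tmap_tens_on:
  assumes "u \<in> tens_on P" "V 0" "\<And>x y. V x \<Longrightarrow> V y \<Longrightarrow> V (x + y)" "\<And>c x. V x \<Longrightarrow> V (e_scal c x)"
    and "\<And>r f. P r f \<Longrightarrow> V (phi r f)"
  shows "V (tmap u)"
proof -
  have "V (\<Sum>K\<in>A. e_scal (Poly_Mapping.lookup u K) (phi (fst K) (snd K)))" if "A \<subseteq> Poly_Mapping.keys u" for A
    using that
  proof (induction A rule: infinite_finite_induct)
    case (insert K A)
    then have "P (fst K) (snd K)" using assms(1) by (auto simp: tens_on_def)
    then show ?case using insert assms(3-5) by simp
  qed (use assms(2) in simp_all)
  then show ?thesis by (simp add: tmap_def psum_def)
qed

definition gr_pred :: "int \<Rightarrow> 'k::field_char_0 re_amb \<Rightarrow> 'k ps \<Rightarrow> bool" where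
  "gr_pred n r f \<longleftrightarrow> (\<exists>d k. r \<in> re_gr d \<and> ps_homog k f \<and> d + 2 * int k = n)"

definition nbh_pred :: "int \<Rightarrow> 'k::field_char_0 re_amb \<Rightarrow> 'k ps \<Rightarrow> bool" where
  "nbh_pred n r f \<longleftrightarrow> (\<exists>d k. r \<in> re_gr d \<and> ps_ord_ge k f \<and> n \<le> d + 2 * int k)"

lemma pre_simps:
  "carr (pre_annihilation RE) = tcarr" "add (pre_annihilation RE) = (+)" "scal (pre_annihilation RE) = tscal"
  "brk (pre_annihilation RE) = ann_bracket RE" "part (pre_annihilation RE) p = tens_on (\<lambda>r f. r \<in> re_part p)"
  "gr (pre_annihilation RE) n = tens_on (gr_pred n)" "nbh (pre_annihilation RE) n = tens_on (nbh_pred n)"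
  by (simp_all add: pre_annihilation_def tens_on_def RE_5_10_simps cgr_RE gr_pred_def nbh_pred_def)

lemma tens_on_mono: "(\<And>r f. P r f \<Longrightarrow> P' r f) \<Longrightarrow> tens_on P \<subseteq> tens_on P'"
  by (auto simp: tens_on_def)

text \<open>\<open>std\<close> with \<open>g = 0\<close> still has odd module elements in its
  support. Lifting an element of pure parity inside the parity component requires the two halves
  separately.\<close>

definition std_even :: "(ix \<Rightarrow> ix \<Rightarrow> 'k ps) \<Rightarrow> ('k::field_char_0, 'k re_amb) tens" where
  "std_even F = (\<Sum>i\<in>UNIV. \<Sum>j\<in>UNIV. tens (re_a i j) (F i j))"

definition std_odd :: "(ix \<Rightarrow> 'k ps) \<Rightarrow> ('k::field_char_0, 'k re_amb) tens" where
  "std_odd g = (\<Sum>k\<in>UNIV. tens (re_b k) (g k))"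

lemma tmap_std_zero: "tmap (std_even (\<lambda>i j. 0)) = 0" "tmap (std_odd (\<lambda>k. 0)) = 0"
  by (simp_all add: std_even_def std_odd_def tmap_sum tmap_tens)

lemma bivector_zero: "bivector 0 i j = 0"
  by (simp add: bivector_def fun_apply(2)) (simp add: inv_euler_def fun_eq_iff fun_apply)

lemma potential_zero: "potential 0 k = 0"
  by (simp add: potential_def fun_apply(2)) (simp add: inv_euler_def fun_eq_iff fun_apply)

lemma part_image:
  "tmap ` tens_on (\<lambda>r f. r \<in> re_part p) = part (E_5_10 :: ('k::field_char_0, _) superalgebra) p"
proof (intro equalityI subsetI)
  fix x :: "'k vfield \<times> 'k form2"
  assume "x \<in> tmap ` tens_on (\<lambda>r f. r \<in> re_part p)"
  then obtain u where u: "u \<in> tens_on (\<lambda>r f. r \<in> re_part p)" "x = tmap u" by blast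
  then have "x \<in> e_carr" using tmap_carr tens_on_mono[of "\<lambda>r f. r \<in> re_part p" "\<lambda>r f. r \<in> re_carr"] re_part_carr by blast
  moreover have "if p = 0 then snd x = 0 else fst x = 0"
    unfolding u(2) using u(1)
  proof (rule tmap_tens_on[where V = "\<lambda>x. if p = 0 then snd x = 0 else fst x = 0"])
    fix r :: "'k re_amb" and f assume "r \<in> re_part p"
    then show "if p = 0 then snd (phi r f) = 0 else fst (phi r f) = 0"
      by (cases p) (auto simp: phi_def re_part_fst re_part_snd fun_apply fun_eq_iff)
  qed (auto simp: e_scal_def split_beta fun_eq_iff fun_apply)
  ultimately show "x \<in> part E_5_10 p" by (simp add: E_simps)
next
  fix x :: "'k vfield \<times> 'k form2"
  assume x: "x \<in> part E_5_10 p"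
  then have xc: "x \<in> e_carr" by (simp add: E_simps)
  define F where "F = (\<lambda>i j. ps_smult (- 1 / 2) (bivector (fst x) i j))"
  define g where "g = (\<lambda>k. - potential (snd x) k)"
  have l: "tmap (std_even F) + tmap (std_odd g) = x"
    using tmap_lift[OF xc] by (simp add: lift_e_def std_def tmap_add std_even_def std_odd_def F_def g_def)
  show "x \<in> tmap ` tens_on (\<lambda>r f. r \<in> re_part p)"
  proof (cases "p = 0")
    case True
    then have "g = (\<lambda>k. 0)" using x by (auto simp: g_def E_simps potential_zero)
    then have "tmap (std_even F) = x" using l by (simp add: tmap_std_zero)
    moreover have "std_even F \<in> tens_on (\<lambda>r f. r \<in> re_part p)"
      unfolding std_even_def True by (intro tens_on_sum tens_on_closed re_a_part)
    ultimately show ?thesis by blast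
  next
    case False
    then have p: "p = 1" by (cases p) auto
    then have "F = (\<lambda>i j. 0)" using x by (auto simp: F_def E_simps bivector_zero)
    then have "tmap (std_odd g) = x" using l by (simp add: tmap_std_zero)
    moreover have "std_odd g \<in> tens_on (\<lambda>r f. r \<in> re_part p)"
      unfolding std_odd_def p by (intro tens_on_sum tens_on_closed re_b_part)
    ultimately show ?thesis by blast
  qed
qed

lemma gr_pred_carr: "gr_pred n r f \<Longrightarrow> r \<in> re_carr" and nbh_pred_carr: "nbh_pred n r f \<Longrightarrow> r \<in> re_carr"
  using re_gr_carr by (auto simp: gr_pred_def nbh_pred_def)

lemma var_mult_support: "ps_var_mult i f M \<noteq> 0 \<Longrightarrow> \<exists>N. f N \<noteq> 0 \<and> mdeg M = mdeg N + 1"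
proof -
  assume *: "ps_var_mult i f M \<noteq> 0"
  then have "M = (M - unit_mexp i) + unit_mexp i"
    by (auto simp: ps_var_mult_def fun_eq_iff fun_apply unit_mexp_apply split: if_splits)
  then have "mdeg M = mdeg (M - unit_mexp i) + 1" by (metis mdeg_simps(2,3))
  then show ?thesis using * by (auto simp: ps_var_mult_def split: if_splits)
qed

lemma gr_image_gen:
  assumes "r \<in> re_gr d" "\<And>M. f M \<noteq> 0 \<Longrightarrow> d + 2 * int (mdeg M) = n"
  shows "phi r f \<in> tmap ` tens_on (gr_pred n)"
\<comment> \<open>For \<open>f = 0\<close> there may be no \<open>k\<close> with
  \<open>d + 2 * int k = n\<close>, so \<open>tens r 0\<close> need not have degree
  \<open>n\<close>; the zero tensor represents the value instead.\<close>
proof (cases "f = 0")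
  case True
  then have "phi r f = tmap 0" by simp
  then show ?thesis using tens_on_closed(1) by blast
next
  case False
  then obtain M where M: "f M \<noteq> 0" by (auto simp: fun_eq_iff fun_apply)
  have "mdeg N = mdeg M" if "f N \<noteq> 0" for N
    using assms(2)[OF M] assms(2)[OF that] by simp
  then have "gr_pred n r f"
    unfolding gr_pred_def ps_homog_def using assms(1) assms(2)[OF M] by blast
  then have "tens r f \<in> tens_on (gr_pred n)" by (rule tens_on_closed(4))
  then show ?thesis using tmap_tens[of r f] by (metis image_eqI)
qed

text \<open>Surjectivity rests on homogeneity of the section: bivector and potential multiply once
  by a variable and so raise the degree of coefficients by exactly one, which compensates the
  derivative in \<open>phi_gen_deg\<close>.\<close>

lemma gr_image: "tmap ` tens_on (gr_pred n) = gr (E_5_10 :: ('k::field_char_0, _) superalgebra) n"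
proof (intro equalityI subsetI)
  fix x :: "'k vfield \<times> 'k form2"
  assume "x \<in> tmap ` tens_on (gr_pred n)"
  then obtain u where u: "u \<in> tens_on (gr_pred n)" "x = tmap u" by blast
  then have "x \<in> e_carr" using tmap_carr tens_on_mono[of "gr_pred n" "\<lambda>r f. r \<in> re_carr"] gr_pred_carr by blast
  moreover have "e_deg (\<lambda>m. m = n) x"
    unfolding u(2) using u(1)
    by (rule tmap_tens_on) (auto simp: e_deg_closed gr_pred_def ps_homog_def intro!: phi_deg)
  ultimately show "x \<in> gr E_5_10 n" by (simp add: E_simps)
next
  fix x :: "'k vfield \<times> 'k form2"
  assume x: "x \<in> gr E_5_10 n"
  then have xc: "x \<in> e_carr" and d: "e_deg (\<lambda>m. m = n) x" by (simp_all add: E_simps)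
  let ?W = "tmap ` tens_on (gr_pred n)"
  have W0: "0 \<in> ?W" using tens_on_closed(1) tmap_0 by (metis image_eqI)
  have Wadd: "y + z \<in> ?W" if yz: "y \<in> ?W" "z \<in> ?W" for y z :: "'k vfield \<times> 'k form2"
  proof -
    from yz obtain u v where "u \<in> tens_on (gr_pred n)" "y = tmap u" "v \<in> tens_on (gr_pred n)" "z = tmap v"
      by blast
    then have "y + z = tmap (u + v)" "u + v \<in> tens_on (gr_pred n)"
      by (simp_all add: tmap_add tens_on_closed(2))
    then show ?thesis by (rule image_eqI)
  qed
  have Wsum: "sum h A \<in> ?W" if "\<And>a. a \<in> A \<Longrightarrow> h a \<in> ?W" for h :: "ix \<Rightarrow> 'k vfield \<times> 'k form2" and A
    using that by (induction A rule: infinite_finite_induct) (auto intro: W0 Wadd)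
  have biv: "phi (re_a i j) (ps_smult (- 1 / 2) (bivector (fst x) i j)) \<in> ?W" for i j
  proof (rule gr_image_gen[OF re_gen_gr(1)])
    fix M assume "ps_smult (- 1 / 2) (bivector (fst x) i j) M \<noteq> 0"
    then have "ps_var_mult i (fst x j) M \<noteq> 0 \<or> ps_var_mult j (fst x i) M \<noteq> 0"
      by (auto simp: bivector_def inv_euler_def fun_apply)
    then obtain k N where "fst x k N \<noteq> 0" "mdeg M = mdeg N + 1" using var_mult_support by blast
    then show "- 4 + 2 * int (mdeg M) = n" using d by (auto simp: e_deg_def)
  qed
  have pot: "phi (re_b k) (- potential (snd x) k) \<in> ?W" for k
  proof (rule gr_image_gen[OF re_gen_gr(2)])
    fix M assume "(- potential (snd x) k) M \<noteq> 0"
    then have "(\<Sum>i\<in>UNIV. ps_var_mult i (snd x i k) M) \<noteq> 0"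
      by (auto simp: potential_def inv_euler_def fun_apply sum_apply)
    then obtain i where "ps_var_mult i (snd x i k) M \<noteq> 0" by (meson sum.neutral)
    then obtain N where "snd x i k N \<noteq> 0" "mdeg M = mdeg N + 1" using var_mult_support by blast
    then show "- 3 + 2 * int (mdeg M) = n" using d by (auto simp: e_deg_def)
  qed
  have "tmap (lift_e x) \<in> ?W"
    unfolding lift_e_def std_def tmap_add tmap_sum tmap_tens by (intro Wadd Wsum biv pot)
  then show "x \<in> ?W" by (simp add: tmap_lift[OF xc])
qed

lemma nbh_image: "tmap ` tens_on (nbh_pred n) \<subseteq> nbh (E_5_10 :: ('k::field_char_0, _) superalgebra) n"
proof
  fix x :: "'k vfield \<times> 'k form2"
  assume "x \<in> tmap ` tens_on (nbh_pred n)"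
  then obtain u where u: "u \<in> tens_on (nbh_pred n)" "x = tmap u" by blast
  then have "x \<in> e_carr" using tmap_carr tens_on_mono[of "nbh_pred n" "\<lambda>r f. r \<in> re_carr"] nbh_pred_carr by blast
  moreover have "e_deg (\<lambda>m. n \<le> m) x"
    unfolding u(2) using u(1)
  proof (rule tmap_tens_on[where V = "e_deg (\<lambda>m. n \<le> m)"])
    fix r f assume "nbh_pred n r f"
    then obtain d k where *: "r \<in> re_gr d" "ps_ord_ge k f" "n \<le> d + 2 * int k"
      by (auto simp: nbh_pred_def)
    show "e_deg (\<lambda>m. n \<le> m) (phi r f)"
    proof (rule phi_deg[OF *(1)])
      fix M assume "f M \<noteq> 0"
      with *(2,3) show "n \<le> d + 2 * int (mdeg M)" by (force simp: ps_ord_ge_def)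
    qed
  qed (simp_all add: e_deg_closed)
  ultimately show "x \<in> nbh E_5_10 n" by (simp add: E_simps)
qed

lemma coset_pre: "coset (pre_annihilation RE) (ann_rel RE) u = {v. v - u \<in> rel}"
proof -
  have "v \<in> (+) u ` rel" if "v - u \<in> rel" for v
    by (rule image_eqI[OF _ that]) simp
  then show ?thesis unfolding coset_def pre_simps rel_def[symmetric] by auto
qed

text \<open>Here A(RE(5,10)) itself is identified with E(5,10): the fibres are the classes by
  \<open>rel_kernel\<close> and \<open>kernel\<close>, and the section gives surjectivity.\<close>

interpretation ann: presentation "pre_annihilation RE :: ('k::field_char_0, _) superalgebra" "ann_rel RE" E_5_10 tmap
proof
  fix x :: "('k, 'k re_amb) tens" assume x: "x \<in> carr (pre_annihilation RE)"
  show "coset (pre_annihilation RE) (ann_rel RE) x = {y \<in> carr (pre_annihilation RE). tmap y = tmap x}"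
  proof (intro equalityI subsetI)
    fix y assume "y \<in> coset (pre_annihilation RE) (ann_rel RE) x"
    then have k: "y - x \<in> tcarr" "tmap (y - x) = 0" using rel_kernel by (auto simp: coset_pre)
    then have "(y - x) + x \<in> tcarr" using x tens_on_closed(2) unfolding pre_simps by blast
    then show "y \<in> {y \<in> carr (pre_annihilation RE). tmap y = tmap x}" using k(2) by (simp add: pre_simps tmap_diff)
  next
    fix y assume "y \<in> {y \<in> carr (pre_annihilation RE). tmap y = tmap x}"
    then have "y - x \<in> tcarr" "tmap (y - x) = 0"
      using x tens.subspace_diff[OF tens_on_subspace] by (auto simp: pre_simps tmap_diff)
    then show "y \<in> coset (pre_annihilation RE) (ann_rel RE) x" using kernel by (simp add: coset_pre)
  qed
next
  show "tmap ` carr (pre_annihilation RE) = carr (E_5_10 :: ('k, _) superalgebra)"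
  proof (intro equalityI subsetI)
    fix x :: "'k vfield \<times> 'k form2" assume "x \<in> carr E_5_10"
    then have "x = tmap (lift_e x)" by (simp add: E_simps tmap_lift)
    then show "x \<in> tmap ` carr (pre_annihilation RE)" using lift_carr unfolding pre_simps by blast
  qed (auto simp: pre_simps E_simps tmap_carr)
next
  fix n :: int and p :: bit
  show "part (pre_annihilation RE) p \<subseteq> carr (pre_annihilation RE :: ('k, _) superalgebra)"
    unfolding pre_simps by (rule tens_on_mono) (rule re_part_carr)
  show "gr (pre_annihilation RE) n \<subseteq> carr (pre_annihilation RE :: ('k, _) superalgebra)"
    unfolding pre_simps by (rule tens_on_mono) (rule gr_pred_carr)
  show "nbh (pre_annihilation RE) n \<subseteq> carr (pre_annihilation RE :: ('k, _) superalgebra)"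
    unfolding pre_simps by (rule tens_on_mono) (rule nbh_pred_carr)
  show "tmap ` nbh (pre_annihilation RE) n \<subseteq> nbh (E_5_10 :: ('k, _) superalgebra) n"
    unfolding pre_simps by (rule nbh_image)
qed (simp_all add: pre_simps E_simps(1-4) part_image gr_image tens_on_closed ann_bracket_carr tmap_bracket tmap_add tmap_tscal)

section \<open>Constant vector fields\<close>

definition const_field :: "(ix \<Rightarrow> 'k) \<Rightarrow> 'k::field_char_0 vfield \<times> 'k form2" where
  "const_field \<delta> = (\<lambda>i. ps_monom (\<delta> i) 0, 0)"

definition e_der :: "(ix \<Rightarrow> 'k) \<Rightarrow> 'k::field_char_0 vfield \<times> 'k form2 \<Rightarrow> 'k vfield \<times> 'k form2" where
  "e_der \<delta> x = (\<lambda>t. \<Sum>i\<in>UNIV. ps_smult (\<delta> i) (ps_deriv i (fst x t)),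
     \<lambda>j k. \<Sum>i\<in>UNIV. ps_smult (\<delta> i) (ps_deriv i (snd x j k)))"

lemma const_field_simps: "fst (const_field \<delta>) t = ps_monom (\<delta> t) 0" "snd (const_field \<delta>) j k = 0"
  by (simp_all add: const_field_def fun_apply)

lemma e_der_simps: "fst (e_der \<delta> x) t = (\<Sum>i\<in>UNIV. ps_smult (\<delta> i) (ps_deriv i (fst x t)))"
  "snd (e_der \<delta> x) j k = (\<Sum>i\<in>UNIV. ps_smult (\<delta> i) (ps_deriv i (snd x j k)))"
  by (simp_all add: e_der_def)

lemma ps_mult_const: "ps_mult (ps_monom c 0) f = ps_smult c f"
proof
  fix M :: mexp
  have "ps_mult (ps_monom c 0) f M = (\<Sum>N | N \<le> M. if N = 0 then c * f M else 0)"
    unfolding ps_mult_def by (intro sum.cong refl) (auto simp: ps_monom_def)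
  also have "\<dots> = c * f M" by (subst sum.delta[OF finite_le_mexp]) (simp add: le_fun_def fun_apply)
  finally show "ps_mult (ps_monom c 0) f M = ps_smult c f M" by (simp add: fun_apply)
qed

text \<open>If \<open>M i = 0\<close> the exponent on the right is truncated to \<open>M\<close>,
  but its coefficient is then zero.\<close>

lemma ps_deriv_monom: "ps_deriv i (ps_monom c M) = ps_monom (of_nat (M i) * c) (M - unit_mexp i)"
proof
  fix N :: mexp
  have "N = M - unit_mexp i" if "N + unit_mexp i = M"
    unfolding that[symmetric] by (simp add: fun_eq_iff fun_apply)
  moreover have "N + unit_mexp i = M" if "N = M - unit_mexp i" "M i \<noteq> 0"
    using that by (auto simp: fun_eq_iff fun_apply unit_mexp_apply)
  moreover have "N i + 1 = M i" if "N + unit_mexp i = M" using that by (auto simp: fun_apply unit_mexp_apply)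
  ultimately have "ps_deriv i (ps_monom c M) N = (if N = M - unit_mexp i \<and> M i \<noteq> 0 then of_nat (M i) * c else 0)"
    unfolding ps_deriv_def ps_monom_def by (smt (verit) Suc_eq_plus1 mult_zero_right nat.distinct(1))
  then show "ps_deriv i (ps_monom c M) N = ps_monom (of_nat (M i) * c) (M - unit_mexp i) N"
    by (simp add: ps_monom_def)
qed

lemma ps_monom_0: "ps_monom 0 M = 0"
  by (simp add: ps_monom_def fun_eq_iff fun_apply)

lemma ps_deriv_const: "ps_deriv i (ps_monom c 0) = 0"
  by (simp add: ps_deriv_monom fun_apply ps_monom_0)

lemma ps_monom_add: "ps_monom (a + b) M = ps_monom a M + ps_monom b M"
  by (simp add: ps_monom_def fun_eq_iff fun_apply)

lemma const_field_add: "const_field (\<delta> + \<gamma>) = const_field \<delta> + const_field \<gamma>"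
  by (rule e_eqI) (simp_all add: const_field_simps fun_apply(1) ps_monom_add)

lemma const_field_scal: "const_field (\<lambda>i. c * \<delta> i) = e_scal c (const_field \<delta>)"
  by (rule e_eqI) (simp_all add: const_field_simps e_scal_simps ps_monom_def fun_eq_iff fun_apply)

lemma const_field_0: "const_field 0 = 0"
  by (rule e_eqI) (simp_all add: const_field_simps fun_apply(2) ps_monom_0)

lemma const_field_uminus: "const_field (- \<delta>) = - const_field \<delta>"
  using const_field_add[of "- \<delta>" \<delta>] by (simp add: const_field_0 eq_neg_iff_add_eq_0)

lemma const_field_carr: "const_field \<delta> \<in> e_carr"
  by (simp add: e_carr_def const_field_def S5_def ps_deriv_const Omega2_closed)

lemma const_field_deg: "Q (- 2) \<Longrightarrow> e_deg Q (const_field \<delta>)"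
  by (auto simp: e_deg_def const_field_simps ps_monom_def fun_apply split: if_splits)

text \<open>The degree 2|M| - 2 of a field is -2 for constant coefficients only, and the degree of a
  form is odd.\<close>

lemma gr_minus_2:
  assumes "x \<in> gr E_5_10 (- 2)"
  shows "x = const_field (\<lambda>i. fst x i 0)"
proof (rule e_eqI)
  have d: "e_deg (\<lambda>m. m = - 2) x" using assms by (simp add: E_simps)
  have "M = 0" if "fst x t M \<noteq> 0" for t M
  proof -
    have "mdeg M = 0" using d that unfolding e_deg_def by fastforce
    then show ?thesis by (simp add: mdeg_def fun_eq_iff fun_apply)
  qed
  then show "fst x t = fst (const_field (\<lambda>i. fst x i 0)) t" for t
    unfolding const_field_simps ps_monom_def by (metis (full_types) ext)
  have "snd x j k M = 0" for j k M
  proof (rule ccontr)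
    assume "snd x j k M \<noteq> 0"
    then have "2 * int (mdeg M) - 1 = - 2" using d by (auto simp: e_deg_def)
    then show False by presburger
  qed
  then show "snd x j k = snd (const_field (\<lambda>i. fst x i 0)) j k" for j k
    by (auto simp: const_field_simps fun_eq_iff fun_apply)
qed

lemma e_brk_const:
  "e_brk (const_field \<delta>) x = e_der \<delta> x" "e_brk x (const_field \<delta>) = - e_der \<delta> x"
proof -
  show "e_brk (const_field \<delta>) x = e_der \<delta> x"
    by (rule e_eqI) (simp_all add: e_brk_fst e_brk_snd e_der_simps const_field_simps ps_mult_const ps_deriv_const)
  show "e_brk x (const_field \<delta>) = - e_der \<delta> x"
    by (rule e_eqI)
      (simp_all add: e_brk_fst e_brk_snd e_der_simps const_field_simps ps_mult_const ps_deriv_const fun_apply(3))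
qed

lemma e_der_const: "e_der \<delta> (const_field \<gamma>) = 0"
  by (rule e_eqI) (simp_all add: e_der_simps const_field_simps ps_deriv_const fun_apply(2))

lemma e_der_add: "e_der \<delta> (x + y) = e_der \<delta> x + e_der \<delta> y"
  by (rule e_eqI) (simp_all add: e_der_simps fun_apply(1) ps_deriv_add ps_smult_add sum.distrib)

lemma e_der_scal: "e_der \<delta> (e_scal c x) = e_scal c (e_der \<delta> x)"
  by (rule e_eqI) (simp_all add: e_der_simps e_scal_simps ps_deriv_smult ps_smult_sum mult.commute)

text \<open>Linear divergence free fields already distinguish the five derivations, since
  differentiating them returns the coordinates of \<delta>.\<close>

lemma e_der_faithful:
  fixes \<gamma> \<delta> :: "ix \<Rightarrow> 'k::field_char_0"
  assumes "\<And>x. x \<in> e_carr \<Longrightarrow> e_der \<gamma> x = e_der \<delta> x"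
  shows "\<gamma> = \<delta>"
proof
  fix i :: ix
  obtain j :: ix where "j \<noteq> i" using ix.distinct(1) by metis
  \<comment> \<open>The power series is half the square of the variable of index \<open>i\<close>,
    so that for \<open>j \<noteq> i\<close> the field is minus that variable times the field of
    index \<open>j\<close>.\<close>
  define x :: "'k vfield \<times> 'k form2" where "x = phi (re_a i j) (ps_monom (1 / 2) (unit_mexp i + unit_mexp i))"
  have f: "fst x j = - ps_monom 1 (unit_mexp i)"
    using \<open>j \<noteq> i\<close> by (simp add: x_def phi_a ps_deriv_monom fun_apply unit_mexp_apply)
  have "fst (e_der \<epsilon> x) j 0 = - \<epsilon> i" for \<epsilon>
  proof -
    have "fst (e_der \<epsilon> x) j 0 = (\<Sum>m\<in>UNIV. of_bool (m = i) * (- \<epsilon> m))"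
      unfolding e_der_simps f sum_apply
      by (intro sum.cong refl) (auto simp: ps_deriv_def ps_monom_def fun_apply unit_mexp_apply fun_eq_iff)
    then show ?thesis by (simp only: sum_of_bool)
  qed
  moreover have "x \<in> e_carr" unfolding x_def by (rule phi_a_carr)
  ultimately show "\<gamma> i = \<delta> i" using assms[of x] by (metis neg_equal_iff_equal)
qed

section \<open>The extended annihilation superalgebra\<close>

lemma phi_sum: "phi r (\<Sum>a\<in>A. f a) = (\<Sum>a\<in>A. phi r (f a))"
  using sum_comp_morphism[of "phi r" f A] by (simp add: phi_add o_def)

lemma phi_der: "phi r (\<Sum>i\<in>UNIV. ps_smult (\<delta> i) (ps_deriv i f)) = e_der \<delta> (phi r f)"
  by (rule e_eqI)
     (simp_all add: phi_sum phi_smult fst_sum snd_sum sum_apply e_scal_simps e_der_simps phi_simps mpol_act_deriv)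

lemma tmap_D: "tmap (tens_D \<delta> u) = e_der \<delta> (tmap u)"
proof -
  have d0: "e_der \<delta> 0 = 0" using e_der_scal[of \<delta> 0 0] by (simp add: e_scal_mult)
  have "tmap (tens_D \<delta> u) = (\<Sum>K\<in>Poly_Mapping.keys u. e_der \<delta> (e_scal (Poly_Mapping.lookup u K) (phi (fst K) (snd K))))"
    unfolding tens_D_def split_beta tmap_sum tmap_tscal tmap_tens phi_der e_der_scal by simp
  also have "\<dots> = e_der \<delta> (tmap u)"
    unfolding tmap_def psum_def using sum_comp_morphism[of "e_der \<delta>", OF d0 e_der_add] by (simp add: o_def)
  finally show ?thesis .
qed

lemma tens_D_carr: "u \<in> tcarr \<Longrightarrow> tens_D \<delta> u \<in> tcarr"
  unfolding tens_D_def split_beta by (intro tens_on_sum tens_on_closed(3,4)) (auto simp: tens_on_def)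

section \<open>Transport of the D-action and of inner derivations to E(5,10)\<close>

abbreviation (input) "Ann \<equiv> annihilation RE_5_10"

lemmas ann_quot = ann.quot_closed[folded annihilation_def] ann.induced_hom[folded annihilation_def]
  ann.induced_bij[folded annihilation_def] ann.quot_sub[folded annihilation_def]
  ann.induced_part[folded annihilation_def] ann.induced_gr[folded annihilation_def]
  ann.induced_nbh[folded annihilation_def]

lemma ann_inj: "x \<in> carr Ann \<Longrightarrow> y \<in> carr Ann \<Longrightarrow> ann.induced x = ann.induced y \<Longrightarrow> x = y"
  using ann.induced_bij[folded annihilation_def] by (auto simp: bij_betw_def dest: inj_onD)

lemma ann_surj:
  assumes "y \<in> e_carr"
  obtains x where "x \<in> carr Ann" "ann.induced x = y"
proof -
  have "y \<in> ann.induced ` carr Ann"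
    using assms ann.induced_bij[folded annihilation_def] unfolding E_simps bij_betw_def by blast
  then show ?thesis using that by blast
qed

lemma ann_D_simps:
  assumes "X \<in> carr Ann"
  shows "ann_D RE \<delta> X \<in> carr Ann" "ann.induced (ann_D RE \<delta> X) = e_der \<delta> (ann.induced X)"
proof -
  obtain u where u: "u \<in> tcarr" "X = coset (pre_annihilation RE) (ann_rel RE) u"
    using assms unfolding annihilation_def ann.carr_quot pre_simps by blast
  have "ann_D RE \<delta> X = coset (pre_annihilation RE) (ann_rel RE) (tens_D \<delta> u)"
    unfolding ann_D_def u(2) by (rule ann.UN_coset) (simp_all add: pre_simps u tens_D_carr tmap_D)
  then show "ann_D RE \<delta> X \<in> carr Ann" "ann.induced (ann_D RE \<delta> X) = e_der \<delta> (ann.induced X)"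
    using u tens_D_carr[OF u(1), of \<delta>]
    by (auto simp: annihilation_def ann.carr_quot pre_simps ann.induced_coset tmap_D)
qed

text \<open>An element of degree -2 is a constant field and acts as the derivation with its
  coordinates. By faithfulness the \<delta> with \<open>ad x\<close> = \<delta> is determined by
  \<open>x\<close>, so the subspace divided out is the graph of an explicit linear
  condition.\<close>

lemma ad_rel_iff:
  "(\<gamma>, x) \<in> ad_rel RE \<longleftrightarrow> x \<in> carr Ann \<and> ann.induced x = const_field (- \<gamma>)"
proof
  assume "(\<gamma>, x) \<in> ad_rel RE"
  then obtain \<delta> where g: "\<gamma> = - \<delta>" and x: "x \<in> gr Ann (- 2)"
    and ad: "\<And>u. u \<in> carr Ann \<Longrightarrow> brk Ann x u = ann_D RE \<delta> u"
    by (auto simp: ad_rel_def)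
  have xc: "x \<in> carr Ann" using x ann_quot(9) by blast
  have "ann.induced x \<in> gr E_5_10 (- 2)" using x ann_quot(12) by blast
  then obtain \<epsilon> where e: "ann.induced x = const_field \<epsilon>" using gr_minus_2 by blast
  have "\<epsilon> = \<delta>"
  proof (rule e_der_faithful)
    fix y :: "'a vfield \<times> 'a form2" assume "y \<in> e_carr"
    then obtain u where u: "u \<in> carr Ann" "ann.induced u = y" by (rule ann_surj)
    then have "ann.induced (brk Ann x u) = ann.induced (ann_D RE \<delta> u)" using ad by simp
    then show "e_der \<epsilon> y = e_der \<delta> y"
      using u xc by (simp add: ann_quot E_simps e e_brk_const ann_D_simps)
  qed
  then show "x \<in> carr Ann \<and> ann.induced x = const_field (- \<gamma>)" using xc e g by simp
next
  assume x: "x \<in> carr Ann \<and> ann.induced x = const_field (- \<gamma>)"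
  \<comment> \<open>The degree of \<open>x\<close> is recovered from its image: some element of
    degree -2 has the same image, and injectivity identifies it with \<open>x\<close>.\<close>
  have "const_field (- \<gamma>) \<in> gr E_5_10 (- 2)" by (simp add: E_simps const_field_carr const_field_deg)
  then have "const_field (- \<gamma>) \<in> ann.induced ` gr Ann (- 2)" unfolding ann_quot(12) .
  then obtain x' where x': "x' \<in> gr Ann (- 2)" "ann.induced x' = const_field (- \<gamma>)" by force
  moreover have "x' \<in> carr Ann" using x'(1) ann_quot(9) by blast
  ultimately have gr: "x \<in> gr Ann (- 2)" using x ann_inj[of x x'] by simp
  have "brk Ann x u = ann_D RE (- \<gamma>) u" if "u \<in> carr Ann" for u
    using x that by (intro ann_inj) (simp_all add: ann_quot E_simps e_brk_const ann_D_simps)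
  then show "(\<gamma>, x) \<in> ad_rel RE"
    unfolding ad_rel_def using gr by (intro CollectI exI[of _ "- \<gamma>"] exI[of _ x]) simp
qed

text \<open>\<delta> goes to the constant field whose adjoint action it is. The pairs in
  \<open>ad_rel\<close> are exactly those sent to zero.\<close>

definition ext_map :: "(ix \<Rightarrow> 'k) \<times> ('k, 'k re_amb) tens set \<Rightarrow> 'k::field_char_0 vfield \<times> 'k form2" where
  "ext_map = (\<lambda>(\<delta>, X). ann.induced X + const_field \<delta>)"

lemma ext_simps:
  "carr (ext_annihilation RE) = UNIV \<times> carr Ann"
  "add (ext_annihilation RE) (\<delta>, u) (\<gamma>, v) = (\<delta> + \<gamma>, add Ann u v)"
  "scal (ext_annihilation RE) c (\<delta>, u) = (\<lambda>i. c * \<delta> i, scal Ann c u)"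
  "brk (ext_annihilation RE) (\<delta>, u) (\<gamma>, v) =
     (0, add Ann (add Ann (ann_D RE \<delta> v) (scal Ann (- 1) (ann_D RE \<gamma> u))) (brk Ann u v))"
  "part (ext_annihilation RE) p = (if p = 0 then UNIV else {0}) \<times> part Ann p"
  "gr (ext_annihilation RE) n = (if n = - 2 then UNIV else {0}) \<times> gr Ann n"
  "nbh (ext_annihilation RE) n = (if n \<le> - 2 then UNIV else {0}) \<times> nbh Ann n"
  by (simp_all add: ext_annihilation_def Let_def)

lemma ext_image:
  assumes "ann.induced ` V = W" "\<And>x \<delta>. \<delta> \<in> D \<Longrightarrow> x \<in> W \<Longrightarrow> x + const_field \<delta> \<in> W" "0 \<in> D"
  shows "ext_map ` (D \<times> V) = W"
proof (intro equalityI subsetI)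
  fix x assume "x \<in> W"
  then obtain u where "u \<in> V" "ann.induced u = x" using assms(1) by blast
  then have "ext_map (0, u) = x" "(0, u) \<in> D \<times> V" using assms(3) by (simp_all add: ext_map_def const_field_0)
  then show "x \<in> ext_map ` (D \<times> V)" by (metis image_eqI)
next
  fix x assume "x \<in> ext_map ` (D \<times> V)"
  then obtain \<delta> u where "\<delta> \<in> D" "u \<in> V" "x = ann.induced u + const_field \<delta>"
    unfolding ext_map_def by auto
  then show "x \<in> W" using assms(1,2) by blast
qed

text \<open>Adjoining D and dividing by the differences of elements and their adjoint actions gives
  E(5,10) again, because D already occurs in it as the constant fields.\<close>

interpretation ext: presentation "ext_annihilation RE :: ('k::field_char_0, _) superalgebra" "ad_rel RE" E_5_10 ext_map
proof
  fix x :: "(ix \<Rightarrow> 'k) \<times> ('k, 'k re_amb) tens set"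
  assume "x \<in> carr (ext_annihilation RE)"
  then obtain \<delta> u where x: "x = (\<delta>, u)" and u: "u \<in> carr Ann" by (auto simp: ext_simps)
  show "coset (ext_annihilation RE) (ad_rel RE) x = {y \<in> carr (ext_annihilation RE). ext_map y = ext_map x}"
  proof (intro equalityI subsetI)
    fix y assume "y \<in> coset (ext_annihilation RE) (ad_rel RE) x"
    then obtain \<gamma> v where "(\<gamma>, v) \<in> ad_rel RE" and y: "y = (\<delta> + \<gamma>, add Ann u v)"
      by (auto simp: coset_def x ext_simps)
    then have v: "v \<in> carr Ann" "ann.induced v = const_field (- \<gamma>)" by (simp_all add: ad_rel_iff)
    then show "y \<in> {y \<in> carr (ext_annihilation RE). ext_map y = ext_map x}"
      using u by (simp add: x y ext_simps ann_quot ext_map_def E_simps const_field_add const_field_uminus)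
  next
    fix y assume "y \<in> {y \<in> carr (ext_annihilation RE). ext_map y = ext_map x}"
    then obtain \<gamma> v where y: "y = (\<gamma>, v)" and v: "v \<in> carr Ann"
      and eq: "ann.induced v + const_field \<gamma> = ann.induced u + const_field \<delta>"
      by (auto simp: ext_simps ext_map_def x)
    \<comment> \<open>The correcting element has D-component \<gamma> - \<delta>, so by
      \<open>ad_rel_iff\<close> its other component must have the constant field \<delta> - \<gamma>
      as image; injectivity then gives \<open>v = add Ann u w\<close>.\<close>
    obtain w where w: "w \<in> carr Ann" "ann.induced w = const_field (- (\<gamma> - \<delta>))"
      using ann_surj[OF const_field_carr] by blast
    have "const_field \<gamma> = const_field (\<gamma> - \<delta>) + const_field \<delta>"
      unfolding const_field_add[symmetric] by simp
    then have "v = add Ann u w"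
      using u v w eq by (intro ann_inj) (simp_all add: ann_quot E_simps eq_diff_eq const_field_uminus[of "\<gamma> - \<delta>"] add.assoc del: minus_diff_eq)
    moreover have "(\<gamma> - \<delta>, w) \<in> ad_rel RE" using w by (simp add: ad_rel_iff)
    ultimately show "y \<in> coset (ext_annihilation RE) (ad_rel RE) x"
      unfolding coset_def x y by (intro image_eqI[of _ _ "(\<gamma> - \<delta>, w)"]) (simp_all add: ext_simps)
  qed
next
  show "ext_map ` carr (ext_annihilation RE) = carr (E_5_10 :: ('k, _) superalgebra)"
    unfolding ext_simps using ann_quot(7)
    by (intro ext_image) (auto simp: bij_betw_def E_simps intro: e_carr_closed const_field_carr)
next
  fix x y :: "(ix \<Rightarrow> 'k) \<times> ('k, 'k re_amb) tens set"
  assume "x \<in> carr (ext_annihilation RE)" "y \<in> carr (ext_annihilation RE)"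
  then obtain \<delta> u \<gamma> v where xy: "x = (\<delta>, u)" "y = (\<gamma>, v)" and u: "u \<in> carr Ann" and v: "v \<in> carr Ann"
    by (auto simp: ext_simps)
  note s = xy ext_simps ann_quot ann_D_simps E_simps ext_map_def u v
  show "add (ext_annihilation RE) x y \<in> carr (ext_annihilation RE)"
    by (simp add: s)
  show "ext_map (add (ext_annihilation RE) x y) = add E_5_10 (ext_map x) (ext_map y)"
    by (simp add: s const_field_add)
  show "brk (ext_annihilation RE) x y \<in> carr (ext_annihilation RE)"
    by (simp add: s)
  \<comment> \<open>Expanding the bracket of two sums in E(5,10), the mixed terms are the two
    actions of D, and the bracket of two constant fields is zero, as D is abelian.\<close>
  show "ext_map (brk (ext_annihilation RE) x y) = brk E_5_10 (ext_map x) (ext_map y)"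
    by (simp add: s const_field_0 e_scal_minus e_brk_add e_brk_const e_der_const e_der_add)
next
  fix x :: "(ix \<Rightarrow> 'k) \<times> ('k, 'k re_amb) tens set" and c
  assume "x \<in> carr (ext_annihilation RE)"
  then obtain \<delta> u where x: "x = (\<delta>, u)" and u: "u \<in> carr Ann" by (auto simp: ext_simps)
  show "scal (ext_annihilation RE) c x \<in> carr (ext_annihilation RE)"
    by (simp add: x u ext_simps ann_quot)
  show "ext_map (scal (ext_annihilation RE) c x) = scal E_5_10 c (ext_map x)"
    by (simp add: x u ext_simps ann_quot ext_map_def E_simps const_field_scal e_scal_add)
next
  fix n :: int and p :: bit
  show "part (ext_annihilation RE) p \<subseteq> carr (ext_annihilation RE :: ('k, _) superalgebra)"
    "gr (ext_annihilation RE) n \<subseteq> carr (ext_annihilation RE :: ('k, _) superalgebra)"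
    "nbh (ext_annihilation RE) n \<subseteq> carr (ext_annihilation RE :: ('k, _) superalgebra)"
    using ann_quot(8-10) unfolding ext_simps by blast+
  have c0: "(\<lambda>i. ps_monom ((0 :: ix \<Rightarrow> 'k) i) 0) = 0" by (simp add: fun_eq_iff fun_apply ps_monom_0)
  show "ext_map ` part (ext_annihilation RE) p = part (E_5_10 :: ('k, _) superalgebra) p"
    unfolding ext_simps
    by (rule ext_image[OF ann_quot(11)])
       (auto simp: E_simps const_field_def c0 const_field_carr[unfolded const_field_def]
         intro: e_carr_closed split: if_splits)
  show "ext_map ` gr (ext_annihilation RE) n = gr (E_5_10 :: ('k, _) superalgebra) n"
    unfolding ext_simps
    by (rule ext_image[OF ann_quot(12)])
       (auto simp: E_simps const_field_0 intro: e_carr_closed e_deg_closed const_field_carr const_field_deg split: if_splits)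
  show "ext_map ` nbh (ext_annihilation RE) n \<subseteq> nbh (E_5_10 :: ('k, _) superalgebra) n"
  proof
    fix x :: "'k vfield \<times> 'k form2" assume "x \<in> ext_map ` nbh (ext_annihilation RE) n"
    then obtain \<delta> u where "u \<in> nbh Ann n" "n \<le> - 2 \<or> \<delta> = 0" "x = ann.induced u + const_field \<delta>"
      unfolding ext_simps by (auto simp: ext_map_def split: if_splits)
    moreover from this have "ann.induced u \<in> nbh E_5_10 n" using ann_quot(13) by blast
    ultimately show "x \<in> nbh E_5_10 n"
      by (auto simp: E_simps const_field_0 intro: e_carr_closed e_deg_closed const_field_carr const_field_deg)
  qed
qed

lemma ext_class:
  assumes "r \<in> re_carr"
  shows "ext.induced (ann_lie_class RE r f) = phi r f"
proof -
  have t: "tens r f \<in> carr (pre_annihilation RE)"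
    using assms by (simp add: pre_simps tens_on_closed)
  then have "ann_class RE r f \<in> carr Ann"
    unfolding ann_class_def annihilation_def ann.carr_quot by blast
  then have "ext.induced (ann_lie_class RE r f) = ext_map (0, ann_class RE r f)"
    unfolding ann_lie_class_def by (intro ext.induced_coset) (simp add: ext_simps)
  also have "\<dots> = phi r f"
    using t by (simp add: ext_map_def const_field_0 ann_class_def ann.induced_coset tmap_tens)
  finally show ?thesis .
qed

theorem theorem6p14:
  "\<exists>\<Phi>. graded_superalgebra_iso (ann_lie RE_5_10)
        (E_5_10 :: ('k::{alg_closed_field, field_char_0}, 'k vfield \<times> 'k form2) superalgebra) \<Phi> \<and>
      continuous_linear (ann_lie RE_5_10) E_5_10 \<Phi> \<and>
      (\<forall>i j M. \<Phi> (ann_lie_class RE_5_10 (re_a i j) (ps_monom 1 M)) =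
         - vf (ps_monom (of_nat (M i)) (M - unit_mexp i)) j
         + vf (ps_monom (of_nat (M j)) (M - unit_mexp j)) i) \<and>
      (\<forall>k M. \<Phi> (ann_lie_class RE_5_10 (re_b k) (ps_monom 1 M)) =
         (\<Sum>r\<in>UNIV - {k}. form (ps_monom (of_nat (M r)) (M - unit_mexp r)) k r))"
proof (intro exI conjI allI)
  show "graded_superalgebra_iso (ann_lie RE_5_10) (E_5_10 :: ('k, _) superalgebra) ext.induced"
    unfolding ann_lie_def by (rule ext.iso)
  show "continuous_linear (ann_lie RE_5_10) (E_5_10 :: ('k, _) superalgebra) ext.induced"
    unfolding ann_lie_def by (rule ext.continuous)
  fix M :: mexp
  show "ext.induced (ann_lie_class RE_5_10 (re_a i j) (ps_monom 1 M)) =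
         - vf (ps_monom (of_nat (M i)) (M - unit_mexp i)) j
         + (vf (ps_monom (of_nat (M j)) (M - unit_mexp j)) i :: 'k vfield \<times> 'k form2)" for i j
    unfolding ext_class[OF re_gen_carr(1)]
    by (rule e_eqI) (auto simp: phi_a ps_deriv_monom vf_def fun_apply(1-4))
  show "ext.induced (ann_lie_class RE_5_10 (re_b k) (ps_monom 1 M)) =
         (\<Sum>r\<in>UNIV - {k}. form (ps_monom (of_nat (M r)) (M - unit_mexp r)) k r :: 'k vfield \<times> 'k form2)" for k
    unfolding ext_class[OF re_gen_carr(2)]
  proof (rule e_eqI)
    fix p q
    let ?f = "\<lambda>r. ps_monom (of_nat (M r)) (M - unit_mexp r) :: 'k ps"
    have summand: "snd (form (?f r) k r) p q
        = ps_smult (of_bool (r = q)) (ps_smult (of_bool (p = k)) (?f r)) - ps_smult (of_bool (r = p)) (ps_smult (of_bool (q = k)) (?f r))" for r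
      unfolding form_def by (cases "r = q"; cases "p = k"; cases "r = p"; cases "q = k") simp_all
    \<comment> \<open>The term \<open>r = k\<close> may be added because \<open>form\<close> with
      equal indices is zero; the sum over all indices then collapses by Kronecker deltas.\<close>
    have "snd (\<Sum>r\<in>UNIV - {k}. form (?f r) k r) p q = (\<Sum>r\<in>UNIV. snd (form (?f r) k r) p q)"
    proof -
      have "snd (\<Sum>r\<in>UNIV - {k}. form (?f r) k r) p q = (\<Sum>r\<in>UNIV - {k}. snd (form (?f r) k r) p q)"
        unfolding snd_sum by (subst sum_apply, subst sum_apply) (rule refl)
      also have "\<dots> = (\<Sum>r\<in>UNIV. snd (form (?f r) k r) p q)"
        by (rule sum.mono_neutral_left) (auto simp: form_def)
      finally show ?thesis .
    qed
    also have "\<dots> = (\<Sum>r\<in>UNIV. ps_smult (of_bool (r = q)) (ps_smult (of_bool (p = k)) (?f r)))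
        - (\<Sum>r\<in>UNIV. ps_smult (of_bool (r = p)) (ps_smult (of_bool (q = k)) (?f r)))"
      unfolding summand sum_subtractf ..
    also have "\<dots> = snd (phi (re_b k) (ps_monom 1 M)) p q"
      unfolding sum_smult_of_bool phi_b ps_deriv_monom by simp
    finally show "snd (phi (re_b k) (ps_monom 1 M)) p q = snd (\<Sum>r\<in>UNIV - {k}. form (?f r) k r) p q" ..
  qed (simp add: phi_b fst_sum sum_apply form_def fun_apply)
qed

end
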